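(* Let $K$ be a scattered, locally compact Hausdorff space and let $X$ be a Banach space that does not contain a copy of $\ell^1$ or for which the unit ball of $X^*$ is weak$^*$ sequentially compact. Then for any non-compact operator $T:C_0(K)\to X$, $$\|T^*\|_e=\sup\{\|U\|^{-1}\|V\|^{-1}: U\in\mathscr{B}(X,c_0),\ V\in\mathscr{B}(c_0,C_0(K)),\ UTV=I_{c_0}\}.$$
   Context: All spaces are over a scalar field $\mathbb{K}$ which is either $\mathbb{R}$ or $\mathbb{C}$. $C_0(K)$ is the Banach space of continuous functions $f:K\to\mathbb{K}$ vanishing at infinity, with the supremum norm. "Operator" means bounded linear map; $\mathscr{B}(X,Y)$ and $\mathscr{K}(X,Y)$ denote the spaces of bounded and of compact operators from $X$ to $Y$. $T^*:X^*\to C_0(K)^*$ is the adjoint of $T$ and $\|T^*\|_e=\inf\{\|T^*-S\|:S\in\mathscr{K}(X^*,C_0(K)^* )\}$ is its essential norm. $I_{c_0}$ is the identity operator on $c_0$ (null scalar sequences with the supremum norm). "Contains a copy of $\ell^1$" means having a subspace linearly isomorphic to $\ell^1$. *)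

theory Defs
  imports "HOL-Analysis.Analysis"
begin

section \<open>Scalar fields and normed spaces over them\<close>

text \<open>
  A scalar field is an isometric copy of the real or of the complex numbers, so that a statement about
  an arbitrary type of this class covers both cases. In the first case \<^term>\<open>of_real\<close> is
  automatically an isometric isomorphism.
\<close>

class real_or_complex = real_normed_field + banach +
  assumes real_or_complex:
    "(\<forall>z. \<exists>r. z = r *\<^sub>R 1) \<or>
     (\<exists>h :: complex \<Rightarrow> 'a. surj h \<and>
        (\<forall>z w. h (z + w) = h z + h w) \<and> (\<forall>z w. h (z * w) = h z * h w) \<and>
        (\<forall>r. h (of_real r) = r *\<^sub>R 1) \<and> (\<forall>z. norm (h z) = norm z))"

instance real :: real_or_complex
  by standard auto

instance complex :: real_or_complex
proof
  show "(\<forall>z::complex. \<exists>r. z = r *\<^sub>R 1) \<or>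
     (\<exists>h :: complex \<Rightarrow> complex. surj h \<and>
        (\<forall>z w. h (z + w) = h z + h w) \<and> (\<forall>z w. h (z * w) = h z * h w) \<and>
        (\<forall>r. h (of_real r) = r *\<^sub>R 1) \<and> (\<forall>z. norm (h z) = norm z))"
    by (intro disjI2 exI[of _ "\<lambda>z. z"]) (auto simp: scaleR_conv_of_real)
qed

text \<open>
  The types of class \<^class>\<open>real_normed_vector\<close> only carry a multiplication by real scalars. The
  multiplication by elements of the scalar field is a parameter that extends it; for real scalars it is
  necessarily \<^term>\<open>scaleR\<close>.
\<close>

locale normed_space_over = vector_space scale
  for scale :: "'k::real_or_complex \<Rightarrow> 'x::real_normed_vector \<Rightarrow> 'x" +
  assumes scale_of_real: "scale (of_real r) x = r *\<^sub>R x"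
    and norm_scale: "norm (scale a x) = norm a * norm x"

text \<open>A \<^term>\<open>blinfun_apply T\<close> is bounded, additive and homogeneous for real scalars.\<close>

definition bounded_operators ::
  "('k::real_or_complex \<Rightarrow> 'x::real_normed_vector \<Rightarrow> 'x) \<Rightarrow>
   ('k \<Rightarrow> 'y::real_normed_vector \<Rightarrow> 'y) \<Rightarrow> ('x \<Rightarrow>\<^sub>L 'y) set" where
  "bounded_operators sX sY = {T. \<forall>a x. blinfun_apply T (sX a x) = sY a (blinfun_apply T x)}"

definition compact_operator :: "('x::real_normed_vector \<Rightarrow>\<^sub>L 'y::real_normed_vector) \<Rightarrow> bool" where
  "compact_operator T \<longleftrightarrow> compact (closure (blinfun_apply T ` cball 0 1))"


section \<open>Dual spaces, adjoints and the essential norm\<close>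

text \<open>
  Over the complex numbers the dual consists of only some of the bounded real-linear maps into the
  scalar field, so it is a subspace of a type and not a type of its own.
\<close>

definition dual :: "('k::real_or_complex \<Rightarrow> 'x::real_normed_vector \<Rightarrow> 'x) \<Rightarrow> ('x \<Rightarrow>\<^sub>L 'k) set" where
  "dual sX = bounded_operators sX (*)"

definition dual_ball :: "('k::real_or_complex \<Rightarrow> 'x::real_normed_vector \<Rightarrow> 'x) \<Rightarrow> ('x \<Rightarrow>\<^sub>L 'k) set" where
  "dual_ball sX = {\<phi> \<in> dual sX. norm \<phi> \<le> 1}"

definition dual_scale :: "'k::real_or_complex \<Rightarrow> ('x::real_normed_vector \<Rightarrow>\<^sub>L 'k) \<Rightarrow> ('x \<Rightarrow>\<^sub>L 'k)" where
  "dual_scale a \<phi> = blinfun_mult_right a o\<^sub>L \<phi>"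

lemma blinfun_apply_dual_scale [simp]: "blinfun_apply (dual_scale a \<phi>) x = a * blinfun_apply \<phi> x"
  by (simp add: dual_scale_def)

definition adjoint_op ::
  "('x::real_normed_vector \<Rightarrow>\<^sub>L 'y::real_normed_vector) \<Rightarrow>
   ('y \<Rightarrow>\<^sub>L 'k::real_or_complex) \<Rightarrow> ('x \<Rightarrow>\<^sub>L 'k)" where
  "adjoint_op T \<phi> = \<phi> o\<^sub>L T"

text \<open>
  Maps between duals are functions on the ambient types of which only the values on the dual
  \<^term>\<open>dual sX\<close> matter.
\<close>

definition dual_linear ::
  "('k::real_or_complex \<Rightarrow> 'x::real_normed_vector \<Rightarrow> 'x) \<Rightarrow>
   ('k \<Rightarrow> 'y::real_normed_vector \<Rightarrow> 'y) \<Rightarrow> (('x \<Rightarrow>\<^sub>L 'k) \<Rightarrow> ('y \<Rightarrow>\<^sub>L 'k)) \<Rightarrow> bool" where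
  "dual_linear sX sY S \<longleftrightarrow>
     (\<forall>\<phi>\<in>dual sX. S \<phi> \<in> dual sY) \<and>
     (\<forall>\<phi>\<in>dual sX. \<forall>\<psi>\<in>dual sX. S (\<phi> + \<psi>) = S \<phi> + S \<psi>) \<and>
     (\<forall>a. \<forall>\<phi>\<in>dual sX. S (dual_scale a \<phi>) = dual_scale a (S \<phi>))"

text \<open>
  \<^term>\<open>dual sY\<close> is closed in its ambient space, so the closure below is the closure within it.
  Relative compactness of the image of the unit ball includes boundedness.
\<close>

definition dual_compact_operators ::
  "('k::real_or_complex \<Rightarrow> 'x::real_normed_vector \<Rightarrow> 'x) \<Rightarrow>
   ('k \<Rightarrow> 'y::real_normed_vector \<Rightarrow> 'y) \<Rightarrow> (('x \<Rightarrow>\<^sub>L 'k) \<Rightarrow> ('y \<Rightarrow>\<^sub>L 'k)) set" where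
  "dual_compact_operators sX sY =
     {S. dual_linear sX sY S \<and> compact (closure (S ` dual_ball sX))}"

definition dual_op_norm ::
  "('k::real_or_complex \<Rightarrow> 'x::real_normed_vector \<Rightarrow> 'x) \<Rightarrow>
   (('x \<Rightarrow>\<^sub>L 'k) \<Rightarrow> ('y::real_normed_vector \<Rightarrow>\<^sub>L 'k)) \<Rightarrow> real" where
  "dual_op_norm sX R = (SUP \<phi>\<in>dual_ball sX. norm (R \<phi>))"

definition dual_essential_norm ::
  "('k::real_or_complex \<Rightarrow> 'x::real_normed_vector \<Rightarrow> 'x) \<Rightarrow>
   ('k \<Rightarrow> 'y::real_normed_vector \<Rightarrow> 'y) \<Rightarrow> (('x \<Rightarrow>\<^sub>L 'k) \<Rightarrow> ('y \<Rightarrow>\<^sub>L 'k)) \<Rightarrow> real" where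
  "dual_essential_norm sX sY R =
     (INF S\<in>dual_compact_operators sX sY. dual_op_norm sX (\<lambda>\<phi>. R \<phi> - S \<phi>))"

definition weak_star_topology ::
  "('k::real_or_complex \<Rightarrow> 'x::real_normed_vector \<Rightarrow> 'x) \<Rightarrow> ('x \<Rightarrow>\<^sub>L 'k) topology" where
  "weak_star_topology sX = pullback_topology (dual sX) blinfun_apply euclidean"

definition sequentially_compactin :: "'a topology \<Rightarrow> 'a set \<Rightarrow> bool" where
  "sequentially_compactin X A \<longleftrightarrow> A \<subseteq> topspace X \<and>
     (\<forall>f :: nat \<Rightarrow> 'a. range f \<subseteq> A \<longrightarrow>
        (\<exists>l\<in>A. \<exists>r. strict_mono r \<and> limitin X (f \<circ> r) l sequentially))"


section \<open>Scattered spaces\<close>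

definition scattered :: "'a::topological_space set \<Rightarrow> bool" where
  "scattered S \<longleftrightarrow> (\<forall>A\<subseteq>S. A \<noteq> {} \<longrightarrow> (\<exists>x. x isolated_in A))"


section \<open>Continuous functions vanishing at infinity\<close>

definition vanishes_at_infinity :: "('a::topological_space \<Rightarrow> 'b::real_normed_vector) \<Rightarrow> bool" where
  "vanishes_at_infinity f \<longleftrightarrow> (\<forall>\<epsilon>>0. compact {x. norm (f x) \<ge> \<epsilon>})"

lemma vanishes_at_infinity_dominated:
  fixes f :: "'a::topological_space \<Rightarrow> 'b::real_normed_vector"
  assumes f: "continuous_on UNIV f"
    and g: "\<And>\<epsilon>. \<epsilon> > 0 \<Longrightarrow> \<exists>C. compact C \<and> {x. norm (f x) \<ge> \<epsilon>} \<subseteq> C"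
  shows "vanishes_at_infinity f"
  unfolding vanishes_at_infinity_def
proof (intro allI impI)
  fix \<epsilon> :: real assume "\<epsilon> > 0"
  then obtain C where C: "compact C" "{x. norm (f x) \<ge> \<epsilon>} \<subseteq> C"
    using g by blast
  have "closed {x. norm (f x) \<ge> \<epsilon>}"
    by (intro closed_Collect_le continuous_intros f)
  then have "compact (C \<inter> {x. norm (f x) \<ge> \<epsilon>})"
    using C(1) by blast
  with C(2) show "compact {x. norm (f x) \<ge> \<epsilon>}"
    by (simp add: Int_absorb1)
qed

lemma vanishes_at_infinity_zero: "vanishes_at_infinity (\<lambda>x. 0)"
  by (auto simp: vanishes_at_infinity_def)

text \<open>
  Continuous functions vanishing at infinity are bounded, so nothing is lost by starting from the
  bounded continuous functions, from which the supremum norm is inherited.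
\<close>

lemma vanishes_at_infinity_bounded:
  fixes f :: "'a::topological_space \<Rightarrow> 'b::real_normed_vector"
  assumes f: "continuous_on UNIV f" and v: "vanishes_at_infinity f"
  shows "f \<in> bcontfun"
proof -
  have "compact (f ` {x. norm (f x) \<ge> 1})"
    using v by (intro compact_continuous_image continuous_on_subset[OF f])
      (auto simp: vanishes_at_infinity_def)
  then have "bounded (f ` {x. norm (f x) \<ge> 1} \<union> cball 0 1)"
    by (simp add: compact_imp_bounded)
  then have "bounded (range f)"
    by (rule bounded_subset) auto
  with f show ?thesis
    by (simp add: bcontfun_def)
qed

typedef (overloaded) ('a, 'b) C0 =
  "{f :: 'a::topological_space \<Rightarrow>\<^sub>C 'b::real_normed_vector. vanishes_at_infinity (apply_bcontfun f)}"
  morphisms bcontfun_of_C0 Abs_C0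
  using vanishes_at_infinity_zero by (intro exI[of _ 0]) (simp add: zero_bcontfun.rep_eq)

setup_lifting type_definition_C0

lift_definition apply_C0 :: "('a::topological_space, 'b::real_normed_vector) C0 \<Rightarrow> 'a \<Rightarrow> 'b"
  is apply_bcontfun .

lemma apply_C0_eqI: "(\<And>x. apply_C0 f x = apply_C0 g x) \<Longrightarrow> f = g"
  by transfer (rule bcontfun_eqI)

lemma range_apply_C0:
  "range (apply_C0 :: ('a::topological_space, 'b::real_normed_vector) C0 \<Rightarrow> _) =
     {f. continuous_on UNIV f \<and> vanishes_at_infinity f}"
proof (intro equalityI subsetI)
  fix f :: "'a \<Rightarrow> 'b" assume "f \<in> range apply_C0"
  then show "f \<in> {f. continuous_on UNIV f \<and> vanishes_at_infinity f}"
    using bcontfun_of_C0 by (auto simp: apply_C0.rep_eq)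
next
  fix f :: "'a \<Rightarrow> 'b" assume f: "f \<in> {f. continuous_on UNIV f \<and> vanishes_at_infinity f}"
  then have "f \<in> bcontfun"
    using vanishes_at_infinity_bounded by blast
  then have "apply_C0 (Abs_C0 (Bcontfun f)) = f"
    using f by (simp add: apply_C0.rep_eq Abs_C0_inverse Bcontfun_inverse)
  then show "f \<in> range apply_C0"
    by (metis rangeI)
qed

lemma vanishes_at_infinity_add:
  fixes f g :: "'a::topological_space \<Rightarrow> 'b::real_normed_vector"
  assumes "continuous_on UNIV f" "continuous_on UNIV g"
    and "vanishes_at_infinity f" "vanishes_at_infinity g"
  shows "vanishes_at_infinity (\<lambda>x. f x + g x)"
proof (rule vanishes_at_infinity_dominated)
  show "continuous_on UNIV (\<lambda>x. f x + g x)"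
    by (intro continuous_intros assms)
  fix \<epsilon> :: real assume "\<epsilon> > 0"
  let ?C = "{x. norm (f x) \<ge> \<epsilon> / 2} \<union> {x. norm (g x) \<ge> \<epsilon> / 2}"
  have "compact ?C"
    using assms(3,4) \<open>\<epsilon> > 0\<close> unfolding vanishes_at_infinity_def
    by (intro compact_Un) (meson half_gt_zero)+
  moreover have "{x. norm (f x + g x) \<ge> \<epsilon>} \<subseteq> ?C"
  proof
    fix x assume "x \<in> {x. norm (f x + g x) \<ge> \<epsilon>}"
    then show "x \<in> ?C"
      using norm_triangle_ineq[of "f x" "g x"] by auto
  qed
  ultimately show "\<exists>C. compact C \<and> {x. norm (f x + g x) \<ge> \<epsilon>} \<subseteq> C"
    by blast
qed

lemma vanishes_at_infinity_bound:
  fixes f :: "'a::topological_space \<Rightarrow> 'b::real_normed_vector"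
    and g :: "'a \<Rightarrow> 'c::real_normed_vector"
  assumes "continuous_on UNIV g" "vanishes_at_infinity f" "\<And>x. norm (g x) \<le> c * norm (f x)"
  shows "vanishes_at_infinity g"
proof (rule vanishes_at_infinity_dominated)
  show "continuous_on UNIV g" by fact
  fix \<epsilon> :: real assume "\<epsilon> > 0"
  let ?d = "\<bar>c\<bar> + 1"
  have "norm (g x) \<le> ?d * norm (f x)" for x
    using assms(3)[of x] by (rule order_trans) (intro mult_right_mono, auto)
  moreover have "\<epsilon> / ?d \<le> norm (f x)" if "\<epsilon> \<le> norm (g x)" "norm (g x) \<le> ?d * norm (f x)" for x
    using order_trans[OF that] by (simp add: divide_le_eq mult.commute)
  ultimately have "{x. norm (g x) \<ge> \<epsilon>} \<subseteq> {x. norm (f x) \<ge> \<epsilon> / ?d}"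
    by blast
  moreover have "compact {x. norm (f x) \<ge> \<epsilon> / ?d}"
    using assms(2) \<open>\<epsilon> > 0\<close> unfolding vanishes_at_infinity_def by simp
  ultimately show "\<exists>C. compact C \<and> {x. norm (g x) \<ge> \<epsilon>} \<subseteq> C"
    by blast
qed

instantiation C0 :: (topological_space, real_normed_vector) real_normed_vector
begin

lift_definition zero_C0 :: "('a, 'b) C0" is 0
  using vanishes_at_infinity_zero by (simp add: zero_bcontfun.rep_eq)

lift_definition plus_C0 :: "('a, 'b) C0 \<Rightarrow> ('a, 'b) C0 \<Rightarrow> ('a, 'b) C0" is "(+)"
  by (simp add: vanishes_at_infinity_add)

lift_definition uminus_C0 :: "('a, 'b) C0 \<Rightarrow> ('a, 'b) C0" is uminus
  by (simp add: vanishes_at_infinity_def)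

lift_definition minus_C0 :: "('a, 'b) C0 \<Rightarrow> ('a, 'b) C0 \<Rightarrow> ('a, 'b) C0" is "(-)"
proof -
  fix f g :: "'a \<Rightarrow>\<^sub>C 'b"
  assume "vanishes_at_infinity (apply_bcontfun f)" "vanishes_at_infinity (apply_bcontfun g)"
  then have "vanishes_at_infinity (\<lambda>x. apply_bcontfun f x + apply_bcontfun (- g) x)"
    by (intro vanishes_at_infinity_add continuous_on_apply_bcontfun) (auto simp: vanishes_at_infinity_def)
  then show "vanishes_at_infinity (apply_bcontfun (f - g))"
    by simp
qed

lift_definition scaleR_C0 :: "real \<Rightarrow> ('a, 'b) C0 \<Rightarrow> ('a, 'b) C0" is scaleR
  by (rule vanishes_at_infinity_bound[OF continuous_on_apply_bcontfun]) auto

lift_definition norm_C0 :: "('a, 'b) C0 \<Rightarrow> real" is norm .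

lift_definition dist_C0 :: "('a, 'b) C0 \<Rightarrow> ('a, 'b) C0 \<Rightarrow> real" is dist .

definition sgn_C0 :: "('a, 'b) C0 \<Rightarrow> ('a, 'b) C0" where
  "sgn_C0 f = scaleR (inverse (norm f)) f"

definition uniformity_C0 :: "(('a, 'b) C0 \<times> ('a, 'b) C0) filter" where
  "uniformity_C0 = (INF e\<in>{0 <..}. principal {(f, g). dist f g < e})"

definition open_C0 :: "('a, 'b) C0 set \<Rightarrow> bool" where
  "open_C0 S = (\<forall>f\<in>S. \<forall>\<^sub>F (f', g) in uniformity. f' = f \<longrightarrow> g \<in> S)"

instance
proof
  fix f g h :: "('a, 'b) C0" and a b :: real
  show "f + g + h = f + (g + h)" by transfer (rule add.assoc)
  show "f + g = g + f" by transfer (rule add.commute)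
  show "0 + f = f" by transfer simp
  show "- f + f = 0" by transfer simp
  show "f - g = f + - g" by transfer simp
  show "a *\<^sub>R (f + g) = a *\<^sub>R f + a *\<^sub>R g" by transfer (rule scaleR_add_right)
  show "(a + b) *\<^sub>R f = a *\<^sub>R f + b *\<^sub>R f" by transfer (rule scaleR_add_left)
  show "a *\<^sub>R b *\<^sub>R f = (a * b) *\<^sub>R f" by transfer simp
  show "1 *\<^sub>R f = f" by transfer simp
  show "dist f g = norm (f - g)" by transfer (rule dist_norm)
  show "norm f = 0 \<longleftrightarrow> f = 0" by transfer simp
  show "norm (f + g) \<le> norm f + norm g" by transfer (rule norm_triangle_ineq)
  show "norm (a *\<^sub>R f) = \<bar>a\<bar> * norm f" by transfer simp
qed (rule sgn_C0_def uniformity_C0_def open_C0_def)+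

end

lemma norm_C0_eq: "norm f = (SUP x. norm (apply_C0 f x))"
  by transfer (simp add: norm_bcontfun_def dist_bcontfun.rep_eq)

lemma norm_apply_C0_le: "norm (apply_C0 f x) \<le> norm f"
  by transfer (rule norm_bounded)

lemma apply_C0_simps [simp]:
  "apply_C0 0 x = 0"
  "apply_C0 (f + g) x = apply_C0 f x + apply_C0 g x"
  "apply_C0 (- f) x = - apply_C0 f x"
  "apply_C0 (f - g) x = apply_C0 f x - apply_C0 g x"
  "apply_C0 (r *\<^sub>R f) x = r *\<^sub>R apply_C0 f x"
  by (transfer; simp)+

instance C0 :: (topological_space, banach) banach
proof
  fix X :: "nat \<Rightarrow> ('a, 'b) C0"
  assume X: "Cauchy X"
  have le: "norm (apply_C0 (X m) x - apply_C0 (X n) x) \<le> norm (X m - X n)" for m n x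
    using norm_apply_C0_le[of "X m - X n" x] by simp
  have "Cauchy (\<lambda>n. apply_C0 (X n) x)" for x
    using X unfolding Cauchy_iff by (meson le le_less_trans)
  then have lim: "(\<lambda>n. apply_C0 (X n) x) \<longlonglongrightarrow> lim (\<lambda>n. apply_C0 (X n) x)" for x
    using Cauchy_convergent convergent_LIMSEQ_iff by blast
  define l where "l = (\<lambda>x. lim (\<lambda>n. apply_C0 (X n) x))"
  have l: "(\<lambda>n. apply_C0 (X n) x) \<longlonglongrightarrow> l x" for x
    using lim by (simp add: l_def)
  have unif: "\<exists>N. \<forall>n\<ge>N. \<forall>x. norm (apply_C0 (X n) x - l x) \<le> e" if e: "e > 0" for e
  proof -
    obtain N where N: "norm (X m - X n) < e" if "m \<ge> N" "n \<ge> N" for m n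
      using X e unfolding Cauchy_iff by meson
    have "norm (apply_C0 (X n) x - l x) \<le> e" if n: "n \<ge> N" for n x
    proof (rule tendsto_upperbound)
      show "(\<lambda>m. norm (apply_C0 (X n) x - apply_C0 (X m) x)) \<longlonglongrightarrow> norm (apply_C0 (X n) x - l x)"
        by (intro tendsto_intros l)
      show "\<forall>\<^sub>F m in sequentially. norm (apply_C0 (X n) x - apply_C0 (X m) x) \<le> e"
        using le N n by (intro eventually_sequentiallyI[of N]) (meson less_imp_le order_trans)
    qed simp
    then show ?thesis by blast
  qed
  have cX: "continuous_on UNIV (apply_C0 f)" and vX: "vanishes_at_infinity (apply_C0 f)"
    for f :: "('a, 'b) C0"
    using range_apply_C0 by blast+
  have ul: "uniform_limit UNIV (\<lambda>n. apply_C0 (X n)) l sequentially"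
  proof (rule uniform_limitI)
    fix e :: real assume "e > 0"
    then obtain N where N: "norm (apply_C0 (X n) x - l x) \<le> e / 2" if "n \<ge> N" for n x
      using unif[of "e / 2"] by (meson half_gt_zero)
    have "dist (apply_C0 (X n) x) (l x) < e" if "n \<ge> N" for n x
      using N[OF that, of x] \<open>e > 0\<close> unfolding dist_norm by linarith
    then show "\<forall>\<^sub>F n in sequentially. \<forall>x\<in>UNIV. dist (apply_C0 (X n) x) (l x) < e"
      by (intro eventually_sequentiallyI[of N]) blast
  qed
  have cl: "continuous_on UNIV l"
    by (rule uniform_limit_theorem[OF _ ul]) (auto simp: cX)
  have "vanishes_at_infinity l"
  proof (rule vanishes_at_infinity_dominated[OF cl])
    fix e :: real assume "e > 0"
    then obtain N where N: "norm (apply_C0 (X N) x - l x) \<le> e / 2" for x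
      using unif[of "e / 2"] by (meson half_gt_zero order_refl)
    have "{x. norm (l x) \<ge> e} \<subseteq> {x. norm (apply_C0 (X N) x) \<ge> e / 2}"
    proof
      fix x assume "x \<in> {x. norm (l x) \<ge> e}"
      then show "x \<in> {x. norm (apply_C0 (X N) x) \<ge> e / 2}"
        using N[of x] norm_triangle_ineq2[of "l x" "apply_C0 (X N) x"]
        by (simp add: norm_minus_commute)
    qed
    moreover have "compact {x. norm (apply_C0 (X N) x) \<ge> e / 2}"
      using vX[of "X N"] \<open>e > 0\<close> unfolding vanishes_at_infinity_def by (meson half_gt_zero)
    ultimately show "\<exists>C. compact C \<and> {x. norm (l x) \<ge> e} \<subseteq> C" by blast
  qed
  then obtain L where L: "l = apply_C0 L"
    using cl range_apply_C0[where 'a='a and 'b='b] by blast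
  have "X \<longlonglongrightarrow> L"
  proof (rule LIMSEQ_I)
    fix e :: real assume "e > 0"
    then obtain N where N: "norm (apply_C0 (X n) x - l x) \<le> e / 2" if "n \<ge> N" for n x
      using unif[of "e / 2"] by (meson half_gt_zero)
    have "norm (X n - L) \<le> e / 2" if "n \<ge> N" for n
      unfolding norm_C0_eq using N[OF that] by (intro cSUP_least) (auto simp: L)
    moreover have "e / 2 < e"
      using \<open>e > 0\<close> by simp
    ultimately show "\<exists>N. \<forall>n\<ge>N. norm (X n - L) < e"
      by (meson le_less_trans)
  qed
  then show "convergent X"
    by (auto simp: convergent_def)
qed

lift_definition scaleC0 ::
  "'k::real_or_complex \<Rightarrow> ('a::topological_space, 'k) C0 \<Rightarrow> ('a, 'k) C0"
  is "\<lambda>a f. Bcontfun (\<lambda>x. a * apply_bcontfun f x)"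
proof -
  fix a :: 'k and f :: "'a \<Rightarrow>\<^sub>C 'k"
  assume f: "vanishes_at_infinity (apply_bcontfun f)"
  have c: "continuous_on UNIV (\<lambda>x. a * apply_bcontfun f x)"
    by (intro continuous_intros) auto
  have v: "vanishes_at_infinity (\<lambda>x. a * apply_bcontfun f x)"
    by (rule vanishes_at_infinity_bound[OF c f, of "norm a"]) (simp add: norm_mult)
  show "vanishes_at_infinity (apply_bcontfun (Bcontfun (\<lambda>x. a * apply_bcontfun f x)))"
    using v vanishes_at_infinity_bounded[OF c v] by (simp add: Bcontfun_inverse)
qed

lemma apply_scaleC0 [simp]: "apply_C0 (scaleC0 a f) x = a * apply_C0 f x"
proof -
  have c: "continuous_on UNIV (\<lambda>x. a * apply_C0 f x)"
    by (intro continuous_intros) (simp add: apply_C0.rep_eq)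
  have "vanishes_at_infinity (apply_C0 f)"
    using range_apply_C0 by blast
  then have v: "vanishes_at_infinity (\<lambda>x. a * apply_C0 f x)"
    by (rule vanishes_at_infinity_bound[OF c, of _ "norm a"]) (simp add: norm_mult)
  show ?thesis
    using vanishes_at_infinity_bounded[OF c v]
    by (simp add: apply_C0.rep_eq scaleC0.rep_eq Bcontfun_inverse)
qed

lemma normed_space_over_scaleC0:
  "normed_space_over
     (scaleC0 :: 'k::real_or_complex \<Rightarrow> ('a::topological_space, 'k) C0 \<Rightarrow> ('a, 'k) C0)"
proof
  fix a :: 'k and f :: "('a, 'k) C0"
  have le: "norm (scaleC0 c g) \<le> norm c * norm g" for c :: 'k and g :: "('a, 'k) C0"
    unfolding norm_C0_eq[of "scaleC0 c g"]
    by (intro cSUP_least) (auto simp: norm_mult intro: mult_left_mono norm_apply_C0_le)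
  show "norm (scaleC0 a f) = norm a * norm f"
  proof (cases "a = 0")
    case True
    then show ?thesis using le[of a f] by simp
  next
    case False
    have "scaleC0 (inverse a) (scaleC0 a f) = f"
      by (rule apply_C0_eqI) (simp add: False)
    then have "norm f \<le> norm (inverse a) * norm (scaleC0 a f)"
      using le[of "inverse a" "scaleC0 a f"] by simp
    then have "norm a * norm f \<le> norm (scaleC0 a f)"
      using False unfolding nonzero_norm_inverse[OF False] by (simp add: field_simps)
    with le[of a f] show ?thesis by simp
  qed
qed (auto intro!: apply_C0_eqI simp: algebra_simps scaleR_conv_of_real)


section \<open>The sequence spaces\<close>

text \<open>
  The space of null sequences is the space of continuous functions vanishing at infinity on the
  discrete space of natural numbers.
\<close>

type_synonym 'k c0 = "(nat, 'k) C0"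

lemma range_apply_c0:
  "range (apply_C0 :: 'k::real_normed_vector c0 \<Rightarrow> _) = {f. f \<longlonglongrightarrow> 0}"
proof -
  have "vanishes_at_infinity f \<longleftrightarrow> f \<longlonglongrightarrow> 0" for f :: "nat \<Rightarrow> 'k"
  proof -
    have *: "{x. \<not> norm (f x) < e} = {x. norm (f x) \<ge> e}" for e
      by auto
    have "f \<longlonglongrightarrow> 0 \<longleftrightarrow> (\<forall>e>0. finite {x. norm (f x) \<ge> e})"
      unfolding tendsto_iff dist_norm cofinite_eq_sequentially[symmetric] eventually_cofinite
      by (simp add: *)
    moreover have "compact A \<longleftrightarrow> finite A" for A :: "nat set"
    proof
      assume "compact A"
      then obtain C where "finite C" "A \<subseteq> (\<Union>n\<in>C. {n})"
        by (rule compactE_image[of A A "\<lambda>n. {n}"]) (auto simp: open_discrete)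
      then show "finite A"
        using finite_subset by auto
    qed (rule finite_imp_compact)
    ultimately show ?thesis
      by (simp add: vanishes_at_infinity_def)
  qed
  then show ?thesis
    unfolding range_apply_C0 by simp
qed

typedef (overloaded) 'k l1 = "{f :: nat \<Rightarrow> 'k::real_normed_vector. summable (\<lambda>n. norm (f n))}"
  morphisms apply_l1 Abs_l1
  by (intro exI[of _ "\<lambda>_. 0"]) simp

setup_lifting type_definition_l1

instantiation l1 :: (real_normed_vector) real_normed_vector
begin

lift_definition zero_l1 :: "'a l1" is "\<lambda>_. 0"
  by simp

lift_definition plus_l1 :: "'a l1 \<Rightarrow> 'a l1 \<Rightarrow> 'a l1" is "\<lambda>f g n. f n + g n"
proof -
  fix f g :: "nat \<Rightarrow> 'a"
  assume "summable (\<lambda>n. norm (f n))" "summable (\<lambda>n. norm (g n))"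
  from summable_add[OF this] show "summable (\<lambda>n. norm (f n + g n))"
    by (rule summable_comparison_test') (simp add: norm_triangle_ineq)
qed

lift_definition uminus_l1 :: "'a l1 \<Rightarrow> 'a l1" is "\<lambda>f n. - f n"
  by simp

lift_definition minus_l1 :: "'a l1 \<Rightarrow> 'a l1 \<Rightarrow> 'a l1" is "\<lambda>f g n. f n - g n"
proof -
  fix f g :: "nat \<Rightarrow> 'a"
  assume "summable (\<lambda>n. norm (f n))" "summable (\<lambda>n. norm (g n))"
  from summable_add[OF this] show "summable (\<lambda>n. norm (f n - g n))"
    by (rule summable_comparison_test') (simp add: norm_triangle_ineq4)
qed

lift_definition scaleR_l1 :: "real \<Rightarrow> 'a l1 \<Rightarrow> 'a l1" is "\<lambda>r f n. r *\<^sub>R f n"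
  by (simp add: summable_mult)

lift_definition norm_l1 :: "'a l1 \<Rightarrow> real" is "\<lambda>f. \<Sum>n. norm (f n)" .

definition dist_l1 :: "'a l1 \<Rightarrow> 'a l1 \<Rightarrow> real" where
  "dist_l1 f g = norm (f - g)"

definition sgn_l1 :: "'a l1 \<Rightarrow> 'a l1" where
  "sgn_l1 f = scaleR (inverse (norm f)) f"

definition uniformity_l1 :: "('a l1 \<times> 'a l1) filter" where
  "uniformity_l1 = (INF e\<in>{0 <..}. principal {(f, g). dist f g < e})"

definition open_l1 :: "'a l1 set \<Rightarrow> bool" where
  "open_l1 S = (\<forall>f\<in>S. \<forall>\<^sub>F (f', g) in uniformity. f' = f \<longrightarrow> g \<in> S)"

instance
proof
  fix f g h :: "'a l1" and a b :: real
  show "f + g + h = f + (g + h)" by transfer (simp add: add.assoc)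
  show "f + g = g + f" by transfer (simp add: add.commute)
  show "0 + f = f" by transfer simp
  show "- f + f = 0" by transfer simp
  show "f - g = f + - g" by transfer simp
  show "a *\<^sub>R (f + g) = a *\<^sub>R f + a *\<^sub>R g" by transfer (simp add: scaleR_add_right)
  show "(a + b) *\<^sub>R f = a *\<^sub>R f + b *\<^sub>R f" by transfer (simp add: scaleR_add_left)
  show "a *\<^sub>R b *\<^sub>R f = (a * b) *\<^sub>R f" by transfer simp
  show "1 *\<^sub>R f = f" by transfer simp
  show "norm f = 0 \<longleftrightarrow> f = 0"
    by transfer (auto simp: suminf_eq_zero_iff)
  show "norm (f + g) \<le> norm f + norm g"
  proof transfer
    fix f g :: "nat \<Rightarrow> 'a"
    assume *: "summable (\<lambda>n. norm (f n))" "summable (\<lambda>n. norm (g n))"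
    have "summable (\<lambda>n. norm (f n + g n))"
      by (rule summable_comparison_test'[OF summable_add[OF *]]) (simp add: norm_triangle_ineq)
    then have "(\<Sum>n. norm (f n + g n)) \<le> (\<Sum>n. norm (f n) + norm (g n))"
      by (intro suminf_le norm_triangle_ineq summable_add *)
    also have "\<dots> = (\<Sum>n. norm (f n)) + (\<Sum>n. norm (g n))"
      by (rule suminf_add[OF *, symmetric])
    finally show "(\<Sum>n. norm (f n + g n)) \<le> (\<Sum>n. norm (f n)) + (\<Sum>n. norm (g n))" .
  qed
  show "norm (a *\<^sub>R f) = \<bar>a\<bar> * norm f"
    by transfer (simp add: suminf_mult)
qed (rule dist_l1_def sgn_l1_def uniformity_l1_def open_l1_def)+

end

lift_definition scale_l1 :: "'k::real_or_complex \<Rightarrow> 'k l1 \<Rightarrow> 'k l1" is "\<lambda>a f n. a * f n"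
  by (simp add: norm_mult summable_mult)

text \<open>The subspace that is isomorphic to the sequence space is the range of the embedding.\<close>

definition contains_copy_of_l1 ::
  "('k::real_or_complex \<Rightarrow> 'x::real_normed_vector \<Rightarrow> 'x) \<Rightarrow> bool" where
  "contains_copy_of_l1 sX \<longleftrightarrow>
     (\<exists>J \<in> bounded_operators scale_l1 sX. \<exists>J'. homeomorphism UNIV (range (blinfun_apply J)) (blinfun_apply J) J')"

end

theory Submission
  imports Defs
begin

text \<open>
  Throughout, \<open>K\<close> is the underlying space and \<open>X\<close> the target space.

  \<^bold>\<open>The lower estimate.\<close> Suppose \<open>U T V = I\<close>. The functionals \<open>e\<^sub>n \<circ> U\<close> are bounded by \<open>\<parallel>U\<parallel>\<close>, and \<open>T\<^sup>*(e\<^sub>m \<circ> U - e\<^sub>n \<circ> U)\<close>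
  takes the value 2 at the vector \<open>V (e\<^sub>m - e\<^sub>n)\<close>, whose norm is at most \<open>\<parallel>V\<parallel>\<close>. A compact operator nearly
  identifies two of these functionals, so it cannot be closer to \<open>T\<^sup>*\<close> than \<open>\<parallel>U\<parallel>\<^sup>-\<^sup>1 \<parallel>V\<parallel>\<^sup>-\<^sup>1\<close>
  (\<open>factorization_le_essential_norm\<close>).

  \<^bold>\<open>The upper estimate.\<close> Let \<open>0 < c\<close> be less than the essential norm. Five facts are combined.

  \<^item> Since \<open>K\<close> is scattered, the dual of the space of functions is the space of summable families of point
    masses (\<open>scattered_imp_atomic\<close>, \<open>dual_approx_point_masses\<close>). Restricting \<open>T\<^sup>* \<phi>\<close> to a finite set of points
    is a compact operation, so for every finite \<open>F\<close> some \<open>\<phi>\<close> in the dual ball gives \<open>T\<^sup>* \<phi>\<close> a mass above \<open>c\<close> on a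
    finite set outside \<open>F\<close> (\<open>large_outside_finite_set\<close>). This produces \<open>\<phi>\<^sub>n\<close> and pairwise disjoint
    finite sets \<open>G\<^sub>n\<close>.

  \<^item> After passing to a subsequence and losing a little mass, the sets \<open>G\<^sub>n\<close> have pairwise disjoint open
    neighbourhoods (\<open>disjoint_neighbourhoods\<close>), so \<open>\<phi>\<^sub>n (T f\<^sub>n)\<close> is nearly at least \<open>c\<close> for suitable disjointly
    supported \<open>f\<^sub>n\<close> in the unit ball.

  \<^item> By Rosenthal's lemma (\<open>rosenthal_selection\<close>) a further subsequence makes the matrix
    \<open>\<phi>\<^sub>i (T f\<^sub>j)\<close> almost diagonal, uniformly in the rows.

  \<^item> The functionals \<open>\<phi>\<^sub>n\<close> have finite successive combinations \<open>w\<^sub>n\<close> whose coefficients have absolute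
    sum one and that form a weak-star null sequence (\<open>weak_star_null_block_seq\<close>). If the dual ball is weak-star
    sequentially compact, half-differences of a convergent subsequence will do. Otherwise the argument of Hagler
    and Johnson applies: among all such block sequences one is chosen whose asymptotic size
    \<open>sup\<^sub>u limsup\<^sub>n \<bar>w\<^sub>n u\<bar>\<close> cannot be decreased by taking blocks again, and if this size is positive,
    then averages with signs yield a sequence of vectors on which the functionals realize all patterns of signs; such a
    sequence spans a copy of the space of summable sequences.

  \<^item> With \<open>g\<^sub>n\<close> the combination of the \<open>f\<^sub>i\<close> with the signs of the coefficients of \<open>w\<^sub>n\<close>, the matrix
    \<open>w\<^sub>m (T g\<^sub>n)\<close> is again almost diagonal, with diagonal nearly at least \<open>c\<close>, because the coefficients have absolute
    sum one (\<open>almost_biorthogonal_blocks\<close>). Hence, after division by the diagonal, \<open>V a = \<Sum> a\<^sub>n g\<^sub>n\<close> and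
    \<open>U x = (w\<^sub>n x)\<^sub>n\<close> satisfy \<open>U T V = I + E\<close> with \<open>\<parallel>E\<parallel> < 1\<close>, and inverting \<open>I + E\<close> gives the factorization
    (\<open>factorization_of_identity\<close>).

  The essential norm of the adjoint of a non-compact operator is positive, by the half of Schauder's
  theorem that passes from the adjoint to the operator (\<open>essential_norm_pos\<close>), so such factorizations exist and the supremum is not taken over the empty set. The
  norming functionals needed for this come from a proof of the Hahn--Banach theorem.
\<close>


section \<open>The scalar field\<close>

text \<open>
  Real and imaginary parts, available uniformly for both kinds of scalar field; over the real numbers the imaginary part is zero.
\<close>

lemma real_or_complex_parts:
  obtains re im :: "'k::real_or_complex \<Rightarrow> real" where
    "\<And>z w. re (z + w) = re z + re w" "\<And>z w. im (z + w) = im z + im w"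
    "\<And>r z. re (of_real r * z) = r * re z" "\<And>r z. im (of_real r * z) = r * im z"
    "\<And>r. re (of_real r) = r" "\<And>z. (norm z)\<^sup>2 = (re z)\<^sup>2 + (im z)\<^sup>2"
proof (cases "\<forall>z::'k. \<exists>r. z = r *\<^sub>R 1")
  case True
  then have ex: "\<exists>r. z = of_real r" for z :: 'k
    by (simp add: of_real_def)
  define re where "re = (\<lambda>z::'k. SOME r. z = of_real r)"
  have re: "of_real (re z) = z" for z
    unfolding re_def using someI_ex[OF ex[of z]] by simp
  have re_of: "re (of_real r) = r" for r
    using re[of "of_real r"] by simp
  have "re (z + w) = re z + re w" "re (of_real r * z) = r * re z" for z w r
    by (metis re re_of of_real_add, metis re re_of of_real_mult)
  moreover have "(norm z)\<^sup>2 = (re z)\<^sup>2 + 0\<^sup>2" for z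
    by (metis re norm_of_real power2_abs add.right_neutral zero_power2)
  ultimately show ?thesis
    using re_of by (intro that[of re "\<lambda>_. 0"]) auto
next
  case False
  then obtain h :: "complex \<Rightarrow> 'k" where h: "surj h"
    "\<And>z w. h (z + w) = h z + h w" "\<And>z w. h (z * w) = h z * h w"
    "\<And>r. h (of_real r) = of_real r" "\<And>z. norm (h z) = norm z"
    using real_or_complex[where 'a='k] unfolding of_real_def[where 'a='k] by blast
  define g where "g = inv h"
  have hg: "h (g z) = z" for z
    by (simp add: g_def h(1) surj_f_inv_f)
  have h_diff: "h (z - w) = h z - h w" for z w
    using h(2)[of "z - w" w] by (simp add: algebra_simps)
  have gh: "g (h z) = z" for z
  proof -
    have "norm (g (h z) - z) = norm (h (g (h z)) - h z)"
      by (metis h(5) h_diff)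
    then show ?thesis by (simp add: hg)
  qed
  have g: "g (z + w) = g z + g w" "g (of_real r * z) = of_real r * g z" for z w r
    by (metis gh hg h(2), metis gh hg h(3,4))
  show ?thesis
  proof (rule that[of "\<lambda>z. Re (g z)" "\<lambda>z. Im (g z)"])
    show "Re (g (of_real r)) = r" for r
      by (metis gh h(4) Re_complex_of_real)
    show "(norm z)\<^sup>2 = (Re (g z))\<^sup>2 + (Im (g z))\<^sup>2" for z
      by (metis h(5) hg cmod_power2)
  qed (simp_all add: g)
qed

lemma compact_cball_scalar: "compact (cball (0::'k::real_or_complex) r)"
proof (cases "\<forall>z::'k. \<exists>r. z = r *\<^sub>R 1")
  case True
  have "cball (0::'k) r = of_real ` {-r..r}"
  proof (intro equalityI subsetI)
    fix z :: 'k assume z: "z \<in> cball 0 r"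
    obtain s where "z = of_real s" using True by (auto simp: of_real_def)
    with z show "z \<in> of_real ` {-r..r}" by (auto simp: abs_le_iff)
  qed auto
  then show ?thesis
    by (simp add: compact_continuous_image continuous_on_of_real continuous_on_id)
next
  case False
  then obtain h :: "complex \<Rightarrow> 'k" where h: "surj h"
    "\<And>z w. h (z + w) = h z + h w" "\<And>z. norm (h z) = norm z"
    using real_or_complex[where 'a='k] by blast
  have "h (z - w) = h z - h w" for z w
    using h(2)[of "z - w" w] by (simp add: algebra_simps)
  then have "continuous_on UNIV h"
    using h(3) unfolding continuous_on_iff dist_norm by metis
  moreover have "cball 0 r = h ` cball 0 r"
  proof (intro equalityI subsetI)
    fix z :: 'k assume "z \<in> cball 0 r"
    then show "z \<in> h ` cball 0 r" using h(1,3) by (metis imageI mem_cball_0 surjD)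
  qed (use h(3) in auto)
  ultimately show ?thesis
    by (metis compact_continuous_image compact_cball continuous_on_subset subset_UNIV)
qed

text \<open>A scalar of modulus one that rotates a given scalar onto the nonnegative real axis; it is 1 at 0.\<close>

definition unit_conj :: "'k::real_normed_field \<Rightarrow> 'k" where
  "unit_conj z = (if z = 0 then 1 else of_real (norm z) / z)"

lemma norm_unit_conj [simp]: "norm (unit_conj z) = 1"
  by (simp add: unit_conj_def norm_divide)

lemma unit_conj_mult [simp]: "unit_conj z * z = of_real (norm z)" "z * unit_conj z = of_real (norm z)"
  by (simp_all add: unit_conj_def)

section \<open>The Hahn--Banach theorem\<close>

text \<open>
  The proof is by minimal sublinear functionals: Zorn's lemma provides a minimal one below any given sublinear
  functional, and a minimal one is linear. All functionals are defined on the whole space.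
\<close>

definition sublinear :: "('x::real_vector \<Rightarrow> real) \<Rightarrow> bool" where
  "sublinear p \<longleftrightarrow> (\<forall>x y. p (x + y) \<le> p x + p y) \<and> (\<forall>t\<ge>0. \<forall>x. p (t *\<^sub>R x) = t * p x)"

lemma sublinearI:
  assumes "\<And>x y. p (x + y) \<le> p x + p y" "p 0 = 0" "\<And>t x. t > 0 \<Longrightarrow> p (t *\<^sub>R x) \<le> t * p x"
  shows "sublinear p"
proof -
  have "t * p x \<le> p (t *\<^sub>R x)" if "t > 0" for t x
    using assms(3)[of "inverse t" "t *\<^sub>R x"] that by (simp add: field_simps)
  then have "p (t *\<^sub>R x) = t * p x" if "t \<ge> 0" for t x
    using assms(2,3) that by (cases "t = 0") (auto intro!: antisym)
  with assms(1) show ?thesis by (simp add: sublinear_def)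
qed

lemma sublinear_lower: "sublinear p \<Longrightarrow> - p (- x) \<le> p x"
proof -
  assume p: "sublinear p"
  then have "p 0 = 0"
    unfolding sublinear_def by (metis mult_zero_left order_refl scale_zero_left)
  moreover have "p 0 \<le> p x + p (- x)"
    using p unfolding sublinear_def by (metis add.right_inverse)
  ultimately show ?thesis by simp
qed

text \<open>
  The functional \<open>x \<mapsto> inf\<^sub>t\<^sub>\<ge>\<^sub>0 q (x + t y) - t q y\<close> is sublinear and below \<open>q\<close>. It serves twice: a minimal \<open>q\<close> coincides with
  it for every \<open>y\<close>, which makes \<open>q\<close> odd; and a linear functional below it for \<open>q = norm\<close> attains the norm at \<open>y\<close>.
\<close>

lemma sublinear_shrink:
  assumes q: "sublinear q"
  shows "\<exists>q'. sublinear q' \<and> (\<forall>x. q' x \<le> q x) \<and> q' (- y) \<le> - q y"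
proof -
  define q' where "q' = (\<lambda>x. INF t\<in>{0..}. q (x + t *\<^sub>R y) - t * q y)"
  have add: "q (a + b) \<le> q a + q b" and scale: "t \<ge> 0 \<Longrightarrow> q (t *\<^sub>R a) = t * q a" for a b t
    using q by (auto simp: sublinear_def)
  have q0: "q 0 = 0" using scale[of 0 0] by simp
  have lower: "- q (- x) \<le> q (x + t *\<^sub>R y) - t * q y" if "t \<ge> 0" for x t
    using add[of "x + t *\<^sub>R y" "- x"] scale[OF that, of y] by simp
  then have bdd: "bdd_below ((\<lambda>t. q (x + t *\<^sub>R y) - t * q y) ` {0..})" for x
    by (intro bdd_belowI2) auto
  have le: "q' x \<le> q (x + t *\<^sub>R y) - t * q y" if "t \<ge> 0" for x t
    unfolding q'_def using that by (intro cINF_lower bdd) auto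
  have "sublinear q'"
  proof (rule sublinearI)
    fix x x'
    have *: "q' (x + x') - (q (x' + s *\<^sub>R y) - s * q y) \<le> q (x + t *\<^sub>R y) - t * q y"
      if "t \<ge> 0" "s \<ge> 0" for s t
      using le[of "t + s" "x + x'"] add[of "x + t *\<^sub>R y" "x' + s *\<^sub>R y"] that
      by (simp add: algebra_simps)
    have "q' (x + x') - (q (x' + s *\<^sub>R y) - s * q y) \<le> q' x" if "s \<ge> 0" for s
      using *[OF _ that] unfolding q'_def[THEN fun_cong, of x] by (intro cINF_greatest) auto
    then have "q' (x + x') - q' x \<le> q' x'"
      unfolding q'_def[THEN fun_cong, of x'] by (intro cINF_greatest) (auto simp: algebra_simps)
    then show "q' (x + x') \<le> q' x + q' x'" by simp
  next
    have "q (0 + t *\<^sub>R y) - t * q y = 0" if "t \<ge> 0" for t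
      using scale[OF that] by simp
    then have "q' 0 = (INF t\<in>{0::real..}. 0)" unfolding q'_def by (intro arg_cong[where f=Inf] image_cong refl) simp
    then show "q' 0 = 0" by simp
  next
    fix t :: real and x assume t: "t > 0"
    have "q' (t *\<^sub>R x) / t \<le> q (x + s *\<^sub>R y) - s * q y" if "s \<ge> 0" for s
    proof -
      have "q' (t *\<^sub>R x) \<le> q (t *\<^sub>R (x + s *\<^sub>R y)) - (t * s) * q y"
        using le[of "t * s" "t *\<^sub>R x"] t that by (simp add: algebra_simps)
      also have "\<dots> = t * (q (x + s *\<^sub>R y) - s * q y)"
        using scale[of t "x + s *\<^sub>R y"] t by (simp add: algebra_simps)
      finally show ?thesis using t by (simp add: field_simps)
    qed
    then have "q' (t *\<^sub>R x) / t \<le> q' x"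
      unfolding q'_def[THEN fun_cong, of x] by (intro cINF_greatest) auto
    then show "q' (t *\<^sub>R x) \<le> t * q' x" using t by (simp add: field_simps)
  qed
  moreover have "q' x \<le> q x" for x using le[of 0 x] by simp
  moreover have "q' (- y) \<le> - q y" using le[of 1 "- y"] q0 by simp
  ultimately show ?thesis by blast
qed

lemma sublinear_dominates_linear:
  assumes p: "sublinear p"
  shows "\<exists>g. linear g \<and> (\<forall>x. g x \<le> p x)"
proof -
  define A where "A = {q. sublinear q \<and> (\<forall>x. q x \<le> p x)}"
  have lower: "- p (- x) \<le> q x" if "q \<in> A" for q x
  proof -
    have "- q (- x) \<le> q x" "q (- x) \<le> p (- x)"
      using sublinear_lower[of q x] that by (auto simp: A_def)
    then show ?thesis by linarith
  qed
  have "\<exists>m\<in>A. \<forall>q\<in>A. (\<forall>x. q x \<le> m x) \<longrightarrow> q = m"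
  proof (rule predicate_Zorn)
    show "partial_order_on A (relation_of (\<lambda>q q'. \<forall>x. q' x \<le> q x) A)"
      by (rule partial_order_on_relation_ofI) (auto intro: order_trans simp: fun_eq_iff order_antisym)
  next
    fix C assume "C \<in> Chains (relation_of (\<lambda>q q'. \<forall>x. q' x \<le> q x) A)"
    then have CA: "C \<subseteq> A" and chain: "\<And>q q'. q \<in> C \<Longrightarrow> q' \<in> C \<Longrightarrow> (\<forall>x. q' x \<le> q x) \<or> (\<forall>x. q x \<le> q' x)"
      unfolding Chains_def relation_of_def by blast+
    show "\<exists>u\<in>A. \<forall>a\<in>C. \<forall>x. u x \<le> a x"
    proof (cases "C = {}")
      case True
      then show ?thesis using p by (auto simp: A_def)
    next
      case False
      define u where "u = (\<lambda>x. INF q\<in>C. q x)"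
      have le: "u x \<le> q x" if "q \<in> C" for q x
        unfolding u_def using that lower CA
        by (intro cINF_lower bdd_belowI2[of _ "- p (- x)"]) auto
      have gr: "c \<le> u x" if "\<And>q. q \<in> C \<Longrightarrow> c \<le> q x" for c x
        unfolding u_def using that False by (intro cINF_greatest)
      have sub: "sublinear q" if "q \<in> C" for q using CA that by (auto simp: A_def)
      have "sublinear u"
      proof (rule sublinearI)
        fix x y
        have *: "u (x + y) \<le> q x + q' y" if "q \<in> C" "q' \<in> C" for q q'
        proof -
          have "\<exists>r\<in>C. r x \<le> q x \<and> r y \<le> q' y"
            using chain[OF that] that by blast
          then obtain r where r: "r \<in> C" "r x \<le> q x" "r y \<le> q' y" by blast
          have "u (x + y) \<le> r x + r y"
            using le[OF r(1), of "x + y"] sub[OF r(1)] unfolding sublinear_def by (meson order_trans)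
          with r show ?thesis by linarith
        qed
        have "u (x + y) - q' y \<le> u x" if "q' \<in> C" for q'
          using *[OF _ that] by (intro gr) (simp add: algebra_simps)
        then have "u (x + y) - u x \<le> u y"
          by (intro gr) (simp add: algebra_simps)
        then show "u (x + y) \<le> u x + u y" by simp
      next
        have "q 0 = 0" if "q \<in> C" for q
          using sub[OF that] unfolding sublinear_def by (metis mult_zero_left order_refl scale_zero_left)
        then have "u 0 = (INF q\<in>C. 0)" unfolding u_def by (intro arg_cong[where f=Inf] image_cong refl) simp
        then show "u 0 = 0" using False by simp
      next
        fix t :: real and x assume t: "t > 0"
        have "u (t *\<^sub>R x) / t \<le> u x"
        proof (rule gr)
          fix q assume q: "q \<in> C"
          then have "q (t *\<^sub>R x) = t * q x" using sub t by (simp add: sublinear_def)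
          with le[OF q, of "t *\<^sub>R x"] t show "u (t *\<^sub>R x) / t \<le> q x" by (simp add: field_simps)
        qed
        then show "u (t *\<^sub>R x) \<le> t * u x" using t by (simp add: field_simps)
      qed
      moreover have "u x \<le> p x" for x
      proof -
        obtain q where "q \<in> C" using False by blast
        then have "u x \<le> q x" "q x \<le> p x" using le CA by (auto simp: A_def)
        then show ?thesis by linarith
      qed
      ultimately show ?thesis using le by (auto simp: A_def)
    qed
  qed
  then obtain g where g: "sublinear g" "\<And>x. g x \<le> p x"
    and min: "\<And>q. sublinear q \<Longrightarrow> (\<And>x. q x \<le> g x) \<Longrightarrow> q = g"
  proof -
    obtain m where m: "m \<in> A" and min: "\<And>q. q \<in> A \<Longrightarrow> (\<And>x. q x \<le> m x) \<Longrightarrow> q = m"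
      using \<open>\<exists>m\<in>A. \<forall>q\<in>A. (\<forall>x. q x \<le> m x) \<longrightarrow> q = m\<close> by blast
    have "q = m" if "sublinear q" "\<And>x. q x \<le> m x" for q
    proof (rule min[OF _ that(2)])
      have "q x \<le> p x" for x
        using that(2)[of x] m unfolding A_def by (metis (mono_tags, lifting) mem_Collect_eq order_trans)
      then show "q \<in> A" using that(1) by (simp add: A_def)
    qed
    then show thesis using m that unfolding A_def by blast
  qed
  have neg: "g (- y) = - g y" for y
  proof (rule antisym)
    show "g (- y) \<le> - g y"
      using sublinear_shrink[OF g(1), of y] min by metis
    show "- g y \<le> g (- y)" using sublinear_lower[OF g(1), of "- y"] by simp
  qed
  have add: "g (x + y) = g x + g y" for x y
  proof (rule antisym)
    show "g (x + y) \<le> g x + g y" using g(1) by (simp add: sublinear_def)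
    have "g ((x + y) + (- y)) \<le> g (x + y) + g (- y)" using g(1) unfolding sublinear_def by blast
    then show "g x + g y \<le> g (x + y)" by (simp add: neg)
  qed
  have "g (t *\<^sub>R x) = t * g x" for t x
  proof (cases "t \<ge> 0")
    case True
    then show ?thesis using g(1) by (simp add: sublinear_def)
  next
    case False
    then have "g ((- t) *\<^sub>R x) = (- t) * g x" using g(1) unfolding sublinear_def by (metis le_cases neg_0_le_iff_le)
    then show ?thesis using neg[of "t *\<^sub>R x"] by simp
  qed
  with add have "linear g" by (intro linearI) auto
  with g(2) show ?thesis by blast
qed

lemma real_norming_functional:
  fixes x0 :: "'x::real_normed_vector"
  shows "\<exists>g. linear g \<and> (\<forall>x. \<bar>g x\<bar> \<le> norm x) \<and> g x0 = norm x0"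
proof -
  have "sublinear (norm :: 'x \<Rightarrow> real)"
    by (auto simp: sublinear_def norm_triangle_ineq)
  from sublinear_shrink[OF this, of x0] obtain p :: "'x \<Rightarrow> real" where p: "sublinear p" "\<And>x. p x \<le> norm x" "p (- x0) \<le> - norm x0"
    by blast
  obtain g where g: "linear g" "\<And>x. g x \<le> p x"
    using sublinear_dominates_linear[OF p(1)] by blast
  have le: "g x \<le> norm x" for x using g(2) p(2) order_trans by blast
  have "\<bar>g x\<bar> \<le> norm x" for x
    using le[of x] le[of "- x"] linear_neg[OF g(1), of x] by simp
  moreover have "norm x0 \<le> g x0"
    using g(2)[of "- x0"] p(3) linear_neg[OF g(1), of x0] by simp
  ultimately show ?thesis using g(1) le[of x0] by (metis antisym)
qed

lemma dual_functionalI: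
  assumes "\<And>x y. f (x + y) = f x + f y" "\<And>a x. f (s a x) = a * f x" "\<And>x. norm (f x) \<le> B * norm x"
    and s: "normed_space_over s"
  shows "\<exists>\<phi>\<in>dual s. \<forall>x. blinfun_apply \<phi> x = f x"
proof -
  interpret normed_space_over s by fact
  have "bounded_linear f"
  proof (rule bounded_linear_intro)
    show "f (r *\<^sub>R x) = r *\<^sub>R f x" for r x
      using assms(2)[of "of_real r" x] by (simp add: scale_of_real scaleR_conv_of_real)
  qed (use assms(1,3) in \<open>auto simp: mult.commute\<close>)
  then have "blinfun_apply (Blinfun f) = f" by (rule bounded_linear_Blinfun_apply)
  then show ?thesis using assms(2)
    by (intro bexI[of _ "Blinfun f"]) (auto simp: dual_def bounded_operators_def)
qed

theorem dual_norming_functional: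
  fixes s :: "'k::real_or_complex \<Rightarrow> 'x::real_normed_vector \<Rightarrow> 'x"
  assumes s: "normed_space_over s"
  shows "\<exists>\<phi>\<in>dual_ball s. norm (blinfun_apply \<phi> x0) \<ge> norm x0"
proof -
  interpret normed_space_over s by fact
  obtain g where g: "linear g" "\<And>x. \<bar>g x\<bar> \<le> norm x" "g x0 = norm x0"
    using real_norming_functional[of x0] by blast
  have g_add: "g (x + y) = g x + g y" and g_scale: "g (r *\<^sub>R x) = r * g x" for x y r
    using g(1) by (simp_all add: linear_add linear_scale)
  have "\<exists>f::'x \<Rightarrow> 'k. (\<forall>x y. f (x + y) = f x + f y) \<and> (\<forall>a x. f (s a x) = a * f x) \<and>
     (\<forall>x. norm (f x) \<le> norm x) \<and> norm x0 \<le> norm (f x0)"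
  proof (cases "\<forall>z::'k. \<exists>r. z = r *\<^sub>R 1")
    case True
    have "of_real (g (s a x)) = a * of_real (g x)" for a x
    proof -
      obtain r where "a = of_real r" using True by (auto simp: of_real_def)
      then show ?thesis by (simp add: scale_of_real g_scale)
    qed
    then show ?thesis using g g_add by (intro exI[of _ "\<lambda>x. of_real (g x)"]) auto
  next
    case False
    then obtain h :: "complex \<Rightarrow> 'k" where h: "surj h"
      "\<And>z w. h (z + w) = h z + h w" "\<And>z w. h (z * w) = h z * h w"
      "\<And>r. h (of_real r) = of_real r" "\<And>z. norm (h z) = norm z"
      using real_or_complex[where 'a='k] unfolding of_real_def[where 'a='k] by blast
    define j where "j = h \<i>"
    have jj: "j * j = - 1"
      using h(3)[of \<i> \<i>] h(4)[of "-1"] by (simp add: j_def)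
    have dec: "\<exists>r t. a = of_real r + of_real t * j" for a
    proof -
      obtain z where "a = h z" using h(1) by blast
      then have "a = h (of_real (Re z) + of_real (Im z) * \<i>)" by (metis complex_eq mult.commute)
      then show ?thesis unfolding h(2,3,4) j_def by blast
    qed
    \<comment> \<open>The scalar-linear functional with real part \<^term>\<open>g\<close>\<close>
    define f where "f = (\<lambda>x. of_real (g x) - j * of_real (g (s j x)))"
    define F where "F = (\<lambda>x. Complex (g x) (- g (s j x)))"
    have fF: "f x = h (F x)" for x
    proof -
      have "F x = of_real (g x) + \<i> * of_real (- g (s j x))"
        unfolding F_def by (simp add: complex_eq_iff)
      then have "h (F x) = of_real (g x) + j * of_real (- g (s j x))"
        by (simp only: h(2,3,4) j_def)
      then show ?thesis by (simp add: f_def)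
    qed
    have f_add: "f (x + y) = f x + f y" for x y
      by (simp add: f_def g_add scale_right_distrib algebra_simps)
    have f_r: "f (s (of_real r) x) = of_real r * f x" for r x
    proof -
      have "s j (s (of_real r) x) = r *\<^sub>R s j x"
        by (metis scale_of_real scale_left_commute)
      then show ?thesis by (simp add: f_def scale_of_real g_scale algebra_simps)
    qed
    have f_j: "f (s j x) = j * f x" for x
    proof -
      have "g (s j (s j x)) = - g x"
        using g_scale[of "-1" x] by (simp add: jj)
      then show ?thesis using jj by (simp add: f_def algebra_simps) (simp add: mult.assoc[symmetric] jj)
    qed
    have f_s: "f (s a x) = a * f x" for a x
    proof -
      obtain r t where a: "a = of_real r + of_real t * j" using dec by blast
      have "f (s a x) = f (s (of_real r) x) + f (s (of_real t) (s j x))"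
        by (simp only: a scale_left_distrib f_add scale_scale)
      then show ?thesis by (simp only: f_r f_j) (simp add: a algebra_simps)
    qed
    have "norm (f x) \<le> norm x" for x
    proof -
      let ?a = "unit_conj (f x)"
      have eq: "f (s ?a x) = h (of_real (norm (f x)))" by (simp add: f_s h(4))
      have "F (s ?a x) = of_real (norm (f x))"
      proof -
        have "h (F (s ?a x) + of_real (- norm (f x))) = 0"
          unfolding h(2) fF[symmetric] eq h(4) by simp
        then have "norm (F (s ?a x) + of_real (- norm (f x))) = 0" by (metis h(5) norm_zero)
        then have "F (s ?a x) = - of_real (- norm (f x))" unfolding norm_eq_zero by (rule eq_neg_iff_add_eq_0[THEN iffD2])
        then show ?thesis by simp
      qed
      then have "g (s ?a x) = norm (f x)" unfolding F_def by (metis Re_complex_of_real complex.sel(1))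
      then show ?thesis using g(2)[of "s ?a x"] by (simp add: norm_scale)
    qed
    moreover have "norm x0 \<le> norm (f x0)"
      using complex_Re_le_cmod[of "F x0"] g(3) by (simp add: fF h(5)) (simp add: F_def)
    ultimately show ?thesis using f_add f_s by blast
  qed
  then obtain f :: "'x \<Rightarrow> 'k" where f: "\<And>x y. f (x + y) = f x + f y" "\<And>a x. f (s a x) = a * f x"
    "\<And>x. norm (f x) \<le> norm x" "norm x0 \<le> norm (f x0)" by blast
  obtain \<phi> where \<phi>: "\<phi> \<in> dual s" "\<And>x. blinfun_apply \<phi> x = f x"
    using dual_functionalI[OF f(1,2) _ s, of 1] f(3) by auto
  have "norm \<phi> \<le> 1" by (rule norm_blinfun_bound) (use \<phi> f(3) in auto)
  then show ?thesis using \<phi> f(4) by (auto simp: dual_ball_def)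
qed

section \<open>Normalized block sequences\<close>

text \<open>
  The combinations of \<^term>\<open>x i\<close> for \<open>a \<le> i < b\<close> whose real coefficients have absolute sum one. The set is empty if \<open>b \<le> a\<close>.
\<close>

definition blocks :: "(nat \<Rightarrow> 'v::real_vector) \<Rightarrow> nat \<Rightarrow> nat \<Rightarrow> 'v set" where
  "blocks x a b = {(\<Sum>i=a..<b. \<beta> i *\<^sub>R x i) | \<beta>. (\<Sum>i=a..<b. \<bar>\<beta> i\<bar>) = 1}"

text \<open>
  The terms of \<^term>\<open>y\<close> are such combinations of successive stretches of \<^term>\<open>x\<close>. Coefficients may vanish, so
  subsequences are block sequences.
\<close>

definition block_seq :: "(nat \<Rightarrow> 'v::real_vector) \<Rightarrow> (nat \<Rightarrow> 'v) \<Rightarrow> bool" where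
  "block_seq x y \<longleftrightarrow> (\<exists>p. strict_mono p \<and> (\<forall>n. y n \<in> blocks x (p n) (p (Suc n))))"

lemma blocks_mono:
  assumes "a' \<le> a" "b \<le> b'"
  shows "blocks x a b \<subseteq> blocks x a' b'"
proof
  fix v assume "v \<in> blocks x a b"
  then obtain \<beta> where \<beta>: "v = (\<Sum>i=a..<b. \<beta> i *\<^sub>R x i)" "(\<Sum>i=a..<b. \<bar>\<beta> i\<bar>) = 1"
    by (auto simp: blocks_def)
  define \<gamma> where "\<gamma> i = (if a \<le> i \<and> i < b then \<beta> i else 0)" for i
  have "(\<Sum>i=a'..<b'. \<gamma> i *\<^sub>R x i) = (\<Sum>i=a..<b. \<beta> i *\<^sub>R x i)"
    by (rule sum.mono_neutral_cong_right) (use assms in \<open>auto simp: \<gamma>_def\<close>)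
  moreover have "(\<Sum>i=a'..<b'. \<bar>\<gamma> i\<bar>) = (\<Sum>i=a..<b. \<bar>\<beta> i\<bar>)"
    by (rule sum.mono_neutral_cong_right) (use assms in \<open>auto simp: \<gamma>_def\<close>)
  ultimately show "v \<in> blocks x a' b'"
    unfolding blocks_def using \<beta> by (intro CollectI exI[of _ \<gamma>]) simp
qed

lemma self_in_blocks: "x n \<in> blocks x n (Suc n)"
  unfolding blocks_def by (intro CollectI exI[of _ "\<lambda>_. 1"]) simp

lemma blocks_trans:
  assumes p: "strict_mono p" and y: "\<And>j. y j \<in> blocks x (p j) (p (Suc j))"
  shows "blocks y a b \<subseteq> blocks x (p a) (p b)"
proof
  fix v assume "v \<in> blocks y a b"
  then obtain d where d: "v = (\<Sum>j=a..<b. d j *\<^sub>R y j)" "(\<Sum>j=a..<b. \<bar>d j\<bar>) = (1::real)"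
    by (auto simp: blocks_def)
  have "\<forall>j. \<exists>\<beta>. y j = (\<Sum>i=p j..<p (Suc j). \<beta> i *\<^sub>R x i) \<and> (\<Sum>i=p j..<p (Suc j). \<bar>\<beta> i\<bar>) = 1"
    using y by (auto simp: blocks_def)
  then obtain \<beta> where \<beta>: "\<And>j. y j = (\<Sum>i=p j..<p (Suc j). \<beta> j i *\<^sub>R x i)"
    "\<And>j. (\<Sum>i=p j..<p (Suc j). \<bar>\<beta> j i\<bar>) = 1"
    by metis
  have "a \<le> b" using d(2) by (cases "a \<le> b") auto
  then have "\<exists>\<gamma>. (\<Sum>j=a..<b. d j *\<^sub>R y j) = (\<Sum>i=p a..<p b. \<gamma> i *\<^sub>R x i) \<and>
      (\<Sum>j=a..<b. \<bar>d j\<bar>) = (\<Sum>i=p a..<p b. \<bar>\<gamma> i\<bar>)"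
  proof (induction b rule: dec_induct)
    case base
    then show ?case by simp
  next
    case (step b)
    then obtain \<gamma> where \<gamma>: "(\<Sum>j=a..<b. d j *\<^sub>R y j) = (\<Sum>i=p a..<p b. \<gamma> i *\<^sub>R x i)"
      "(\<Sum>j=a..<b. \<bar>d j\<bar>) = (\<Sum>i=p a..<p b. \<bar>\<gamma> i\<bar>)" by blast
    define \<gamma>' where "\<gamma>' i = (if i < p b then \<gamma> i else d b * \<beta> b i)" for i
    have pp: "p a \<le> p b" "p b \<le> p (Suc b)"
      using p step(1) by (auto simp: strict_mono_less_eq)
    have split: "sum g {p a..<p (Suc b)} = sum g {p a..<p b} + sum g {p b..<p (Suc b)}"
      for g :: "nat \<Rightarrow> 'c::comm_monoid_add"
      using sum.atLeastLessThan_concat[OF pp] by metis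
    have "(\<Sum>i=p a..<p (Suc b). \<gamma>' i *\<^sub>R x i) = (\<Sum>i=p a..<p b. \<gamma> i *\<^sub>R x i) + (\<Sum>i=p b..<p (Suc b). (d b * \<beta> b i) *\<^sub>R x i)"
      unfolding split by (intro arg_cong2[where f="(+)"] sum.cong) (auto simp: \<gamma>'_def)
    also have "\<dots> = (\<Sum>j=a..<Suc b. d j *\<^sub>R y j)"
      using step(1) by (simp add: \<gamma> \<beta>(1)[of b] scaleR_sum_right)
    finally have 1: "(\<Sum>j=a..<Suc b. d j *\<^sub>R y j) = (\<Sum>i=p a..<p (Suc b). \<gamma>' i *\<^sub>R x i)" ..
    have "(\<Sum>i=p a..<p (Suc b). \<bar>\<gamma>' i\<bar>) = (\<Sum>i=p a..<p b. \<bar>\<gamma> i\<bar>) + (\<Sum>i=p b..<p (Suc b). \<bar>d b\<bar> * \<bar>\<beta> b i\<bar>)"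
      unfolding split by (intro arg_cong2[where f="(+)"] sum.cong) (auto simp: \<gamma>'_def abs_mult)
    also have "\<dots> = (\<Sum>j=a..<Suc b. \<bar>d j\<bar>)"
      using step(1) by (simp add: \<gamma> \<beta>(2)[of b] sum_distrib_left[symmetric])
    finally show ?case using 1 by metis
  qed
  with d show "v \<in> blocks x (p a) (p b)"
    unfolding blocks_def by auto
qed

lemma block_seq_refl: "block_seq x x"
  unfolding block_seq_def by (intro exI[of _ id]) (auto simp: strict_mono_def self_in_blocks)

lemma block_seq_trans:
  assumes "block_seq x y" "block_seq y z"
  shows "block_seq x z"
proof -
  obtain p q where p: "strict_mono p" "\<And>n. y n \<in> blocks x (p n) (p (Suc n))"
    and q: "strict_mono q" "\<And>n. z n \<in> blocks y (q n) (q (Suc n))"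
    using assms by (auto simp: block_seq_def)
  have "z n \<in> blocks x (p (q n)) (p (q (Suc n)))" for n
    using blocks_trans[of p y x, OF p] q(2) by blast
  then show ?thesis
    unfolding block_seq_def using p(1) q(1)
    by (intro exI[of _ "p \<circ> q"]) (auto simp: strict_mono_o)
qed

lemma block_seq_subseq:
  assumes "strict_mono r"
  shows "block_seq x (x \<circ> r)"
proof -
  have "x (r n) \<in> blocks x (r n) (r (Suc n))" for n
    using self_in_blocks[of x "r n"] blocks_mono[of "r n" "r n" "Suc (r n)" "r (Suc n)" x] assms
    by (auto simp: strict_mono_Suc_iff Suc_leI)
  then show ?thesis using assms by (auto simp: block_seq_def)
qed

lemma blocks_shift:
  assumes "k \<le> a" "k \<le> b"
  shows "blocks x a b = blocks (\<lambda>n. x (n + k)) (a - k) (b - k)"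
proof -
  have eq: "sum g {a..<b} = (\<Sum>i=a - k..<b - k. g (i + k))" for g :: "nat \<Rightarrow> 'c::comm_monoid_add"
    using sum.shift_bounds_nat_ivl[of g "a - k" k "b - k"] assms by simp
  show ?thesis
  proof (intro equalityI subsetI)
    fix v assume "v \<in> blocks x a b"
    then obtain \<beta> where "v = (\<Sum>i=a - k..<b - k. \<beta> (i + k) *\<^sub>R x (i + k))"
      "(\<Sum>i=a - k..<b - k. \<bar>\<beta> (i + k)\<bar>) = 1"
      unfolding blocks_def eq by blast
    then show "v \<in> blocks (\<lambda>n. x (n + k)) (a - k) (b - k)"
      unfolding blocks_def by (intro CollectI exI[of _ "\<lambda>i. \<beta> (i + k)"]) auto
  next
    fix v assume "v \<in> blocks (\<lambda>n. x (n + k)) (a - k) (b - k)"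
    then obtain \<beta> where "v = (\<Sum>i=a - k..<b - k. \<beta> i *\<^sub>R x (i + k))"
      "(\<Sum>i=a - k..<b - k. \<bar>\<beta> i\<bar>) = 1"
      unfolding blocks_def by blast
    then show "v \<in> blocks x a b"
      unfolding blocks_def eq by (intro CollectI exI[of _ "\<lambda>i. \<beta> (i - k)"]) auto
  qed
qed

lemma block_seq_shift:
  assumes "block_seq x y"
  shows "block_seq (\<lambda>n. x (n + k)) (\<lambda>n. y (n + k))"
proof -
  obtain p where p: "strict_mono p" "\<And>n. y n \<in> blocks x (p n) (p (Suc n))"
    using assms by (auto simp: block_seq_def)
  have ge: "k \<le> p (n + k)" for n
    using strict_mono_imp_increasing[OF p(1), of "n + k"] by simp
  have "y (n + k) \<in> blocks (\<lambda>n. x (n + k)) (p (n + k) - k) (p (Suc n + k) - k)" for n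
    using p(2)[of "n + k"] blocks_shift[OF ge[of n] ge[of "Suc n"], of x] by simp
  moreover have "strict_mono (\<lambda>n. p (n + k) - k)"
    using p(1) ge by (auto simp: strict_mono_Suc_iff intro!: diff_less_mono)
  ultimately show ?thesis
    unfolding block_seq_def by (intro exI[of _ "\<lambda>n. p (n + k) - k"]) auto
qed

lemma norm_blocks_le:
  fixes x :: "nat \<Rightarrow> 'v::real_normed_vector"
  assumes "v \<in> blocks x a b" "\<And>i. a \<le> i \<Longrightarrow> i < b \<Longrightarrow> norm (x i) \<le> B"
  shows "norm v \<le> B"
proof -
  obtain \<beta> where \<beta>: "v = (\<Sum>i=a..<b. \<beta> i *\<^sub>R x i)" "(\<Sum>i=a..<b. \<bar>\<beta> i\<bar>) = 1"
    using assms(1) by (auto simp: blocks_def)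
  have "norm v \<le> (\<Sum>i=a..<b. \<bar>\<beta> i\<bar> * B)"
    unfolding \<beta>(1) by (intro sum_norm_le) (auto intro!: mult_left_mono assms(2))
  also have "\<dots> = B" by (simp add: sum_distrib_right[symmetric] \<beta>(2))
  finally show ?thesis .
qed

lemma blocks_apply:
  "v \<in> blocks x a b \<Longrightarrow> blinfun_apply v u \<in> blocks (\<lambda>i. blinfun_apply (x i) u) a b"
  unfolding blocks_def by (auto simp: blinfun.sum_left blinfun.scaleR_left)

lemma dual_sum:
  assumes "\<And>i. i \<in> I \<Longrightarrow> x i \<in> dual s"
  shows "(\<Sum>i\<in>I. \<beta> i *\<^sub>R x i) \<in> dual s"
  using assms
  by (auto simp: dual_def bounded_operators_def blinfun.sum_left blinfun.scaleR_left sum_distrib_left intro!: sum.cong)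

lemma blocks_dual_ball:
  assumes "v \<in> blocks x a b" "\<And>i. x i \<in> dual_ball s"
  shows "v \<in> dual_ball s"
  using norm_blocks_le[OF assms(1), of 1] assms dual_sum[of "{a..<b}" x s]
  unfolding dual_ball_def by (auto simp: blocks_def)

lemma block_seq_dual_ball:
  assumes "block_seq x y" "\<And>i. x i \<in> dual_ball s"
  shows "y n \<in> dual_ball s"
  using assms blocks_dual_ball unfolding block_seq_def by metis

section \<open>Asymptotic size\<close>

text \<open>
  \<open>limsup\<^sub>n \<bar>y\<^sub>n u\<bar> \<le> d\<close> for all \<^term>\<open>u\<close> in the unit ball. The least such \<^term>\<open>d\<close> is the asymptotic size
  \<open>sup\<^sub>u limsup\<^sub>n \<bar>y\<^sub>n u\<bar>\<close>. A bounded sequence of functionals is weak-star null if and only if its size is zero.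
\<close>

definition asymp_bound :: "(nat \<Rightarrow> 'x::real_normed_vector \<Rightarrow>\<^sub>L 'k::real_normed_vector) \<Rightarrow> real \<Rightarrow> bool" where
  "asymp_bound y d \<longleftrightarrow> (\<forall>u\<in>cball 0 1. \<forall>e>d. \<forall>\<^sub>F n in sequentially. norm (blinfun_apply (y n) u) < e)"

definition asymp_size :: "(nat \<Rightarrow> 'x::real_normed_vector \<Rightarrow>\<^sub>L 'k::real_normed_vector) \<Rightarrow> real" where
  "asymp_size y = Inf {d. 0 \<le> d \<and> asymp_bound y d}"

lemma asymp_bound_block_seq:
  assumes x: "asymp_bound x d" and "block_seq x y"
  shows "asymp_bound y d"
  unfolding asymp_bound_def
proof (intro ballI allI impI)
  fix u :: 'a and e assume u: "u \<in> cball 0 1" and e: "d < e"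
  obtain p where p: "strict_mono p" "\<And>n. y n \<in> blocks x (p n) (p (Suc n))"
    using assms by (auto simp: block_seq_def)
  obtain N where N: "\<And>n. n \<ge> N \<Longrightarrow> norm (blinfun_apply (x n) u) < (d + e) / 2"
  proof -
    have "d < (d + e) / 2" using e by simp
    then have "\<forall>\<^sub>F n in sequentially. norm (blinfun_apply (x n) u) < (d + e) / 2"
      using x u unfolding asymp_bound_def by blast
    then show thesis using that unfolding eventually_sequentially by blast
  qed
  have "norm (blinfun_apply (y n) u) < e" if "n \<ge> N" for n
  proof -
    have "norm (blinfun_apply (y n) u) \<le> (d + e) / 2"
    proof (rule norm_blocks_le[OF blocks_apply[OF p(2)]])
      fix i assume "p n \<le> i"
      then have "N \<le> i" using strict_mono_imp_increasing[OF p(1), of n] that by linarith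
      then show "norm (blinfun_apply (x i) u) \<le> (d + e) / 2" using N by (simp add: less_imp_le)
    qed
    with e show ?thesis by (simp add: field_simps)
  qed
  then show "\<forall>\<^sub>F n in sequentially. norm (blinfun_apply (y n) u) < e"
    by (auto simp: eventually_sequentially)
qed

lemma asymp_bound_1:
  assumes "\<And>n. norm (y n) \<le> 1"
  shows "asymp_bound y 1"
  unfolding asymp_bound_def
proof (intro ballI allI impI)
  fix u :: 'a and e :: real assume u: "u \<in> cball 0 1" and e: "1 < e"
  have "norm (blinfun_apply (y n) u) \<le> 1 * 1" for n
    by (rule order_trans[OF norm_blinfun]) (intro mult_mono assms; use u in auto)
  then have "norm (blinfun_apply (y n) u) < e" for n using e by (metis le_less_trans mult_1)
  then show "\<forall>\<^sub>F n in sequentially. norm (blinfun_apply (y n) u) < e" by simp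
qed

lemma asymp_size:
  assumes y: "\<And>n. norm (y n) \<le> 1"
  shows "0 \<le> asymp_size y" "asymp_size y \<le> 1" "asymp_bound y (asymp_size y)"
    "0 \<le> d \<Longrightarrow> asymp_bound y d \<Longrightarrow> asymp_size y \<le> d"
proof -
  let ?A = "{d. 0 \<le> d \<and> asymp_bound y d}"
  have ne: "1 \<in> ?A" using asymp_bound_1[OF y] by simp
  have bdd: "bdd_below ?A" by (auto intro: bdd_belowI[of _ 0])
  show "0 \<le> asymp_size y" unfolding asymp_size_def using ne by (intro cInf_greatest) blast+
  show le: "0 \<le> d \<Longrightarrow> asymp_bound y d \<Longrightarrow> asymp_size y \<le> d" for d
    unfolding asymp_size_def using bdd by (intro cInf_lower) auto
  show "asymp_size y \<le> 1" using le[of 1] ne by simp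
  show "asymp_bound y (asymp_size y)"
    unfolding asymp_bound_def
  proof (intro ballI allI impI)
    fix u :: 'a and e assume u: "u \<in> cball 0 1" and e: "asymp_size y < e"
    then obtain d where "d \<in> ?A" "d < e"
      using cInf_lessD[of ?A e] ne unfolding asymp_size_def by blast
    then show "\<forall>\<^sub>F n in sequentially. norm (blinfun_apply (y n) u) < e"
      using u by (auto simp: asymp_bound_def)
  qed
qed

lemma asymp_size_block_seq:
  assumes "\<And>n. norm (x n) \<le> 1" "\<And>n. norm (y n) \<le> 1" "block_seq x y"
  shows "asymp_size y \<le> asymp_size x"
  using asymp_bound_block_seq[OF asymp_size(3) assms(3)] assms asymp_size(1,4) by metis

lemma asymp_size_shift: "asymp_size (\<lambda>n. y (n + k)) = asymp_size y"
proof -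
  have "asymp_bound (\<lambda>n. y (n + k)) d \<longleftrightarrow> asymp_bound y d" for d
    unfolding asymp_bound_def
    using eventually_sequentially_seg[of "\<lambda>n. norm (blinfun_apply (y n) _) < _" k] by simp
  then show ?thesis by (simp add: asymp_size_def)
qed

text \<open>
  Taking blocks does not increase the size. Choosing blocks again and again, each time with nearly the smallest possible
  size, and passing to the diagonal sequence gives a block sequence whose size cannot be decreased any more.
\<close>

lemma stable_block_seq:
  fixes x :: "nat \<Rightarrow> 'x::real_normed_vector \<Rightarrow>\<^sub>L 'k::real_or_complex"
  assumes x: "\<And>n. x n \<in> dual_ball s"
  shows "\<exists>z. block_seq x z \<and> (\<forall>z'. block_seq z z' \<longrightarrow> asymp_size z' = asymp_size z)"
proof -
  define low :: "(nat \<Rightarrow> 'x \<Rightarrow>\<^sub>L 'k) \<Rightarrow> real" where "low = (\<lambda>y. Inf (asymp_size ` {z. block_seq y z}))"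
  have ex: "\<exists>z. block_seq y z \<and> asymp_size z < low y + 1 / Suc k" for y k
    using cInf_lessD[of "asymp_size ` {z. block_seq y z}" "low y + 1 / Suc k"] block_seq_refl[of y]
    unfolding low_def by auto
  define Y where "Y = rec_nat x (\<lambda>k y. SOME z. block_seq y z \<and> asymp_size z < low y + 1 / Suc k)"
  have Y0: "Y 0 = x" by (simp add: Y_def)
  have "block_seq (Y k) (Y (Suc k)) \<and> asymp_size (Y (Suc k)) < low (Y k) + 1 / Suc k" for k
    using someI_ex[OF ex[of "Y k" k]] by (simp add: Y_def)
  then have YS: "block_seq (Y k) (Y (Suc k))" "asymp_size (Y (Suc k)) < low (Y k) + 1 / Suc k" for k
    by blast+
  have Yball: "Y k n \<in> dual_ball s" for k n
    by (induction k arbitrary: n) (use x Y0 block_seq_dual_ball[OF YS(1)] in auto)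
  obtain p where p: "\<And>k. strict_mono (p k)" "\<And>k n. Y (Suc k) n \<in> blocks (Y k) (p k n) (p k (Suc n))"
    using YS(1) unfolding block_seq_def by metis
  \<comment> \<open>\<^term>\<open>P k m\<close> gives the stretches of \<^term>\<open>Y k\<close> that make up \<^term>\<open>Y (k + m)\<close>.\<close>
  define P where "P k = rec_nat id (\<lambda>m f. f \<circ> p (k + m))" for k
  have P: "P k 0 = id" "P k (Suc m) = P k m \<circ> p (k + m)" for k m
    by (simp_all add: P_def)
  have P_mono: "strict_mono (P k m)" for k m
  proof (induction m)
    case 0
    then show ?case by (simp add: P strict_mono_def)
  next
    case (Suc m)
    then show ?case unfolding P by (rule strict_mono_o[OF _ p(1)])
  qed
  have P_blocks: "Y (k + m) n \<in> blocks (Y k) (P k m n) (P k m (Suc n))" for k m n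
  proof (induction m arbitrary: n)
    case 0
    then show ?case by (simp add: P self_in_blocks)
  next
    case (Suc m)
    have "Y (Suc (k + m)) n \<in> blocks (Y (k + m)) (p (k + m) n) (p (k + m) (Suc n))"
      by (rule p(2))
    with blocks_trans[of "P k m" "Y (k + m)" "Y k", OF P_mono Suc.IH] show ?case
      by (auto simp: P)
  qed
  \<comment> \<open>From index \<^term>\<open>k\<close> on, the diagonal sequence is a block sequence of \<^term>\<open>Y k\<close>.\<close>
  define z where "z n = Y n n" for n
  have z: "block_seq (Y k) (\<lambda>n. z (n + k))" for k
  proof -
    define q where "q n = P k n (n + k)" for n
    have step: "P k n (Suc (n + k)) \<le> q (Suc n)" for n
    proof -
      have "Suc (n + k) \<le> p (k + n) (Suc (n + k))"
        by (rule strict_mono_imp_increasing[OF p(1)])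
      then show ?thesis using P_mono[of k n] by (simp add: q_def P strict_mono_less_eq)
    qed
    have "strict_mono q"
      unfolding strict_mono_Suc_iff
    proof
      fix n
      have "q n < P k n (Suc (n + k))" using P_mono[of k n] by (simp add: q_def strict_mono_less)
      then show "q n < q (Suc n)" using step[of n] by linarith
    qed
    moreover have "z (n + k) \<in> blocks (Y k) (q n) (q (Suc n))" for n
      using P_blocks[of k n "n + k"] blocks_mono[OF order_refl step[of n], of "Y k" "q n"]
      unfolding z_def q_def by (auto simp: add.commute)
    ultimately show ?thesis by (auto simp: block_seq_def)
  qed
  have xz: "block_seq x z" using z[of 0] by (simp add: Y0)
  have zball: "z n \<in> dual_ball s" for n by (rule block_seq_dual_ball[OF xz x])
  have "asymp_size z' = asymp_size z" if z': "block_seq z z'" for z'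
  proof (rule antisym)
    have z'ball: "z' n \<in> dual_ball s" for n by (rule block_seq_dual_ball[OF z' zball])
    show "asymp_size z' \<le> asymp_size z"
      by (rule asymp_size_block_seq[OF _ _ z']) (use zball z'ball in \<open>auto simp: dual_ball_def\<close>)
    have le: "asymp_size z \<le> asymp_size z' + 1 / Suc k" for k
    proof -
      have "asymp_size (\<lambda>n. z (n + Suc k)) \<le> asymp_size (Y (Suc k))"
        by (rule asymp_size_block_seq[OF _ _ z]) (use zball Yball in \<open>auto simp: dual_ball_def\<close>)
      moreover have "low (Y k) \<le> asymp_size (\<lambda>n. z' (n + k))"
      proof -
        have "block_seq (Y k) (\<lambda>n. z' (n + k))"
          by (rule block_seq_trans[OF z block_seq_shift[OF z']])
        moreover have "bdd_below (asymp_size ` {y. block_seq (Y k) y})"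
          by (rule bdd_belowI2[of _ 0], rule asymp_size(1))
            (use block_seq_dual_ball[OF _ Yball] in \<open>auto simp: dual_ball_def\<close>)
        ultimately show ?thesis unfolding low_def by (intro cINF_lower) auto
      qed
      ultimately show ?thesis using YS(2)[of k] unfolding asymp_size_shift by linarith
    qed
    show "asymp_size z \<le> asymp_size z'"
    proof (rule field_le_epsilon)
      fix e :: real assume "e > 0"
      then obtain k where "1 / Suc k < e" by (rule nat_approx_posE)
      with le[of k]
      show "asymp_size z \<le> asymp_size z' + e" by linarith
    qed
  qed
  with xz show ?thesis by blast
qed

section \<open>Stable sequences of positive size\<close>

lemma infinite_selection:
  assumes "\<And>i::nat. infinite (B i :: nat set)"
  shows "\<exists>r. strict_mono r \<and> (\<forall>i. r i \<in> B i)"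
proof -
  have "\<exists>r::nat \<Rightarrow> nat. \<forall>i. r i \<in> B i \<and> r i < r (Suc i)"
  proof (rule dependent_nat_choice)
    show "\<exists>x. x \<in> B 0" using assms[of 0] by (metis finite.emptyI all_not_in_conv)
    show "\<exists>y. y \<in> B (Suc n) \<and> x < y" for x n
      using assms[of "Suc n"] unfolding infinite_nat_iff_unbounded by auto
  qed
  then show ?thesis by (auto simp: strict_mono_Suc_iff)
qed

lemma norm_diff_of_real_square:
  fixes z :: "'k::real_or_complex" and re im :: "'k \<Rightarrow> real"
  assumes re: "\<And>z w. re (z + w) = re z + re w" "\<And>z w. im (z + w) = im z + im w"
    "\<And>r. re (of_real r) = r" "\<And>z. (norm z)\<^sup>2 = (re z)\<^sup>2 + (im z)\<^sup>2"
  shows "(norm (z - of_real c))\<^sup>2 = (norm z)\<^sup>2 - 2 * c * re z + c\<^sup>2"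
proof -
  have im0: "im (of_real r) = 0" for r
  proof -
    have "(norm (of_real r :: 'k))\<^sup>2 = r\<^sup>2" by simp
    then show ?thesis using re(4)[of "of_real r"] by (simp add: re(3))
  qed
  have "re (z - of_real c) = re z - c" "im (z - of_real c) = im z"
    using re(1)[of "z - of_real c" "of_real c"] re(2)[of "z - of_real c" "of_real c"] im0[of c] re(3)[of c]
    by simp_all
  then have "(norm (z - of_real c))\<^sup>2 = (re z - c)\<^sup>2 + (im z)\<^sup>2"
    using re(4)[of "z - of_real c"] by simp
  also have "\<dots> = (re z)\<^sup>2 + (im z)\<^sup>2 - 2 * c * re z + c\<^sup>2"
    by (simp add: power2_eq_square algebra_simps)
  finally show ?thesis by (simp only: re(4)[of z])
qed

lemma dual_applyD:
  assumes "\<phi> \<in> dual s"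
  shows "blinfun_apply \<phi> (s a x) = a * blinfun_apply \<phi> x"
  using assms by (auto simp: dual_def bounded_operators_def)

text \<open>
  Let the size \<open>\<delta>\<close> of \<^term>\<open>z\<close> be stable under taking blocks. For finitely many infinite sets \<^term>\<open>A q\<close> of indices, average one
  term from each with the signs \<^term>\<open>sg q\<close>. These averages again have size \<open>\<delta>\<close>, so some \<^term>\<open>u\<close> gives infinitely many
  of them a value near \<open>\<delta>\<close>. As the individual values are hardly larger than \<open>\<delta>\<close> in modulus, each of them has to be
  near its signed extreme value.
\<close>

lemma simultaneous_signs:
  fixes z :: "nat \<Rightarrow> 'x::real_normed_vector \<Rightarrow>\<^sub>L 'k::real_or_complex"
  assumes s: "normed_space_over s"
    and z: "\<And>n. z n \<in> dual_ball s"
    and stable: "\<And>z'. block_seq z z' \<Longrightarrow> asymp_size z' = asymp_size z"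
    and pos: "asymp_size z > 0" and \<eta>: "\<eta> > 0"
    and Q: "finite Q" "Q \<noteq> {}" and A: "\<And>q. q \<in> Q \<Longrightarrow> infinite (A q)"
    and sg: "\<And>q. \<bar>sg q\<bar> = (1::real)"
  shows "\<exists>u\<in>cball 0 1. \<forall>q\<in>Q. infinite {n\<in>A q. norm (blinfun_apply (z n) u - of_real (sg q * asymp_size z)) < \<eta>}"
proof -
  interpret normed_space_over s by fact
  define \<delta> where "\<delta> = asymp_size z"
  have nz: "norm (z n) \<le> 1" for n using z by (simp add: dual_ball_def)
  have \<delta>: "0 < \<delta>" "\<delta> \<le> 1" using pos asymp_size(2)[OF nz] by (auto simp: \<delta>_def)
  obtain re im :: "'k \<Rightarrow> real" where re: "\<And>z w. re (z + w) = re z + re w" "\<And>z w. im (z + w) = im z + im w"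
    "\<And>r z. re (of_real r * z) = r * re z" 
    "\<And>r. re (of_real r) = r" "\<And>z. (norm z)\<^sup>2 = (re z)\<^sup>2 + (im z)\<^sup>2"
    by (rule real_or_complex_parts) blast
  have re_le: "\<bar>re a\<bar> \<le> norm a" for a
    using re(5)[of a] by (metis abs_le_square_iff abs_norm_cancel le_add_same_cancel1 zero_le_power2)
  have re_0: "re 0 = 0" using re(4)[of 0] by simp
  have re_sum: "re (\<Sum>i\<in>I. f i) = (\<Sum>i\<in>I. re (f i))" for I :: "nat set" and f
    by (induction I rule: infinite_finite_induct) (auto simp: re_0 re(1))
  define M where "M = card Q"
  have M: "M > 0" using Q by (simp add: M_def card_gt_0_iff)
  obtain e where e: "bij_betw e {0..<M} Q"
    using ex_bij_betw_nat_finite[OF Q(1)] unfolding M_def by blast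
  have eQ: "e (i mod M) \<in> Q" for i
    using e M by (auto simp: bij_betw_def)
  obtain r where r: "strict_mono r" "\<And>i. r i \<in> A (e (i mod M))"
    using infinite_selection[of "\<lambda>i. A (e (i mod M))"] A[OF eQ] by blast
  define \<sigma> where "\<sigma> i = sg (e (i mod M))" for i
  have abs\<sigma>: "\<bar>\<sigma> i\<bar> = 1" for i by (simp add: \<sigma>_def sg)
  have \<sigma>\<sigma>: "\<sigma> i * \<sigma> i = 1" for i using abs\<sigma>[of i] by (metis abs_mult_self_eq mult_1)
  define z' where "z' j = (\<Sum>i=j*M..<Suc j*M. (\<sigma> i / M) *\<^sub>R (z \<circ> r) i)" for j
  have "z' j \<in> blocks (z \<circ> r) (j*M) (Suc j*M)" for j
  proof -
    have "(\<Sum>i=j*M..<Suc j*M. \<bar>\<sigma> i / M\<bar>) = (\<Sum>i=j*M..<Suc j*M. 1 / M)"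
      by (simp add: abs\<sigma>)
    also have "\<dots> = 1" using M by simp
    finally show ?thesis
      unfolding blocks_def z'_def by (intro CollectI exI[of _ "\<lambda>i. \<sigma> i / M"]) simp
  qed
  then have "block_seq (z \<circ> r) z'"
    unfolding block_seq_def using M by (intro exI[of _ "\<lambda>j. j * M"]) (auto simp: strict_mono_def)
  then have "block_seq z z'"
    using block_seq_trans block_seq_subseq[OF r(1)] by blast
  then have size': "asymp_size z' = \<delta>" using stable \<delta>_def by simp
  have z'ball: "z' j \<in> dual_ball s" for j by (rule block_seq_dual_ball[OF \<open>block_seq z z'\<close> z])
  then have nz': "norm (z' j) \<le> 1" "z' j \<in> dual s" for j by (auto simp: dual_ball_def)
  \<comment> \<open>Small against \<^term>\<open>1 / M\<close>, since an average of \<^term>\<open>M\<close> terms forgives a single term \<^term>\<open>M\<close> times the error.\<close>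
  define \<epsilon> where "\<epsilon> = min \<delta> (\<eta>\<^sup>2 / (18 * M))"
  have \<epsilon>: "0 < \<epsilon>" "\<epsilon> \<le> \<delta>" "18 * M * \<epsilon> \<le> \<eta>\<^sup>2"
    using \<delta> \<eta> M by (auto simp: \<epsilon>_def min_def field_simps)
  have "\<not> asymp_bound z' (\<delta> - \<epsilon>)"
    using asymp_size(4)[of z', OF nz'(1), of "\<delta> - \<epsilon>"] size' \<epsilon> by auto
  then obtain u d where u: "u \<in> cball 0 1" "\<delta> - \<epsilon> < d"
    "\<exists>\<^sub>F n in sequentially. d \<le> norm (blinfun_apply (z' n) u)"
    unfolding asymp_bound_def by (auto simp: not_eventually not_less)
  have "\<exists>\<^sub>F n in sequentially. \<delta> - \<epsilon> \<le> norm (blinfun_apply (z' n) u)"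
    by (rule frequently_elim1[OF u(3)]) (use u(2) in linarith)
  then have "infinite {n. \<delta> - \<epsilon> \<le> norm (blinfun_apply (z' n) u)}"
    unfolding cofinite_eq_sequentially[symmetric] frequently_cofinite .
  from infinite_enumerate[OF this] obtain t0 :: "nat \<Rightarrow> nat"
    where t0: "strict_mono t0" "\<forall>n. t0 n \<in> {n. \<delta> - \<epsilon> \<le> norm (blinfun_apply (z' n) u)}"
    by blast
  have "norm (blinfun_apply (z' n) u) \<le> 1 * 1" for n
    by (rule order_trans[OF norm_blinfun]) (intro mult_mono nz'; use u in auto)
  then have "\<forall>n. blinfun_apply (z' (t0 n)) u \<in> cball 0 1" by simp
  then have "\<exists>\<rho>\<in>cball 0 1. \<exists>t1::nat \<Rightarrow> nat. strict_mono t1 \<and> ((\<lambda>n. blinfun_apply (z' (t0 n)) u) \<circ> t1) \<longlonglongrightarrow> \<rho>"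
    by (rule compact_cball_scalar[of 1, where 'k='k, unfolded compact_def, THEN spec, THEN mp])
  then obtain \<rho> and t1 :: "nat \<Rightarrow> nat" where \<rho>: "strict_mono t1" "((\<lambda>n. blinfun_apply (z' (t0 n)) u) \<circ> t1) \<longlonglongrightarrow> \<rho>"
    by blast
  define t where "t = t0 \<circ> t1"
  have t: "strict_mono t" unfolding t_def by (rule strict_mono_o[OF t0(1) \<rho>(1)])
  have lim: "(\<lambda>n. blinfun_apply (z' (t n)) u) \<longlonglongrightarrow> \<rho>" using \<rho>(2) by (simp add: t_def o_def)
  have n\<rho>: "\<delta> - \<epsilon> \<le> norm \<rho>"
    by (rule tendsto_lowerbound[OF tendsto_norm[OF lim]]) (use t0(2) in \<open>auto simp: t_def\<close>)
  \<comment> \<open>Rotating \<^term>\<open>u\<close> makes the limit of the averages a positive real number.\<close>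
  define v where "v = s (unit_conj \<rho>) u"
  have v: "v \<in> cball 0 1" using u by (simp add: v_def norm_scale)
  have "(\<lambda>n. unit_conj \<rho> * blinfun_apply (z' (t n)) u) \<longlonglongrightarrow> unit_conj \<rho> * \<rho>"
    by (intro tendsto_mult tendsto_const lim)
  then have "(\<lambda>n. blinfun_apply (z' (t n)) v) \<longlonglongrightarrow> of_real (norm \<rho>)"
    by (simp add: v_def dual_applyD[OF nz'(2)])
  then have "\<forall>\<^sub>F n in sequentially. dist (blinfun_apply (z' (t n)) v) (of_real (norm \<rho>)) < \<epsilon>"
    using \<epsilon>(1) by (rule tendstoD)
  then have ev1: "\<forall>\<^sub>F n in sequentially. \<delta> - 2 * \<epsilon> < re (blinfun_apply (z' (t n)) v)"
  proof eventually_elim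
    case (elim n)
    have "re (of_real (norm \<rho>) - blinfun_apply (z' (t n)) v) = norm \<rho> - re (blinfun_apply (z' (t n)) v)"
      using re(1)[of "of_real (norm \<rho>) - blinfun_apply (z' (t n)) v" "blinfun_apply (z' (t n)) v"] re(4)
      by simp
    then show ?case
      using re_le[of "of_real (norm \<rho>) - blinfun_apply (z' (t n)) v"] elim n\<rho>
      by (simp add: dist_norm norm_minus_commute)
  qed
  have "\<forall>\<^sub>F n in sequentially. norm (blinfun_apply (z n) v) < \<delta> + \<epsilon>"
    using asymp_size(3)[of z, OF nz] v \<epsilon>(1) unfolding asymp_bound_def \<delta>_def by simp
  then obtain N1 where N1: "\<And>n. n \<ge> N1 \<Longrightarrow> norm (blinfun_apply (z n) v) < \<delta> + \<epsilon>"
    by (auto simp: eventually_sequentially)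
  obtain N2 where N2: "\<And>n. n \<ge> N2 \<Longrightarrow> \<delta> - 2 * \<epsilon> < re (blinfun_apply (z' (t n)) v)"
    using ev1 by (auto simp: eventually_sequentially)
  have key: "norm (blinfun_apply (z (r i)) v - of_real (\<sigma> i * \<delta>)) < \<eta>"
    if n: "n \<ge> N1" "n \<ge> N2" and i: "i \<in> {t n*M..<Suc (t n)*M}" for n i
  proof -
    let ?I = "{t n*M..<Suc (t n)*M}"
    have ub: "norm (blinfun_apply (z (r k)) v) < \<delta> + \<epsilon>" if "k \<in> ?I" for k
    proof (rule N1)
      have "n \<le> t n" by (rule strict_mono_imp_increasing[OF t])
      also have "t n \<le> t n * M" using M by simp
      also have "\<dots> \<le> k" using that by simp
      also have "k \<le> r k" by (rule strict_mono_imp_increasing[OF r(1)])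
      finally show "N1 \<le> r k" using n by simp
    qed
    have re_ub: "\<sigma> k * re (blinfun_apply (z (r k)) v) \<le> \<delta> + \<epsilon>" if "k \<in> ?I" for k
    proof -
      have "\<sigma> k * re (blinfun_apply (z (r k)) v) \<le> \<bar>\<sigma> k * re (blinfun_apply (z (r k)) v)\<bar>" by simp
      also have "\<dots> \<le> norm (blinfun_apply (z (r k)) v)" by (simp add: abs_mult abs\<sigma> re_le)
      finally show ?thesis using ub[OF that] by simp
    qed
    have "blinfun_apply (z' (t n)) v = (\<Sum>k\<in>?I. of_real (\<sigma> k / M) * blinfun_apply (z (r k)) v)"
      by (simp add: z'_def blinfun.sum_left blinfun.scaleR_left scaleR_conv_of_real)
    then have "re (blinfun_apply (z' (t n)) v) = (\<Sum>k\<in>?I. \<sigma> k / M * re (blinfun_apply (z (r k)) v))"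
      by (simp only: re_sum re(3))
    then have "M * re (blinfun_apply (z' (t n)) v) = (\<Sum>k\<in>?I. \<sigma> k * re (blinfun_apply (z (r k)) v))"
      using M by (simp add: sum_distrib_left)
    also have "\<dots> = \<sigma> i * re (blinfun_apply (z (r i)) v) + (\<Sum>k\<in>?I-{i}. \<sigma> k * re (blinfun_apply (z (r k)) v))"
      by (rule sum.remove) (use i in auto)
    also have "(\<Sum>k\<in>?I-{i}. \<sigma> k * re (blinfun_apply (z (r k)) v)) \<le> card (?I-{i}) * (\<delta> + \<epsilon>)"
      by (rule sum_bounded_above) (use re_ub in auto)
    also have "card (?I-{i}) = M - 1"
      using i by (subst card_Diff_singleton) auto
    finally have "M * re (blinfun_apply (z' (t n)) v) \<le> \<sigma> i * re (blinfun_apply (z (r i)) v) + (real M - 1) * (\<delta> + \<epsilon>)"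
      using M by (simp add: of_nat_diff)
    moreover have "M * (\<delta> - 2 * \<epsilon>) \<le> M * re (blinfun_apply (z' (t n)) v)"
      using N2[OF n(2)] by (intro mult_left_mono) auto
    ultimately have lb: "\<delta> - 3 * M * \<epsilon> \<le> \<sigma> i * re (blinfun_apply (z (r i)) v)"
      using \<epsilon>(1) by (simp add: algebra_simps)
    let ?w = "blinfun_apply (z (r i)) v"
    have "(norm (?w - of_real (\<sigma> i * \<delta>)))\<^sup>2 = (norm ?w)\<^sup>2 - 2 * (\<sigma> i * \<delta>) * re ?w + (\<sigma> i * \<delta>)\<^sup>2"
      by (rule norm_diff_of_real_square[of re im]) (rule re)+
    also have "(\<sigma> i * \<delta>)\<^sup>2 = \<delta>\<^sup>2"
      by (simp add: power2_eq_square) (metis \<sigma>\<sigma> mult.assoc mult.commute mult_1)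
    also have "(norm ?w)\<^sup>2 - 2 * (\<sigma> i * \<delta>) * re ?w + \<delta>\<^sup>2 = (norm ?w)\<^sup>2 - 2 * \<delta> * (\<sigma> i * re ?w) + \<delta>\<^sup>2"
      by simp
    also have "\<dots> \<le> (\<delta> + \<epsilon>)\<^sup>2 - 2 * \<delta> * (\<delta> - 3 * M * \<epsilon>) + \<delta>\<^sup>2"
      using ub[OF i] lb \<delta> by (intro add_mono diff_mono power_mono mult_left_mono) auto
    also have "\<dots> = 2 * \<delta> * \<epsilon> + \<epsilon> * \<epsilon> + 6 * M * \<epsilon> * \<delta>"
      by (simp add: power2_eq_square algebra_simps)
    also have "\<dots> \<le> 2 * 1 * \<epsilon> + 1 * \<epsilon> + 6 * M * \<epsilon> * 1"
      using \<delta> \<epsilon> by (intro add_mono mult_mono mult_left_mono) auto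
    also have "\<dots> \<le> 9 * (M * \<epsilon>)"
      using \<epsilon>(1) M by (simp add: algebra_simps)
    also have "\<dots> < \<eta>\<^sup>2"
    proof -
      have "0 < real M * \<epsilon>" using \<epsilon>(1) M by simp
      with \<epsilon>(3) show ?thesis by (simp add: mult.assoc)
    qed
    finally show ?thesis by (rule power2_less_imp_less) (use \<eta> in simp)
  qed
  have "infinite {n\<in>A q. norm (blinfun_apply (z n) v - of_real (sg q * \<delta>)) < \<eta>}" if q: "q \<in> Q" for q
  proof -
    obtain i where i: "i < M" "e i = q" using e q by (force simp: bij_betw_def)
    define w where "w n = r (t (n + (N1 + N2)) * M + i)" for n
    have "strict_mono w"
    proof (rule strict_monoI)
      fix a b :: nat assume "a < b"
      then have "t (a + (N1 + N2)) < t (b + (N1 + N2))" using t by (simp add: strict_mono_less)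
      then show "w a < w b" unfolding w_def using M r(1) by (simp add: strict_mono_less)
    qed
    then have "infinite (range w)"
      using range_inj_infinite strict_mono_imp_inj_on by blast
    moreover have "range w \<subseteq> {n\<in>A q. norm (blinfun_apply (z n) v - of_real (sg q * \<delta>)) < \<eta>}"
    proof
      fix m assume "m \<in> range w"
      then obtain n where m: "m = r (t (n + (N1 + N2)) * M + i)" by (auto simp: w_def)
      let ?k = "t (n + (N1 + N2)) * M + i"
      have "?k mod M = i" using i by simp
      then have "\<sigma> ?k = sg q" "m \<in> A q" using i r(2)[of ?k] by (simp_all add: \<sigma>_def m)
      moreover have "norm (blinfun_apply (z (r ?k)) v - of_real (\<sigma> ?k * \<delta>)) < \<eta>"
        by (rule key[of "n + (N1 + N2)"]) (use i in auto)
      ultimately show "m \<in> {n\<in>A q. norm (blinfun_apply (z n) v - of_real (sg q * \<delta>)) < \<eta>}"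
        by (simp add: m)
    qed
    ultimately show ?thesis using infinite_super by blast
  qed
  with v show ?thesis unfolding \<delta>_def by blast
qed

text \<open>
  Iterating the previous lemma over all patterns \<open>\<sigma>\<close> of signs of length \<open>K\<close>: the functionals behave on the vectors
  \<^term>\<open>u k\<close> like points on the Rademacher functions.
\<close>

lemma sign_tree:
  fixes z :: "nat \<Rightarrow> 'x::real_normed_vector \<Rightarrow>\<^sub>L 'k::real_or_complex"
  assumes s: "normed_space_over s"
    and z: "\<And>n. z n \<in> dual_ball s"
    and stable: "\<And>z'. block_seq z z' \<Longrightarrow> asymp_size z' = asymp_size z"
    and pos: "asymp_size z > 0" and \<eta>: "\<eta> > 0"
  shows "\<exists>u::nat \<Rightarrow> 'x. (\<forall>k. u k \<in> cball 0 1) \<and> (\<forall>K \<sigma>. \<exists>n. \<forall>k<K.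
           norm (blinfun_apply (z n) (u k) - of_real ((if k \<in> \<sigma> then 1 else - 1) * asymp_size z)) < \<eta>)"
proof -
  define sg :: "nat \<Rightarrow> nat set \<Rightarrow> real" where "sg k \<sigma> = (if k \<in> \<sigma> then 1 else - 1)" for k \<sigma>
  define N where "N us \<sigma> = {n. \<forall>k<length us.
      norm (blinfun_apply (z n) (us ! k) - of_real (sg k \<sigma> * asymp_size z)) < \<eta>}" for us \<sigma>
  have "\<exists>us. \<forall>K. (length (us K) = K \<and> (\<forall>\<sigma>. infinite (N (us K) \<sigma>)) \<and> set (us K) \<subseteq> cball 0 1) \<and>
      (\<exists>v. us (Suc K) = us K @ [v])"
  proof (rule dependent_nat_choice)
    show "\<exists>us. length us = 0 \<and> (\<forall>\<sigma>. infinite (N us \<sigma>)) \<and> set us \<subseteq> cball 0 1"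
      by (auto simp: N_def)
  next
    fix us :: "'x list" and K
    assume us: "length us = K \<and> (\<forall>\<sigma>. infinite (N us \<sigma>)) \<and> set us \<subseteq> cball 0 1"
    obtain v where v: "v \<in> cball 0 1" "\<And>\<sigma>. \<sigma> \<in> Pow {..<Suc K} \<Longrightarrow>
        infinite {n\<in>N us \<sigma>. norm (blinfun_apply (z n) v - of_real (sg K \<sigma> * asymp_size z)) < \<eta>}"
    proof -
      have "\<exists>u\<in>cball 0 1. \<forall>\<sigma>\<in>Pow {..<Suc K}.
          infinite {n\<in>N us \<sigma>. norm (blinfun_apply (z n) u - of_real (sg K \<sigma> * asymp_size z)) < \<eta>}"
        by (rule simultaneous_signs[OF s z stable pos \<eta>]) (use us in \<open>auto simp: sg_def\<close>)
      then show thesis using that by blast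
    qed
    have "infinite (N (us @ [v]) \<sigma>)" for \<sigma>
    proof -
      let ?\<sigma> = "\<sigma> \<inter> {..<Suc K}"
      have sg: "sg k \<sigma> = sg k ?\<sigma>" if "k < Suc K" for k using that by (simp add: sg_def)
      have "N (us @ [v]) \<sigma> = {n\<in>N us ?\<sigma>. norm (blinfun_apply (z n) v - of_real (sg K ?\<sigma> * asymp_size z)) < \<eta>}"
        unfolding N_def using us sg by (auto simp: less_Suc_eq nth_append all_conj_distrib)
      then show ?thesis using v(2)[of ?\<sigma>] by simp
    qed
    then show "\<exists>us'. (length us' = Suc K \<and> (\<forall>\<sigma>. infinite (N us' \<sigma>)) \<and> set us' \<subseteq> cball 0 1) \<and>
        (\<exists>v. us' = us @ [v])"
      using us v(1) by (intro exI[of _ "us @ [v]"]) auto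
  qed
  then obtain us where len: "\<And>K. length (us K) = K" and inf: "\<And>K \<sigma>. infinite (N (us K) \<sigma>)"
    and ball: "\<And>K. set (us K) \<subseteq> cball 0 1" and ext: "\<And>K. \<exists>v. us (Suc K) = us K @ [v]"
    by blast
  define u where "u k = us (Suc k) ! k" for k
  have nth: "us K ! k = u k" if "k < K" for k K
    using that
  proof (induction K)
    case (Suc K)
    obtain v where "us (Suc K) = us K @ [v]" using ext by blast
    then show ?case using Suc len by (cases "k = K") (auto simp: u_def nth_append)
  qed simp
  have "u k \<in> cball 0 1" for k
    unfolding u_def by (rule subsetD[OF ball nth_mem]) (simp add: len)
  moreover have "\<exists>n. \<forall>k<K. norm (blinfun_apply (z n) (u k) - of_real (sg k \<sigma> * asymp_size z)) < \<eta>" for K \<sigma>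
  proof -
    obtain n where "n \<in> N (us K) \<sigma>" using inf[of K \<sigma>] by (metis finite.emptyI all_not_in_conv)
    then show ?thesis using nth by (auto simp: N_def len)
  qed
  ultimately show ?thesis
    unfolding sg_def by (intro exI[of _ u] conjI allI) simp_all
qed

text \<open>
  Choosing the signs of the real parts, or of the imaginary parts, of the coefficients gives a lower estimate by their absolute sum. The error
  \<open>\<delta> / 4\<close> leaves half of it, and the better of the two choices accounts for at least half of the absolute sum.
\<close>

lemma signs_lower_bound:
  fixes z :: "nat \<Rightarrow> 'x::real_normed_vector \<Rightarrow>\<^sub>L 'k::real_or_complex"
    and u :: "nat \<Rightarrow> 'x" and K :: nat
  assumes s: "normed_space_over s" and z: "\<And>n. z n \<in> dual_ball s" and \<delta>: "\<delta> > 0"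
    and signs: "\<And>\<sigma>. \<exists>n. \<forall>k<K.
           norm (blinfun_apply (z n) (u k) - of_real ((if k \<in> \<sigma> then 1 else - 1) * \<delta>)) < \<delta> / 4"
  shows "\<delta> / 4 * (\<Sum>k<K. norm (t k)) \<le> norm (\<Sum>k<K. s (t k) (u k))"
proof -
  interpret normed_space_over s by fact
  obtain re im :: "'k \<Rightarrow> real" where re: "\<And>z w. re (z + w) = re z + re w" "\<And>z w. im (z + w) = im z + im w"
    "\<And>r z. re (of_real r * z) = r * re z" "\<And>r z. im (of_real r * z) = r * im z"
    "\<And>z. (norm z)\<^sup>2 = (re z)\<^sup>2 + (im z)\<^sup>2"
    by (rule real_or_complex_parts) blast
  have abs_le: "\<bar>re a\<bar> \<le> norm a" "\<bar>im a\<bar> \<le> norm a" "norm a \<le> \<bar>re a\<bar> + \<bar>im a\<bar>" for a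
  proof -
    show "\<bar>re a\<bar> \<le> norm a" "\<bar>im a\<bar> \<le> norm a"
      using re(5)[of a] by (auto intro!: abs_le_square_iff[THEN iffD2, of _ "norm a", simplified])
    have "norm a = sqrt ((re a)\<^sup>2 + (im a)\<^sup>2)" by (simp add: re(5)[symmetric])
    then show "norm a \<le> \<bar>re a\<bar> + \<bar>im a\<bar>" by (simp add: sqrt_sum_squares_le_sum_abs)
  qed
  have part: "\<delta> * (\<Sum>k<K. \<bar>f (t k)\<bar>) - \<delta> / 4 * (\<Sum>k<K. norm (t k)) \<le> norm (\<Sum>k<K. s (t k) (u k))"
    if f: "\<And>z w. f (z + w) = f z + f w" "\<And>r z. f (of_real r * z) = r * f z" "\<And>z. \<bar>f z\<bar> \<le> norm z" for f
  proof -
    define \<sigma> where "\<sigma> = {k. f (t k) \<ge> 0}"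
    define c where "c k = (if k \<in> \<sigma> then 1 else - 1) * \<delta>" for k
    obtain n where n: "\<And>k. k < K \<Longrightarrow> norm (blinfun_apply (z n) (u k) - of_real (c k)) < \<delta> / 4"
      using signs[of \<sigma>] by (auto simp: c_def)
    have f0: "f 0 = 0" using f(3)[of 0] by simp
    have f_sum: "f (\<Sum>k<K. g k) = (\<Sum>k<K. f (g k))" for g
      by (induction K) (auto simp: f0 f(1))
    have zn: "z n \<in> dual s" "norm (z n) \<le> 1" using z[of n] by (auto simp: dual_ball_def)
    let ?v = "\<Sum>k<K. s (t k) (u k)"
    have zv: "blinfun_apply (z n) ?v = (\<Sum>k<K. t k * blinfun_apply (z n) (u k))"
      by (simp add: blinfun.sum_right dual_applyD[OF zn(1)])
    have "\<delta> * (\<Sum>k<K. \<bar>f (t k)\<bar>) = (\<Sum>k<K. f (of_real (c k) * t k))"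
      unfolding sum_distrib_left f(2) by (intro sum.cong) (auto simp: c_def \<sigma>_def)
    also have "\<dots> = f (\<Sum>k<K. of_real (c k) * t k)" by (simp add: f_sum)
    also have "\<dots> \<le> norm (\<Sum>k<K. of_real (c k) * t k)" using f(3) abs_le_D1 by blast
    also have "(\<Sum>k<K. of_real (c k) * t k) = blinfun_apply (z n) ?v - (\<Sum>k<K. t k * (blinfun_apply (z n) (u k) - of_real (c k)))"
      unfolding zv sum_subtractf[symmetric] by (intro sum.cong) (auto simp: algebra_simps)
    also have "norm \<dots> \<le> norm (blinfun_apply (z n) ?v) + norm (\<Sum>k<K. t k * (blinfun_apply (z n) (u k) - of_real (c k)))"
      by (rule norm_triangle_ineq4)
    also have "norm (blinfun_apply (z n) ?v) \<le> 1 * norm ?v"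
      by (rule order_trans[OF norm_blinfun]) (intro mult_right_mono zn; simp)
    also have "norm (\<Sum>k<K. t k * (blinfun_apply (z n) (u k) - of_real (c k))) \<le> (\<Sum>k<K. \<delta> / 4 * norm (t k))"
    proof (rule sum_norm_le)
      fix k assume "k \<in> {..<K}"
      then have "norm (t k) * norm (blinfun_apply (z n) (u k) - of_real (c k)) \<le> norm (t k) * (\<delta> / 4)"
        using n[of k] by (intro mult_left_mono) auto
      then show "norm (t k * (blinfun_apply (z n) (u k) - of_real (c k))) \<le> \<delta> / 4 * norm (t k)"
        by (simp add: norm_mult mult.commute)
    qed
    finally show ?thesis by (simp add: sum_distrib_left)
  qed
  have "(\<Sum>k<K. norm (t k)) \<le> (\<Sum>k<K. \<bar>re (t k)\<bar>) + (\<Sum>k<K. \<bar>im (t k)\<bar>)"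
    unfolding sum.distrib[symmetric] by (intro sum_mono abs_le)
  then have "\<delta> * (\<Sum>k<K. norm (t k)) \<le> \<delta> * (\<Sum>k<K. \<bar>re (t k)\<bar>) + \<delta> * (\<Sum>k<K. \<bar>im (t k)\<bar>)"
    using \<delta> by (simp flip: distrib_left)
  moreover note part[of re, OF re(1,3) abs_le(1)] part[of im, OF re(2,4) abs_le(2)]
  ultimately show ?thesis by simp
qed

lemma apply_l1_simps [simp]:
  "apply_l1 (f + g) n = apply_l1 f n + apply_l1 g n"
  "apply_l1 (f - g) n = apply_l1 f n - apply_l1 g n"
  "apply_l1 (scale_l1 a h) n = a * apply_l1 h n"
  "apply_l1 (r *\<^sub>R f) n = r *\<^sub>R apply_l1 f n"
  by (simp_all only: plus_l1.rep_eq minus_l1.rep_eq scale_l1.rep_eq scaleR_l1.rep_eq)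

lemma l1_embedding:
  fixes s :: "'k::real_or_complex \<Rightarrow> 'x::banach \<Rightarrow> 'x" and u :: "nat \<Rightarrow> 'x"
  assumes s: "normed_space_over s" and u: "\<And>k. u k \<in> cball 0 1" and c: "c > 0"
    and lower: "\<And>K t. c * (\<Sum>k<K. norm (t k)) \<le> norm (\<Sum>k<K. s (t k) (u k))"
  shows "contains_copy_of_l1 s"
proof -
  interpret normed_space_over s by fact
  have summ: "summable (\<lambda>k. norm (apply_l1 f k))" for f :: "'k l1"
    using apply_l1[of f] by simp
  have le: "norm (s (apply_l1 f k) (u k)) \<le> norm (apply_l1 f k)" for f :: "'k l1" and k
    using u[of k] by (simp add: norm_scale mult_left_le)
  have summ': "summable (\<lambda>k. norm (s (apply_l1 f k) (u k)))" for f :: "'k l1"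
    by (rule summable_comparison_test'[OF summ[of f]]) (simp add: le)
  note summ'' = summable_norm_cancel[OF summ']
  define j where "j f = (\<Sum>k. s (apply_l1 f k) (u k))" for f :: "'k l1"
  have j_add: "j (f + g) = j f + j g" for f g
    unfolding j_def suminf_add[OF summ'' summ''] by (simp add: scale_left_distrib)
  have j_diff: "j (f - g) = j f - j g" for f g
    unfolding j_def suminf_diff[OF summ'' summ''] by (simp add: scale_left_diff_distrib)
  have bl: "bounded_linear (\<lambda>x. s a x)" for a
    by (rule bounded_linear_intro[where K="norm a"])
      (auto simp: scale_right_distrib norm_scale mult.commute scale_of_real[symmetric] scale_left_commute)
  have j_scale: "j (scale_l1 a f) = s a (j f)" for a f
    unfolding j_def bounded_linear.suminf[OF bl summ''] by simp
  have j_scaleR: "j (r *\<^sub>R f) = r *\<^sub>R j f" for r f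
  proof -
    have "r *\<^sub>R f = scale_l1 (of_real r) f"
      by (simp add: apply_l1_inject[symmetric] fun_eq_iff scaleR_conv_of_real)
    then show ?thesis by (simp add: j_scale scale_of_real)
  qed
  have j_norm: "norm (j f) \<le> norm f" for f
    unfolding j_def norm_l1.rep_eq
    using summable_norm[OF summ'[of f]] suminf_le[OF le[of f] summ'[of f] summ[of f]] by linarith
  have j_lower: "c * norm f \<le> norm (j f)" for f
  proof (rule LIMSEQ_le)
    show "(\<lambda>K. c * (\<Sum>k<K. norm (apply_l1 f k))) \<longlonglongrightarrow> c * norm f"
      unfolding norm_l1.rep_eq by (intro tendsto_mult tendsto_const summable_LIMSEQ summ)
    show "(\<lambda>K. norm (\<Sum>k<K. s (apply_l1 f k) (u k))) \<longlonglongrightarrow> norm (j f)"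
      unfolding j_def by (intro tendsto_norm summable_LIMSEQ summ'')
  qed (use lower in auto)
  have bl_j: "bounded_linear j"
    by (rule bounded_linear_intro[where K=1]) (auto simp: j_add j_scaleR j_norm)
  have app: "blinfun_apply (Blinfun j) = j" by (rule bounded_linear_Blinfun_apply[OF bl_j])
  have lip: "norm (f - g) \<le> norm (j f - j g) / c" for f g
    using j_lower[of "f - g"] c by (simp add: j_diff field_simps)
  have inj: "inj j"
  proof (rule injI)
    fix f g assume "j f = j g"
    then show "f = g" using lip[of f g] by simp
  qed
  have "homeomorphism UNIV (range j) j (inv j)"
  proof (rule homeomorphismI)
    show "continuous_on UNIV j" by (rule linear_continuous_on[OF bl_j])
    show "continuous_on (range j) (inv j)"
      unfolding continuous_on_iff
    proof (intro ballI allI impI)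
      fix v and e :: real assume v: "v \<in> range j" and e: "e > 0"
      have "dist (inv j w) (inv j v) < e" if w: "w \<in> range j" "dist w v < c * e" for w
      proof -
        have "norm (inv j w - inv j v) \<le> norm (w - v) / c"
          using lip[of "inv j w" "inv j v"] v w(1) by (simp add: f_inv_into_f)
        also have "\<dots> < e" using w(2) c by (simp add: dist_norm field_simps)
        finally show ?thesis by (simp add: dist_norm)
      qed
      then show "\<exists>d>0. \<forall>w\<in>range j. dist w v < d \<longrightarrow> dist (inv j w) (inv j v) < e"
        using c e by (intro exI[of _ "c * e"]) auto
    qed
  qed (auto simp: inj f_inv_into_f)
  moreover have "Blinfun j \<in> bounded_operators scale_l1 s"
    by (simp add: bounded_operators_def app j_scale)
  ultimately show ?thesis unfolding contains_copy_of_l1_def by (intro bexI[of _ "Blinfun j"]) (auto simp: app)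
qed

section \<open>Weak-star null block sequences\<close>

lemma weak_star_limit_apply:
  assumes "limitin (weak_star_topology s) y l sequentially"
  shows "(\<lambda>n. blinfun_apply (y n) u) \<longlonglongrightarrow> blinfun_apply l u"
proof -
  have "open {g. g u \<in> S}" if "open S" for S :: "'b set"
  proof -
    have "continuous_on UNIV (\<lambda>g::'a \<Rightarrow> 'b. g u)" by (simp add: continuous_on_product_coordinates)
    then show ?thesis using that open_vimage[of S "\<lambda>g. g u"] by (simp add: vimage_def)
  qed
  show ?thesis
  proof (rule topological_tendstoI)
    fix S :: "'b set" assume S: "open S" "blinfun_apply l u \<in> S"
    let ?U = "{\<phi> \<in> dual s. blinfun_apply \<phi> u \<in> S}"
    have "openin (weak_star_topology s) ?U"
      unfolding weak_star_topology_def openin_pullback_topology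
      using \<open>\<And>S. open S \<Longrightarrow> open {g. g u \<in> S}\<close>[OF S(1)] by (intro exI[of _ "{g. g u \<in> S}"]) auto
    moreover have "l \<in> ?U"
      using assms S(2) by (auto simp: limitin_def weak_star_topology_def topspace_pullback_topology)
    ultimately have "\<forall>\<^sub>F n in sequentially. y n \<in> ?U"
      using assms by (auto simp: limitin_def)
    then show "\<forall>\<^sub>F n in sequentially. blinfun_apply (y n) u \<in> S"
      by eventually_elim simp
  qed
qed

theorem weak_star_null_block_seq:
  fixes s :: "'k::real_or_complex \<Rightarrow> 'x::banach \<Rightarrow> 'x"
  assumes s: "normed_space_over s"
    and X: "\<not> contains_copy_of_l1 s \<or> sequentially_compactin (weak_star_topology s) (dual_ball s)"
    and x: "\<And>n. x n \<in> dual_ball s"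
  shows "\<exists>w. block_seq x w \<and> (\<forall>u. (\<lambda>n. blinfun_apply (w n) u) \<longlonglongrightarrow> 0)"
  using X
proof
  assume no: "\<not> contains_copy_of_l1 s"
  obtain z where z: "block_seq x z" "\<And>z'. block_seq z z' \<Longrightarrow> asymp_size z' = asymp_size z"
    using stable_block_seq[of x s] x by blast
  have zball: "z n \<in> dual_ball s" for n by (rule block_seq_dual_ball[OF z(1) x])
  then have nz: "norm (z n) \<le> 1" for n by (simp add: dual_ball_def)
  have "asymp_size z = 0"
  proof (rule ccontr)
    assume "asymp_size z \<noteq> 0"
    then have pos: "asymp_size z > 0" using asymp_size(1)[of z, OF nz] by simp
    then obtain u :: "nat \<Rightarrow> 'x" where u: "\<And>k. u k \<in> cball 0 1" "\<And>K \<sigma>. \<exists>n. \<forall>k<K.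
        norm (blinfun_apply (z n) (u k) - of_real ((if k \<in> \<sigma> then 1 else - 1) * asymp_size z)) < asymp_size z / 4"
      using sign_tree[OF s zball z(2) pos, of "asymp_size z / 4"] by auto
    have "contains_copy_of_l1 s"
    proof (rule l1_embedding[OF s u(1)])
      show "asymp_size z / 4 * (\<Sum>k<K. norm (t k)) \<le> norm (\<Sum>k<K. s (t k) (u k))" for K t
        by (rule signs_lower_bound[OF s zball pos u(2)])
    qed (use pos in simp)
    with no show False by simp
  qed
  then have b: "asymp_bound z 0" using asymp_size(3)[of z, OF nz] by simp
  have "(\<lambda>n. blinfun_apply (z n) u) \<longlonglongrightarrow> 0" for u
  proof (rule tendstoI)
    fix e :: real assume e: "e > 0"
    let ?u = "(1 / (norm u + 1)) *\<^sub>R u"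
    have pos: "norm u + 1 > 0" by (simp add: add_nonneg_pos)
    have "?u \<in> cball 0 1" using pos by (simp add: field_simps)
    moreover have "e / (norm u + 1) > 0" using e pos by simp
    ultimately have "\<forall>\<^sub>F n in sequentially. norm (blinfun_apply (z n) ?u) < e / (norm u + 1)"
      using b unfolding asymp_bound_def by blast
    then show "\<forall>\<^sub>F n in sequentially. dist (blinfun_apply (z n) u) 0 < e"
    proof eventually_elim
      case (elim n)
      then show ?case using pos by (simp add: blinfun.scaleR_right divide_less_cancel)
    qed
  qed
  with z(1) show ?thesis by blast
next
  assume "sequentially_compactin (weak_star_topology s) (dual_ball s)"
  moreover have "range x \<subseteq> dual_ball s" using x by blast
  ultimately obtain l and r :: "nat \<Rightarrow> nat" where r: "strict_mono r" and l: "limitin (weak_star_topology s) (x \<circ> r) l sequentially"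
    unfolding sequentially_compactin_def by blast
  have set_eq: "{2*n..<2*Suc n} = {2*n, Suc (2*n)}" for n :: nat by auto
  define w where "w n = (\<Sum>i=2*n..<2*Suc n. (if even i then 1/2 else -1/2) *\<^sub>R (x \<circ> r) i)" for n
  have w_eq: "w n = (1/2) *\<^sub>R (x \<circ> r) (2*n) - (1/2) *\<^sub>R (x \<circ> r) (Suc (2*n))" for n
    unfolding w_def set_eq by simp
  have "w n \<in> blocks (x \<circ> r) (2*n) (2*Suc n)" for n
    unfolding blocks_def w_def set_eq
    by (intro CollectI exI[of _ "\<lambda>i. if even i then 1/2 else -1/2"]) simp
  then have "block_seq (x \<circ> r) w"
    unfolding block_seq_def by (intro exI[of _ "\<lambda>n. 2 * n"]) (auto simp: strict_mono_def)
  then have "block_seq x w" using block_seq_trans block_seq_subseq[OF r] by blast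
  moreover have "(\<lambda>n. blinfun_apply (w n) u) \<longlonglongrightarrow> 0" for u
  proof -
    have lim: "(\<lambda>n. blinfun_apply ((x \<circ> r) n) u) \<longlonglongrightarrow> blinfun_apply l u"
      by (rule weak_star_limit_apply[OF l])
    have "(\<lambda>n. blinfun_apply ((x \<circ> r) (2*n)) u) \<longlonglongrightarrow> blinfun_apply l u"
      "(\<lambda>n. blinfun_apply ((x \<circ> r) (Suc (2*n))) u) \<longlonglongrightarrow> blinfun_apply l u"
      using LIMSEQ_subseq_LIMSEQ[OF lim, of "\<lambda>n. 2 * n"] LIMSEQ_subseq_LIMSEQ[OF lim, of "\<lambda>n. Suc (2 * n)"]
      by (auto simp: strict_mono_def o_def)
    then have "(\<lambda>n. (1/2) *\<^sub>R blinfun_apply ((x \<circ> r) (2*n)) u - (1/2) *\<^sub>R blinfun_apply ((x \<circ> r) (Suc (2*n))) u)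
        \<longlonglongrightarrow> (1/2) *\<^sub>R blinfun_apply l u - (1/2) *\<^sub>R blinfun_apply l u"
      by (intro tendsto_diff tendsto_scaleR tendsto_const)
    then show ?thesis by (simp add: w_eq blinfun.diff_left blinfun.scaleR_left)
  qed
  ultimately show ?thesis by blast
qed

section \<open>Continuous functions on a locally compact space\<close>

lemma norm_C0_le:
  assumes "\<And>x. norm (apply_C0 f x) \<le> B"
  shows "norm f \<le> B"
  unfolding norm_C0_eq using assms by (intro cSUP_least) auto

lemma continuous_on_C0: "continuous_on UNIV (apply_C0 f)"
  using range_apply_C0 by blast

lemma vanishes_C0: "vanishes_at_infinity (apply_C0 f)"
  using range_apply_C0 by blast

lemma compact_norm_ge_C0: "\<epsilon> > 0 \<Longrightarrow> compact {x. \<epsilon> \<le> norm (apply_C0 f x)}"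
  using vanishes_C0[of f] by (simp add: vanishes_at_infinity_def)

lemma C0_existence:
  assumes "continuous_on UNIV f" "vanishes_at_infinity f"
  shows "\<exists>F. apply_C0 F = f"
  using assms range_apply_C0 by (metis (mono_tags, lifting) imageE mem_Collect_eq)

lemma C0_dominated_existence:
  assumes "continuous_on UNIV g" "\<And>x. norm (g x) \<le> norm (apply_C0 f x)"
  shows "\<exists>F. apply_C0 F = g"
proof (rule C0_existence[OF assms(1)])
  show "vanishes_at_infinity g"
    by (rule vanishes_at_infinity_bound[OF assms(1) vanishes_C0, where c=1]) (use assms(2) in auto)
qed

lemma C0_mult_existence:
  fixes f :: "('a::topological_space, 'k::real_normed_vector) C0"
  assumes "continuous_on UNIV g" "\<And>x. \<bar>g x\<bar> \<le> 1"
  shows "\<exists>F. \<forall>x. apply_C0 F x = g x *\<^sub>R apply_C0 f x"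
proof -
  have "\<exists>F. apply_C0 F = (\<lambda>x. g x *\<^sub>R apply_C0 f x)"
    by (rule C0_dominated_existence[where f=f])
      (auto intro!: continuous_intros assms continuous_on_C0 mult_left_le_one_le)
  then show ?thesis by metis
qed

lemma C0_split:
  fixes f :: "('a::topological_space, 'k::real_normed_vector) C0"
  assumes g: "continuous_on UNIV g" "\<And>x. 0 \<le> g x" "\<And>x. g x \<le> 1" and f: "norm f \<le> 1"
  obtains f1 f2 where "f = f1 + f2" "\<And>x. apply_C0 f1 x = g x *\<^sub>R apply_C0 f x"
    "\<And>x. apply_C0 f2 x = (1 - g x) *\<^sub>R apply_C0 f x" "norm f1 \<le> 1" "norm f2 \<le> 1"
proof -
  obtain f1 where f1: "\<And>x. apply_C0 f1 x = g x *\<^sub>R apply_C0 f x"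
    using C0_mult_existence[of g f] g by auto
  obtain f2 where f2: "\<And>x. apply_C0 f2 x = (1 - g x) *\<^sub>R apply_C0 f x"
  proof -
    have "continuous_on UNIV (\<lambda>x. 1 - g x)" by (intro continuous_intros g)
    moreover have "\<bar>1 - g x\<bar> \<le> 1" for x using g(2,3)[of x] by simp
    ultimately show thesis using C0_mult_existence[of "\<lambda>x. 1 - g x" f] that by blast
  qed
  have le: "norm (apply_C0 f x) \<le> 1" for x using norm_apply_C0_le[of f x] f by linarith
  have "norm f1 \<le> 1" "norm f2 \<le> 1"
    using g le by (auto intro!: norm_C0_le mult_le_one simp: f1 f2)
  moreover have "f = f1 + f2"
    by (rule apply_C0_eqI) (simp add: f1 f2 algebra_simps)
  ultimately show thesis using that f1 f2 by blast
qed

text \<open>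
  Uniform approximation by a function that vanishes where the given one is small. In particular a function vanishing at
  a point is approximated by functions vanishing near that point.
\<close>

lemma soft_threshold:
  fixes f :: "('a::topological_space, 'k::real_normed_vector) C0"
  assumes \<eta>: "\<eta> > 0"
  obtains g where "\<And>x. norm (apply_C0 g x) \<le> norm (apply_C0 f x)" "norm (f - g) \<le> \<eta>"
    "\<And>x. norm (apply_C0 f x) \<le> \<eta> \<Longrightarrow> apply_C0 g x = 0"
proof -
  define c where "c x = max 0 (norm (apply_C0 f x) - \<eta>) / max \<eta> (norm (apply_C0 f x))" for x
  have "continuous_on UNIV c"
    unfolding c_def
  proof (intro continuous_on_divide continuous_on_max continuous_intros continuous_on_C0)
    show "\<forall>x\<in>UNIV. max \<eta> (norm (apply_C0 f x)) \<noteq> 0" using \<eta> by (auto simp: max_def)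
  qed
  moreover have c: "0 \<le> c x" "c x \<le> 1" for x
    unfolding c_def using \<eta> by (auto simp: divide_le_eq max_def)
  ultimately obtain g where g: "\<And>x. apply_C0 g x = c x *\<^sub>R apply_C0 f x"
    using C0_mult_existence[of c f] by auto
  show thesis
  proof (rule that)
    show "norm (apply_C0 g x) \<le> norm (apply_C0 f x)" for x
      using c[of x] by (simp add: g mult_left_le_one_le)
    show "apply_C0 g x = 0" if "norm (apply_C0 f x) \<le> \<eta>" for x
      using that by (simp add: g c_def)
    show "norm (f - g) \<le> \<eta>"
    proof (rule norm_C0_le)
      fix x
      have "apply_C0 (f - g) x = (1 - c x) *\<^sub>R apply_C0 f x"
        by (simp add: g algebra_simps)
      then have eq: "norm (apply_C0 (f - g) x) = (1 - c x) * norm (apply_C0 f x)"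
        using c[of x] by simp
      show "norm (apply_C0 (f - g) x) \<le> \<eta>"
      proof (cases "norm (apply_C0 f x) \<le> \<eta>")
        case True
        then show ?thesis unfolding eq by (simp add: c_def)
      next
        case False
        then have "c x = 1 - \<eta> / norm (apply_C0 f x)"
        proof -
          have "norm (apply_C0 f x) \<noteq> 0" using False \<eta> by linarith
          then show ?thesis using False by (simp add: c_def max_def diff_divide_distrib)
        qed
        then show ?thesis unfolding eq using False \<eta> by simp
      qed
    qed
  qed
qed

lemma bump:
  fixes C :: "'a::t2_space set"
  assumes lc: "locally_compact_space (euclidean :: 'a topology)"
    and C: "compact C" "open U" "C \<subseteq> U"
  obtains g :: "'a \<Rightarrow> real" where "continuous_on UNIV g" "\<And>x. 0 \<le> g x" "\<And>x. g x \<le> 1"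
    "\<And>x. x \<in> C \<Longrightarrow> g x = 1" "\<And>x. x \<notin> U \<Longrightarrow> g x = 0" "vanishes_at_infinity g"
proof -
  have "\<forall>x::'a. \<exists>W D. open W \<and> compact D \<and> x \<in> W \<and> W \<subseteq> D"
    using lc by (auto simp: locally_compact_space_def)
  then obtain W D :: "'a \<Rightarrow> 'a set" where WD: "\<And>x. open (W x)" "\<And>x. compact (D x)" "\<And>x. x \<in> W x" "\<And>x. W x \<subseteq> D x"
    by metis
  have "C \<subseteq> (\<Union>x\<in>C. W x)" using WD(3) by auto
  then obtain X where X: "X \<subseteq> C" "finite X" "C \<subseteq> (\<Union>x\<in>X. W x)"
    using compactE_image[OF C(1), of C W] WD(1) by blast
  define V where "V = U \<inter> (\<Union>x\<in>X. W x)"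
  have V: "open V" "C \<subseteq> V"
    using C X(3) unfolding V_def by (auto intro!: open_Int open_UN WD(1))
  have "Hausdorff_space (euclidean :: 'a topology)"
    unfolding Hausdorff_space_def disjnt_def using hausdorff by auto
  then have "completely_regular_space (euclidean :: 'a topology)"
    using lc locally_compact_regular_imp_completely_regular_space by blast
  then obtain f where f: "continuous_map (euclidean :: 'a topology) (top_of_set {0..1::real}) f" "f ` C \<subseteq> {0}" "f ` (- V) \<subseteq> {1}"
    using Urysohn_completely_regular_closed_compact[of 0 1 "euclidean :: 'a topology" "- V" C] V C(1)
    by (auto simp: disjnt_def)
  have fc: "continuous_on UNIV f" and f01: "\<And>x. f x \<in> {0..1}"
    using f(1) by (auto simp: continuous_map_in_subtopology)
  define g where "g x = 1 - f x" for x
  have gc: "continuous_on UNIV g" unfolding g_def by (intro continuous_intros fc)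
  have g0: "g x = 0" if "x \<notin> V" for x using f(3) that by (auto simp: g_def)
  show thesis
  proof (rule that)
    show "continuous_on UNIV g" by fact
    show "0 \<le> g x" "g x \<le> 1" for x using f01[of x] by (auto simp: g_def)
    show "g x = 1" if "x \<in> C" for x using f(2) that by (auto simp: g_def)
    show "g x = 0" if "x \<notin> U" for x using g0 that by (simp add: V_def)
    show "vanishes_at_infinity g"
    proof (rule vanishes_at_infinity_dominated[OF gc])
      fix \<epsilon> :: real assume "\<epsilon> > 0"
      have "{x. \<epsilon> \<le> norm (g x)} \<subseteq> (\<Union>x\<in>X. D x)"
      proof
        fix x assume "x \<in> {x. \<epsilon> \<le> norm (g x)}"
        then have "x \<in> V" using g0[of x] \<open>\<epsilon> > 0\<close> by fastforce
        then show "x \<in> (\<Union>x\<in>X. D x)" using WD(4) by (auto simp: V_def)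
      qed
      moreover have "compact (\<Union>x\<in>X. D x)" using X(2) WD(2) by blast
      ultimately show "\<exists>K. compact K \<and> {x. \<epsilon> \<le> norm (g x)} \<subseteq> K" by blast
    qed
  qed
qed

lemma bump_at_point:
  fixes k :: "'a::t2_space"
  assumes lc: "locally_compact_space (euclidean :: 'a topology)" and U: "open U" "k \<in> U"
  obtains h :: "('a, 'k::real_normed_field) C0" and g :: "'a \<Rightarrow> real"
    where "\<And>x. apply_C0 h x = of_real (g x)" "\<And>x. 0 \<le> g x" "\<And>x. g x \<le> 1" "g k = 1"
      "\<And>x. x \<notin> U \<Longrightarrow> g x = 0" "norm h \<le> 1"
proof -
  obtain g :: "'a \<Rightarrow> real" where g: "continuous_on UNIV g" "\<And>x. 0 \<le> g x" "\<And>x. g x \<le> 1"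
    "g k = 1" "\<And>x. x \<notin> U \<Longrightarrow> g x = 0" "vanishes_at_infinity g"
    using bump[OF lc, of "{k}" U] U by (metis compact_sing empty_subsetI insert_subset singletonI)
  have c: "continuous_on UNIV (\<lambda>x. of_real (g x) :: 'k)" by (intro continuous_intros g)
  have "vanishes_at_infinity (\<lambda>x. of_real (g x) :: 'k)"
    using g(6) by (simp add: vanishes_at_infinity_def)
  then obtain h :: "('a, 'k) C0" where h: "apply_C0 h = (\<lambda>x. of_real (g x))"
    using C0_existence[OF c] by blast
  have "norm h \<le> 1" by (rule norm_C0_le) (use g(2,3) in \<open>simp add: h\<close>)
  then show thesis using that[of h g] g h by simp
qed

lemma apply_C0_sum [simp]: "apply_C0 (\<Sum>i\<in>I. f i) x = (\<Sum>i\<in>I. apply_C0 (f i) x)"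
  by (induction I rule: infinite_finite_induct) auto

lemma apply_disjoint_sum:
  fixes f :: "'i \<Rightarrow> ('a::topological_space, 'k::real_normed_field) C0"
  assumes "finite J" "\<forall>i\<in>J. \<forall>j\<in>J. i \<noteq> j \<longrightarrow> apply_C0 (f i) x = 0 \<or> apply_C0 (f j) x = 0"
  obtains "(\<Sum>i\<in>J. a i * apply_C0 (f i) x) = 0" | j where "j \<in> J" "(\<Sum>i\<in>J. a i * apply_C0 (f i) x) = a j * apply_C0 (f j) x"
proof (cases "\<exists>j\<in>J. apply_C0 (f j) x \<noteq> 0")
  case True
  then obtain j where j: "j \<in> J" "apply_C0 (f j) x \<noteq> 0" by blast
  have "(\<Sum>i\<in>J. a i * apply_C0 (f i) x) = a j * apply_C0 (f j) x + (\<Sum>i\<in>J-{j}. a i * apply_C0 (f i) x)"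
    by (rule sum.remove) (use assms j in auto)
  also have "(\<Sum>i\<in>J-{j}. a i * apply_C0 (f i) x) = 0"
  proof (intro sum.neutral ballI)
    fix i assume "i \<in> J - {j}"
    then have "apply_C0 (f i) x = 0" using assms(2) j by blast
    then show "a i * apply_C0 (f i) x = 0" by simp
  qed
  finally have "(\<Sum>i\<in>J. a i * apply_C0 (f i) x) = a j * apply_C0 (f j) x" by simp
  then show thesis by (rule that(2)[OF j(1)])
next
  case False
  then have "(\<Sum>i\<in>J. a i * apply_C0 (f i) x) = 0" by (intro sum.neutral) auto
  then show thesis by (rule that(1))
qed

lemma norm_disjoint_sum:
  fixes f :: "'i \<Rightarrow> ('a::topological_space, 'k::real_or_complex) C0"
  assumes J: "finite J" and B: "B \<ge> 0"
    and disj: "\<And>i j x. i \<in> J \<Longrightarrow> j \<in> J \<Longrightarrow> i \<noteq> j \<Longrightarrow> apply_C0 (f i) x = 0 \<or> apply_C0 (f j) x = 0"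
    and f: "\<And>i. i \<in> J \<Longrightarrow> norm (f i) \<le> 1" and a: "\<And>i. i \<in> J \<Longrightarrow> norm (a i) \<le> B"
  shows "norm (\<Sum>i\<in>J. scaleC0 (a i) (f i)) \<le> B"
proof (rule norm_C0_le)
  fix x
  show "norm (apply_C0 (\<Sum>i\<in>J. scaleC0 (a i) (f i)) x) \<le> B"
  proof (rule apply_disjoint_sum[OF J, of f x a])
    show "\<forall>i\<in>J. \<forall>j\<in>J. i \<noteq> j \<longrightarrow> apply_C0 (f i) x = 0 \<or> apply_C0 (f j) x = 0"
      using disj by blast
  next
    fix j assume 2: "j \<in> J" "(\<Sum>i\<in>J. a i * apply_C0 (f i) x) = a j * apply_C0 (f j) x"
    have "norm (a j) * norm (apply_C0 (f j) x) \<le> B * 1"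
      using order_trans[OF norm_apply_C0_le f[OF 2(1)]] a[OF 2(1)] B by (intro mult_mono) auto
    then show ?thesis using 2 by (simp add: norm_mult)
  qed (use B in auto)
qed

section \<open>Functionals over a scattered space\<close>

lemma dual_scale_in_dual: "\<phi> \<in> dual s \<Longrightarrow> dual_scale a \<phi> \<in> dual s"
  by (auto simp: dual_def bounded_operators_def algebra_simps)

text \<open>
  Values of \<^term>\<open>\<phi>\<close> on disjointly supported functions add up. Hence, if \<^term>\<open>f\<close> nearly attains the norm of \<^term>\<open>\<phi>\<close> on the
  functions supported in \<^term>\<open>U\<close>, then \<^term>\<open>\<phi>\<close> is small on those that vanish where \<^term>\<open>f\<close> is not small. For
  \<open>U = UNIV\<close> this is the tightness of \<^term>\<open>\<phi>\<close>; for \<open>U = - {k}\<close> it says that \<^term>\<open>\<phi>\<close> has little mass in a punctured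
  neighbourhood of \<^term>\<open>k\<close>.
\<close>

lemma exhausting_function:
  fixes \<phi> :: "('a::t2_space, 'k::real_or_complex) C0 \<Rightarrow>\<^sub>L 'k"
  assumes \<phi>: "\<phi> \<in> dual scaleC0" and \<epsilon>: "\<epsilon> > 0"
  obtains f :: "('a, 'k) C0" and \<eta> where "\<eta> > 0" "\<And>x. x \<notin> U \<Longrightarrow> apply_C0 f x = 0"
    "\<And>g. norm g \<le> 1 \<Longrightarrow> (\<And>x. x \<notin> U \<Longrightarrow> apply_C0 g x = 0) \<Longrightarrow>
      (\<And>x. \<eta> \<le> norm (apply_C0 f x) \<Longrightarrow> apply_C0 g x = 0) \<Longrightarrow> norm (blinfun_apply \<phi> g) \<le> \<epsilon>"
proof -
  define S where "S = {f :: ('a, 'k) C0. norm f \<le> 1 \<and> (\<forall>x. x \<notin> U \<longrightarrow> apply_C0 f x = 0)}"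
  define v where "v = (SUP f\<in>S. norm (blinfun_apply \<phi> f))"
  have S0: "0 \<in> S" by (simp add: S_def)
  have bdd: "bdd_above ((\<lambda>f. norm (blinfun_apply \<phi> f)) ` S)"
  proof (rule bdd_aboveI2)
    fix f assume "f \<in> S"
    then have "norm f \<le> 1" by (simp add: S_def)
    then have "norm \<phi> * norm f \<le> norm \<phi> * 1" by (intro mult_left_mono) auto
    then show "norm (blinfun_apply \<phi> f) \<le> norm \<phi>" using norm_blinfun[of \<phi> f] by simp
  qed
  have le_v: "norm (blinfun_apply \<phi> f) \<le> v" if "f \<in> S" for f
    unfolding v_def by (rule cSUP_upper[OF that bdd])
  have "\<exists>f\<in>S. v - \<epsilon> / 2 < norm (blinfun_apply \<phi> f)"
    using less_cSUP_iff[OF _ bdd, of "v - \<epsilon> / 2"] S0 \<epsilon> unfolding v_def by auto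
  then obtain f where f: "f \<in> S" "v - \<epsilon> / 2 < norm (blinfun_apply \<phi> f)" by blast
  define \<eta> where "\<eta> = \<epsilon> / 2 / (norm \<phi> + 1)"
  have n1: "norm \<phi> + 1 > 0" by (simp add: add_nonneg_pos)
  have \<eta>: "\<eta> > 0" using \<epsilon> n1 by (simp add: \<eta>_def)
  obtain f' where f': "\<And>x. norm (apply_C0 f' x) \<le> norm (apply_C0 f x)" "norm (f - f') \<le> \<eta>"
    "\<And>x. norm (apply_C0 f x) \<le> \<eta> \<Longrightarrow> apply_C0 f' x = 0"
    by (rule soft_threshold[OF \<eta>, of f]) blast
  have "norm (blinfun_apply \<phi> (f - f')) \<le> norm \<phi> * \<eta>"
    by (rule order_trans[OF norm_blinfun]) (intro mult_left_mono f' norm_ge_zero)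
  also have "\<dots> \<le> (norm \<phi> + 1) * \<eta>" using \<eta> by (intro mult_right_mono) auto
  also have "\<dots> = \<epsilon> / 2" unfolding \<eta>_def using n1 by (intro nonzero_mult_div_cancel_left[of _ "\<epsilon> / 2", folded times_divide_eq_right]) simp
  finally have "norm (blinfun_apply \<phi> f) - norm (blinfun_apply \<phi> f') \<le> \<epsilon> / 2"
    using norm_triangle_ineq2[of "blinfun_apply \<phi> f" "blinfun_apply \<phi> f'"] by (simp add: blinfun.diff_right)
  then have near: "v - \<epsilon> < norm (blinfun_apply \<phi> f')" using f(2) by linarith
  have f'S: "norm f' \<le> 1" "\<And>x. x \<notin> U \<Longrightarrow> apply_C0 f' x = 0"
  proof -
    show "norm f' \<le> 1"
    proof (rule norm_C0_le)
      fix x show "norm (apply_C0 f' x) \<le> 1"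
        using f'(1)[of x] norm_apply_C0_le[of f x] f(1) by (simp add: S_def)
    qed
    show "apply_C0 f' x = 0" if "x \<notin> U" for x
      using f'(3)[of x] f(1) that \<eta> by (simp add: S_def)
  qed
  show thesis
  proof (rule that[of \<eta> f, OF \<eta>])
    show "apply_C0 f x = 0" if "x \<notin> U" for x using f(1) that by (simp add: S_def)
    fix g :: "('a, 'k) C0"
    assume g: "norm g \<le> 1" "\<And>x. x \<notin> U \<Longrightarrow> apply_C0 g x = 0"
      "\<And>x. \<eta> \<le> norm (apply_C0 f x) \<Longrightarrow> apply_C0 g x = 0"
    let ?a = "unit_conj (blinfun_apply \<phi> f')" and ?b = "unit_conj (blinfun_apply \<phi> g)"
    let ?e = "scaleC0 ?a f' + scaleC0 ?b g"
    have "?e \<in> S"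
      unfolding S_def
    proof (intro CollectI conjI allI impI)
      show "norm ?e \<le> 1"
      proof (rule norm_C0_le)
        fix x
        have "apply_C0 f' x = 0 \<or> apply_C0 g x = 0"
          using f'(3)[of x] g(3)[of x] by linarith
        then show "norm (apply_C0 ?e x) \<le> 1"
          using norm_apply_C0_le[of f' x] norm_apply_C0_le[of g x] f'S(1) g(1)
          by (auto simp: norm_mult)
      qed
      show "apply_C0 ?e x = 0" if "x \<notin> U" for x using that g(2) f'S(2) by simp
    qed
    then have "norm (blinfun_apply \<phi> ?e) \<le> v" by (rule le_v)
    moreover have "blinfun_apply \<phi> ?e = of_real (norm (blinfun_apply \<phi> f') + norm (blinfun_apply \<phi> g))"
      by (simp add: blinfun.add_right dual_applyD[OF \<phi>])
    ultimately have "norm (blinfun_apply \<phi> f') + norm (blinfun_apply \<phi> g) \<le> v"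
      by (simp only: norm_of_real)
    with near show "norm (blinfun_apply \<phi> g) \<le> \<epsilon>" by linarith
  qed
qed

lemma small_near_point:
  fixes \<phi> :: "('a::t2_space, 'k::real_or_complex) C0 \<Rightarrow>\<^sub>L 'k"
  assumes \<phi>: "\<phi> \<in> dual scaleC0" and \<epsilon>: "\<epsilon> > 0"
  obtains U where "open U" "k \<in> U"
    "\<And>g. norm g \<le> 1 \<Longrightarrow> (\<And>x. x \<notin> U \<Longrightarrow> apply_C0 g x = 0) \<Longrightarrow> apply_C0 g k = 0 \<Longrightarrow>
      norm (blinfun_apply \<phi> g) \<le> \<epsilon>"
proof -
  obtain f :: "('a, 'k) C0" and \<eta> where f: "\<eta> > 0" "\<And>x. x \<notin> - {k} \<Longrightarrow> apply_C0 f x = 0"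
    "\<And>g. norm g \<le> 1 \<Longrightarrow> (\<And>x. x \<notin> - {k} \<Longrightarrow> apply_C0 g x = 0) \<Longrightarrow>
      (\<And>x. \<eta> \<le> norm (apply_C0 f x) \<Longrightarrow> apply_C0 g x = 0) \<Longrightarrow> norm (blinfun_apply \<phi> g) \<le> \<epsilon>"
    by (rule exhausting_function[OF \<phi> \<epsilon>, of "- {k}"]) blast
  show thesis
  proof (rule that[of "{x. norm (apply_C0 f x) < \<eta>}"])
    show "open {x. norm (apply_C0 f x) < \<eta>}"
      by (intro open_Collect_less continuous_intros continuous_on_C0)
    show "k \<in> {x. norm (apply_C0 f x) < \<eta>}" using f(1,2) by simp
    fix g :: "('a, 'k) C0"
    assume "norm g \<le> 1" "\<And>x. x \<notin> {x. norm (apply_C0 f x) < \<eta>} \<Longrightarrow> apply_C0 g x = 0" "apply_C0 g k = 0"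
    then show "norm (blinfun_apply \<phi> g) \<le> \<epsilon>"
      by (intro f(3)) auto
  qed
qed

text \<open>
  On the functions supported in \<^term>\<open>U\<close> the functional is approximated by combinations of finitely many point evaluations. This is
  stated through the common kernel: \<^term>\<open>\<phi>\<close> is small on the functions that vanish at these points.
\<close>

definition atomic_on :: "(('a::t2_space, 'k::real_or_complex) C0 \<Rightarrow>\<^sub>L 'k) \<Rightarrow> 'a set \<Rightarrow> bool" where
  "atomic_on \<phi> U \<longleftrightarrow> (\<forall>\<epsilon>>0. \<exists>F. finite F \<and> (\<forall>f. norm f \<le> 1 \<longrightarrow> (\<forall>x. x \<notin> U \<longrightarrow> apply_C0 f x = 0) \<longrightarrow>
     (\<forall>x\<in>F. apply_C0 f x = 0) \<longrightarrow> norm (blinfun_apply \<phi> f) \<le> \<epsilon>))"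

lemma atomic_on_Union_chain:
  fixes \<phi> :: "('a::t2_space, 'k::real_or_complex) C0 \<Rightarrow>\<^sub>L 'k"
  assumes lc: "locally_compact_space (euclidean :: 'a topology)" and \<phi>: "\<phi> \<in> dual scaleC0"
    and chain: "subset.chain {U. open U \<and> atomic_on \<phi> U} \<C>" and ne: "\<C> \<noteq> {}"
  shows "atomic_on \<phi> (\<Union>\<C>)"
  unfolding atomic_on_def
proof (intro allI impI)
  fix \<epsilon> :: real assume "\<epsilon> > 0"
  then have \<epsilon>: "\<epsilon> / 2 > 0" by simp
  have \<C>: "open U" "atomic_on \<phi> U" if "U \<in> \<C>" for U
    using chain that by (auto simp: subset_chain_def)
  obtain f0 :: "('a, 'k) C0" and \<eta> where f0: "\<eta> > 0" "\<And>x. x \<notin> \<Union>\<C> \<Longrightarrow> apply_C0 f0 x = 0"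
    "\<And>g. norm g \<le> 1 \<Longrightarrow> (\<And>x. x \<notin> \<Union>\<C> \<Longrightarrow> apply_C0 g x = 0) \<Longrightarrow>
      (\<And>x. \<eta> \<le> norm (apply_C0 f0 x) \<Longrightarrow> apply_C0 g x = 0) \<Longrightarrow> norm (blinfun_apply \<phi> g) \<le> \<epsilon> / 2"
    by (rule exhausting_function[OF \<phi> \<epsilon>, of "\<Union>\<C>"]) blast
  let ?C = "{x. \<eta> \<le> norm (apply_C0 f0 x)}"
  have C: "compact ?C" by (rule compact_norm_ge_C0[OF f0(1)])
  have "?C \<subseteq> \<Union>\<C>" using f0(1,2) by force
  then obtain \<D> where \<D>: "\<D> \<subseteq> \<C>" "finite \<D>" "?C \<subseteq> \<Union>\<D>"
    using compactE[OF C, of \<C>] \<C>(1) by blast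
  have "\<exists>V\<in>\<C>. ?C \<subseteq> V"
  proof (cases "\<D> = {}")
    case True
    then have "?C = {}" using \<D>(3) by (metis Union_empty subset_empty)
    moreover obtain V where "V \<in> \<C>" using ne by (metis all_not_in_conv)
    ultimately show ?thesis by (metis empty_subsetI)
  next
    case False
    have "subset.chain {U. open U \<and> atomic_on \<phi> U} \<D>"
    proof -
      have "\<C> \<subseteq> {U. open U \<and> atomic_on \<phi> U}" "\<forall>X\<in>\<C>. \<forall>Y\<in>\<C>. X \<subseteq> Y \<or> Y \<subseteq> X"
        using chain[unfolded subset_chain_def] by (rule conjunct1, rule conjunct2)
      then show ?thesis
        unfolding subset_chain_def using \<D>(1)
        by (intro conjI ballI) (erule (1) order_trans[rotated], metis subsetD)
    qed
    then have "\<Union>\<D> \<in> \<D>" by (rule Union_in_chain[OF \<D>(2) False])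
    then have "\<Union>\<D> \<in> \<C>" using \<D>(1) by (rule subsetD[rotated])
    with \<D>(3) show ?thesis by (intro bexI[of _ "\<Union>\<D>"])
  qed
  then obtain V where V: "V \<in> \<C>" "?C \<subseteq> V" by blast
  obtain g :: "'a \<Rightarrow> real" where g: "continuous_on UNIV g" "\<And>x. 0 \<le> g x" "\<And>x. g x \<le> 1"
    "\<And>x. x \<in> ?C \<Longrightarrow> g x = 1" "\<And>x. x \<notin> V \<Longrightarrow> g x = 0" "vanishes_at_infinity g"
    by (rule bump[OF lc C \<C>(1)[OF V(1)] V(2)]) (rule that)
  obtain F where F: "finite F" "\<And>f. norm f \<le> 1 \<Longrightarrow> (\<forall>x. x \<notin> V \<longrightarrow> apply_C0 f x = 0) \<Longrightarrow>
     (\<forall>x\<in>F. apply_C0 f x = 0) \<Longrightarrow> norm (blinfun_apply \<phi> f) \<le> \<epsilon> / 2"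
    using \<C>(2)[OF V(1)] \<epsilon> unfolding atomic_on_def by blast
  have "norm (blinfun_apply \<phi> f) \<le> \<epsilon>"
    if f: "norm f \<le> 1" "\<forall>x. x \<notin> \<Union>\<C> \<longrightarrow> apply_C0 f x = 0" "\<forall>x\<in>F. apply_C0 f x = 0" for f
  proof -
    obtain f1 f2 where f12: "f = f1 + f2" "\<And>x. apply_C0 f1 x = g x *\<^sub>R apply_C0 f x"
      "\<And>x. apply_C0 f2 x = (1 - g x) *\<^sub>R apply_C0 f x" "norm f1 \<le> 1" "norm f2 \<le> 1"
      by (rule C0_split[OF g(1-3) f(1)]) blast
    have "norm (blinfun_apply \<phi> f1) \<le> \<epsilon> / 2"
      by (rule F(2)[OF f12(4)]) (simp_all add: f12(2) f(3) g(5))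
    moreover have "norm (blinfun_apply \<phi> f2) \<le> \<epsilon> / 2"
    proof (rule f0(3)[OF f12(5)])
      show "apply_C0 f2 x = 0" if "x \<notin> \<Union>\<C>" for x using f(2) that by (simp add: f12(3))
      show "apply_C0 f2 x = 0" if "\<eta> \<le> norm (apply_C0 f0 x)" for x
        using g(4)[of x] that by (simp add: f12(3))
    qed
    ultimately show ?thesis
      unfolding f12(1) blinfun.add_right
      using norm_triangle_ineq[of "blinfun_apply \<phi> f1" "blinfun_apply \<phi> f2"] by linarith
  qed
  with F(1) show "\<exists>F. finite F \<and> (\<forall>f. norm f \<le> 1 \<longrightarrow> (\<forall>x. x \<notin> \<Union>\<C> \<longrightarrow> apply_C0 f x = 0) \<longrightarrow>
     (\<forall>x\<in>F. apply_C0 f x = 0) \<longrightarrow> norm (blinfun_apply \<phi> f) \<le> \<epsilon>)" by blast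
qed

lemma atomic_on_insert:
  fixes \<phi> :: "('a::t2_space, 'k::real_or_complex) C0 \<Rightarrow>\<^sub>L 'k"
  assumes lc: "locally_compact_space (euclidean :: 'a topology)" and \<phi>: "\<phi> \<in> dual scaleC0"
    and M: "atomic_on \<phi> M" and T: "open T" "T - M = {p}"
  shows "atomic_on \<phi> (M \<union> T)"
  unfolding atomic_on_def
proof (intro allI impI)
  fix \<epsilon> :: real assume "\<epsilon> > 0"
  then have \<epsilon>: "\<epsilon> / 2 > 0" by simp
  obtain U where U: "open U" "p \<in> U"
    "\<And>g. norm g \<le> 1 \<Longrightarrow> (\<And>x. x \<notin> U \<Longrightarrow> apply_C0 g x = 0) \<Longrightarrow> apply_C0 g p = 0 \<Longrightarrow>
      norm (blinfun_apply \<phi> g) \<le> \<epsilon> / 2"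
    by (rule small_near_point[OF \<phi> \<epsilon>, of p]) blast
  have pTU: "compact {p}" "open (T \<inter> U)" "{p} \<subseteq> T \<inter> U" using T U(1,2) by auto
  obtain g :: "'a \<Rightarrow> real" where g: "continuous_on UNIV g" "\<And>x. 0 \<le> g x" "\<And>x. g x \<le> 1"
    "\<And>x. x \<in> {p} \<Longrightarrow> g x = 1" "\<And>x. x \<notin> T \<inter> U \<Longrightarrow> g x = 0" "vanishes_at_infinity g"
    by (rule bump[OF lc pTU]) (rule that)
  obtain F where F: "finite F" "\<And>f. norm f \<le> 1 \<Longrightarrow> (\<forall>x. x \<notin> M \<longrightarrow> apply_C0 f x = 0) \<Longrightarrow>
     (\<forall>x\<in>F. apply_C0 f x = 0) \<Longrightarrow> norm (blinfun_apply \<phi> f) \<le> \<epsilon> / 2"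
    using M \<epsilon> unfolding atomic_on_def by blast
  have "norm (blinfun_apply \<phi> f) \<le> \<epsilon>"
    if f: "norm f \<le> 1" "\<forall>x. x \<notin> M \<union> T \<longrightarrow> apply_C0 f x = 0" "\<forall>x\<in>insert p F. apply_C0 f x = 0" for f
  proof -
    obtain f1 f2 where f12: "f = f1 + f2" "\<And>x. apply_C0 f1 x = g x *\<^sub>R apply_C0 f x"
      "\<And>x. apply_C0 f2 x = (1 - g x) *\<^sub>R apply_C0 f x" "norm f1 \<le> 1" "norm f2 \<le> 1"
      by (rule C0_split[OF g(1-3) f(1)]) blast
    have "norm (blinfun_apply \<phi> f1) \<le> \<epsilon> / 2"
      by (rule U(3)[OF f12(4)]) (use f(3) in \<open>simp_all add: f12(2) g(5)\<close>)
    moreover have "norm (blinfun_apply \<phi> f2) \<le> \<epsilon> / 2"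
    proof (rule F(2)[OF f12(5)])
      show "\<forall>x. x \<notin> M \<longrightarrow> apply_C0 f2 x = 0"
      proof (intro allI impI)
        fix x assume "x \<notin> M"
        then have "x = p \<or> x \<notin> M \<union> T" using T(2) by blast
        then show "apply_C0 f2 x = 0" using f(2) g(4) f12(3)[of x] by auto
      qed
      show "\<forall>x\<in>F. apply_C0 f2 x = 0" using f(3) f12(3) by simp
    qed
    ultimately show ?thesis
      unfolding f12(1) blinfun.add_right
      using norm_triangle_ineq[of "blinfun_apply \<phi> f1" "blinfun_apply \<phi> f2"] by linarith
  qed
  then show "\<exists>F. finite F \<and> (\<forall>f. norm f \<le> 1 \<longrightarrow> (\<forall>x. x \<notin> M \<union> T \<longrightarrow> apply_C0 f x = 0) \<longrightarrow>
     (\<forall>x\<in>F. apply_C0 f x = 0) \<longrightarrow> norm (blinfun_apply \<phi> f) \<le> \<epsilon>)"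
    using F(1) by (intro exI[of _ "insert p F"]) blast
qed

text \<open>
  By Zorn's lemma there is a maximal open set on which \<^term>\<open>\<phi>\<close> is atomic. If it were not the whole space, an isolated point of its
  complement could be added to it.
\<close>

theorem scattered_imp_atomic:
  fixes \<phi> :: "('a::t2_space, 'k::real_or_complex) C0 \<Rightarrow>\<^sub>L 'k"
  assumes lc: "locally_compact_space (euclidean :: 'a topology)"
    and sc: "scattered (UNIV :: 'a set)" and \<phi>: "\<phi> \<in> dual scaleC0"
  shows "atomic_on \<phi> UNIV"
proof -
  let ?A = "{U. open U \<and> atomic_on \<phi> U}"
  have "\<exists>M\<in>?A. \<forall>X\<in>?A. M \<subseteq> X \<longrightarrow> X = M"
  proof (rule subset_Zorn')
    fix \<C> assume ch: "subset.chain ?A \<C>"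
    show "\<Union>\<C> \<in> ?A"
    proof (cases "\<C> = {}")
      case True
      have "f = 0" if "\<forall>x. apply_C0 f x = 0" for f :: "('a, 'k) C0"
        using that by (intro apply_C0_eqI) simp
      then have "norm (blinfun_apply \<phi> f) \<le> \<epsilon>" if "\<forall>x. apply_C0 f x = 0" "\<epsilon> > 0" for f \<epsilon>
        using that by (metis blinfun.zero_right less_imp_le norm_zero)
      then have "atomic_on \<phi> {}"
        unfolding atomic_on_def by (auto intro!: exI[of _ "{}"])
      then show ?thesis using True by simp
    next
      case False
      have "open U" if "U \<in> \<C>" for U using ch that by (auto simp: subset_chain_def)
      then show ?thesis using atomic_on_Union_chain[OF lc \<phi> ch False] by auto
    qed
  qed
  then obtain M where M: "open M" "atomic_on \<phi> M" "\<And>X. open X \<Longrightarrow> atomic_on \<phi> X \<Longrightarrow> M \<subseteq> X \<Longrightarrow> X = M"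
    by blast
  have "M = UNIV"
  proof (rule ccontr)
    assume "M \<noteq> UNIV"
    then have "- M \<noteq> {}" by auto
    then obtain p where "p isolated_in (- M)" using sc unfolding scattered_def by blast
    then obtain T where T: "open T" "T \<inter> - M = {p}" by (auto simp: isolated_in_def)
    then have T': "T - M = {p}" by blast
    have "M \<union> T = M"
      by (rule M(3)) (use M(1) T(1) atomic_on_insert[OF lc \<phi> M(2) T(1) T'] in auto)
    with T' show False by blast
  qed
  with M(2) show ?thesis by simp
qed

section \<open>Point masses\<close>

text \<open>
  The mass of the point \<^term>\<open>k\<close> is the limit of the values of \<^term>\<open>\<phi>\<close> at functions in the unit ball that are 1 at \<^term>\<open>k\<close>
  and whose supports shrink to \<^term>\<open>k\<close>. It is the value at \<open>{k}\<close> of the measure that represents \<^term>\<open>\<phi>\<close>; no measure is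
  needed to define it.
\<close>

definition is_point_mass :: "(('a::t2_space, 'k::real_or_complex) C0 \<Rightarrow>\<^sub>L 'k) \<Rightarrow> 'a \<Rightarrow> 'k \<Rightarrow> bool" where
  "is_point_mass \<phi> k c \<longleftrightarrow> (\<forall>\<epsilon>>0. \<exists>U. open U \<and> k \<in> U \<and>
     (\<forall>h. norm h \<le> 1 \<longrightarrow> (\<forall>x. x \<notin> U \<longrightarrow> apply_C0 h x = 0) \<longrightarrow> apply_C0 h k = 1 \<longrightarrow>
        norm (blinfun_apply \<phi> h - c) \<le> \<epsilon>))"

definition point_mass :: "(('a::t2_space, 'k::real_or_complex) C0 \<Rightarrow>\<^sub>L 'k) \<Rightarrow> 'a \<Rightarrow> 'k" where
  "point_mass \<phi> k = (THE c. is_point_mass \<phi> k c)"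

lemma is_point_mass_unique:
  fixes \<phi> :: "('a::t2_space, 'k::real_or_complex) C0 \<Rightarrow>\<^sub>L 'k"
  assumes lc: "locally_compact_space (euclidean :: 'a topology)"
    and c: "is_point_mass \<phi> k c" and d: "is_point_mass \<phi> k d"
  shows "c = d"
proof -
  have "dist c d \<le> 0"
  proof (rule field_le_epsilon)
    fix \<epsilon> :: real assume "\<epsilon> > 0"
    then have \<epsilon>: "\<epsilon> / 2 > 0" by simp
    obtain U where U: "open U" "k \<in> U" "\<And>h. norm h \<le> 1 \<Longrightarrow> (\<forall>x. x \<notin> U \<longrightarrow> apply_C0 h x = 0) \<Longrightarrow>
        apply_C0 h k = 1 \<Longrightarrow> norm (blinfun_apply \<phi> h - c) \<le> \<epsilon> / 2"
      using c \<epsilon> unfolding is_point_mass_def by blast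
    obtain V where V: "open V" "k \<in> V" "\<And>h. norm h \<le> 1 \<Longrightarrow> (\<forall>x. x \<notin> V \<longrightarrow> apply_C0 h x = 0) \<Longrightarrow>
        apply_C0 h k = 1 \<Longrightarrow> norm (blinfun_apply \<phi> h - d) \<le> \<epsilon> / 2"
      using d \<epsilon> unfolding is_point_mass_def by blast
    have "open (U \<inter> V)" "k \<in> U \<inter> V" using U V by auto
    then obtain h :: "('a, 'k) C0" and g where h: "\<And>x. apply_C0 h x = of_real (g x)" "g k = 1"
      "\<And>x. x \<notin> U \<inter> V \<Longrightarrow> g x = 0" "norm h \<le> 1"
      using bump_at_point[OF lc] by metis
    have "norm (blinfun_apply \<phi> h - c) \<le> \<epsilon> / 2" by (rule U(3)) (use h in auto)
    moreover have "norm (blinfun_apply \<phi> h - d) \<le> \<epsilon> / 2" by (rule V(3)) (use h in auto)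
    ultimately show "dist c d \<le> 0 + \<epsilon>"
      using dist_triangle3[of c d "blinfun_apply \<phi> h"] by (simp add: dist_norm)
  qed
  then show ?thesis by simp
qed

lemma is_point_mass_exists:
  fixes \<phi> :: "('a::t2_space, 'k::real_or_complex) C0 \<Rightarrow>\<^sub>L 'k"
  assumes lc: "locally_compact_space (euclidean :: 'a topology)" and \<phi>: "\<phi> \<in> dual scaleC0"
  shows "\<exists>c. is_point_mass \<phi> k c"
proof -
  have "\<exists>U. open U \<and> k \<in> U \<and> (\<forall>g. norm g \<le> 1 \<longrightarrow> (\<forall>x. x \<notin> U \<longrightarrow> apply_C0 g x = 0) \<longrightarrow>
      apply_C0 g k = 0 \<longrightarrow> norm (blinfun_apply \<phi> g) \<le> 1 / real (Suc n))" for n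
    by (rule small_near_point[OF \<phi>, of "1 / real (Suc n)" k]) auto
  then obtain U where U: "\<And>n. open (U n)" "\<And>n. k \<in> U n"
    "\<And>n g. norm g \<le> 1 \<Longrightarrow> (\<forall>x. x \<notin> U n \<longrightarrow> apply_C0 g x = 0) \<Longrightarrow>
      apply_C0 g k = 0 \<Longrightarrow> norm (blinfun_apply \<phi> g) \<le> 1 / real (Suc n)"
    by metis
  define V where "V n = (\<Inter>i\<le>n. U i)" for n
  have V: "open (V n)" "k \<in> V n" for n unfolding V_def using U by auto
  have close: "norm (blinfun_apply \<phi> h - blinfun_apply \<phi> h') \<le> 2 / real (Suc n)"
    if h: "norm h \<le> 1" "\<forall>x. x \<notin> V n \<longrightarrow> apply_C0 h x = 0" "apply_C0 h k = 1"
      and h': "norm h' \<le> 1" "\<forall>x. x \<notin> V n \<longrightarrow> apply_C0 h' x = 0" "apply_C0 h' k = 1" for h h' n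
  proof -
    have "norm (h - h') \<le> 2" using norm_triangle_ineq4[of h h'] h h' by simp
    then have "norm (blinfun_apply \<phi> ((1/2) *\<^sub>R (h - h'))) \<le> 1 / real (Suc n)"
    proof (intro U(3) allI impI)
      fix x assume "x \<notin> U n"
      then have "x \<notin> V n" by (auto simp: V_def)
      then show "apply_C0 ((1/2) *\<^sub>R (h - h')) x = 0" using h(2) h'(2) by simp
    qed (use h(3) h'(3) in auto)
    then show ?thesis by (simp add: blinfun.scaleR_right blinfun.diff_right)
  qed
  have "\<exists>h :: ('a, 'k) C0. norm h \<le> 1 \<and> (\<forall>x. x \<notin> V n \<longrightarrow> apply_C0 h x = 0) \<and> apply_C0 h k = 1" for n
    by (rule bump_at_point[OF lc V[of n], where 'k='k]) (metis of_real_0 of_real_1)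
  then obtain h :: "nat \<Rightarrow> ('a, 'k) C0" where h: "\<And>n. norm (h n) \<le> 1"
    "\<And>n. \<forall>x. x \<notin> V n \<longrightarrow> apply_C0 (h n) x = 0" "\<And>n. apply_C0 (h n) k = 1"
    by metis
  have V_anti: "V m \<subseteq> V n" if "n \<le> m" for m n unfolding V_def using that by auto
  have hclose: "norm (blinfun_apply \<phi> (h m) - blinfun_apply \<phi> (h n)) \<le> 2 / real (Suc n)" if "n \<le> m" for m n
  proof (rule close)
    show "\<forall>x. x \<notin> V n \<longrightarrow> apply_C0 (h m) x = 0" using h(2)[of m] V_anti[OF that] by blast
  qed (use h in auto)
  have "Cauchy (\<lambda>n. blinfun_apply \<phi> (h n))"
  proof (rule metric_CauchyI)
    fix e :: real assume "e > 0"
    then have "e / 4 > 0" by simp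
    then obtain N where N: "1 / real (Suc N) < e / 4" by (rule nat_approx_posE)
    have near: "dist (blinfun_apply \<phi> (h m)) (blinfun_apply \<phi> (h N)) < e / 2" if "m \<ge> N" for m
      using hclose[OF that] N by (simp add: dist_norm)
    then show "\<exists>M. \<forall>m\<ge>M. \<forall>n\<ge>M. dist (blinfun_apply \<phi> (h m)) (blinfun_apply \<phi> (h n)) < e"
      using dist_triangle_half_l by blast
  qed
  then obtain c where c: "(\<lambda>n. blinfun_apply \<phi> (h n)) \<longlonglongrightarrow> c"
    using Cauchy_convergent convergent_def by blast
  have hc: "norm (c - blinfun_apply \<phi> (h n)) \<le> 2 / real (Suc n)" for n
  proof (rule tendsto_upperbound)
    show "(\<lambda>m. norm (blinfun_apply \<phi> (h m) - blinfun_apply \<phi> (h n))) \<longlonglongrightarrow> norm (c - blinfun_apply \<phi> (h n))"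
      by (intro tendsto_intros c)
    show "\<forall>\<^sub>F m in sequentially. norm (blinfun_apply \<phi> (h m) - blinfun_apply \<phi> (h n)) \<le> 2 / real (Suc n)"
      using hclose by (intro eventually_sequentiallyI[of n])
  qed simp
  have "is_point_mass \<phi> k c"
    unfolding is_point_mass_def
  proof (intro allI impI)
    fix \<epsilon> :: real assume "\<epsilon> > 0"
    then have "\<epsilon> / 4 > 0" by simp
    then obtain n where n: "1 / real (Suc n) < \<epsilon> / 4" by (rule nat_approx_posE)
    have "norm (blinfun_apply \<phi> f - c) \<le> \<epsilon>"
      if "norm f \<le> 1" "\<forall>x. x \<notin> V n \<longrightarrow> apply_C0 f x = 0" "apply_C0 f k = 1" for f
    proof -
      have "norm (blinfun_apply \<phi> f - blinfun_apply \<phi> (h n)) \<le> 2 / real (Suc n)"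
        by (rule close) (use that h in auto)
      then show ?thesis
        using hc[of n] n norm_triangle_ineq4[of "blinfun_apply \<phi> f - blinfun_apply \<phi> (h n)" "c - blinfun_apply \<phi> (h n)"]
        by simp
    qed
    then show "\<exists>U. open U \<and> k \<in> U \<and> (\<forall>h. norm h \<le> 1 \<longrightarrow> (\<forall>x. x \<notin> U \<longrightarrow> apply_C0 h x = 0) \<longrightarrow>
        apply_C0 h k = 1 \<longrightarrow> norm (blinfun_apply \<phi> h - c) \<le> \<epsilon>)"
      using V by blast
  qed
  then show ?thesis by blast
qed

lemma point_mass_eqI:
  fixes \<phi> :: "('a::t2_space, 'k::real_or_complex) C0 \<Rightarrow>\<^sub>L 'k"
  assumes "locally_compact_space (euclidean :: 'a topology)" "is_point_mass \<phi> k c"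
  shows "point_mass \<phi> k = c"
  unfolding point_mass_def using assms is_point_mass_unique by blast

lemma is_point_mass_point_mass:
  fixes \<phi> :: "('a::t2_space, 'k::real_or_complex) C0 \<Rightarrow>\<^sub>L 'k"
  assumes "locally_compact_space (euclidean :: 'a topology)" "\<phi> \<in> dual scaleC0"
  shows "is_point_mass \<phi> k (point_mass \<phi> k)"
  using is_point_mass_exists[OF assms] point_mass_eqI[OF assms(1)] by metis

lemma point_mass_add:
  fixes \<phi> :: "('a::t2_space, 'k::real_or_complex) C0 \<Rightarrow>\<^sub>L 'k"
  assumes lc: "locally_compact_space (euclidean :: 'a topology)" and \<phi>: "\<phi> \<in> dual scaleC0" and \<psi>: "\<psi> \<in> dual scaleC0"
  shows "point_mass (\<phi> + \<psi>) k = point_mass \<phi> k + point_mass \<psi> k"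
proof (rule point_mass_eqI[OF lc], unfold is_point_mass_def, intro allI impI)
  fix \<epsilon> :: real assume "\<epsilon> > 0"
  then have \<epsilon>: "\<epsilon> / 2 > 0" by simp
  obtain U where U: "open U" "k \<in> U" "\<And>h. norm h \<le> 1 \<Longrightarrow> (\<forall>x. x \<notin> U \<longrightarrow> apply_C0 h x = 0) \<Longrightarrow>
      apply_C0 h k = 1 \<Longrightarrow> norm (blinfun_apply \<phi> h - point_mass \<phi> k) \<le> \<epsilon> / 2"
    using is_point_mass_point_mass[OF lc \<phi>] \<epsilon> unfolding is_point_mass_def by blast
  obtain V where V: "open V" "k \<in> V" "\<And>h. norm h \<le> 1 \<Longrightarrow> (\<forall>x. x \<notin> V \<longrightarrow> apply_C0 h x = 0) \<Longrightarrow>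
      apply_C0 h k = 1 \<Longrightarrow> norm (blinfun_apply \<psi> h - point_mass \<psi> k) \<le> \<epsilon> / 2"
    using is_point_mass_point_mass[OF lc \<psi>] \<epsilon> unfolding is_point_mass_def by blast
  have "norm (blinfun_apply (\<phi> + \<psi>) h - (point_mass \<phi> k + point_mass \<psi> k)) \<le> \<epsilon>"
    if h: "norm h \<le> 1" "\<forall>x. x \<notin> U \<inter> V \<longrightarrow> apply_C0 h x = 0" "apply_C0 h k = 1" for h
  proof -
    have "norm (blinfun_apply \<phi> h - point_mass \<phi> k) \<le> \<epsilon> / 2" "norm (blinfun_apply \<psi> h - point_mass \<psi> k) \<le> \<epsilon> / 2"
      using U(3) V(3) h by auto
    then show ?thesis
      using norm_triangle_ineq[of "blinfun_apply \<phi> h - point_mass \<phi> k" "blinfun_apply \<psi> h - point_mass \<psi> k"]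
      by (simp add: blinfun.add_left algebra_simps)
  qed
  then show "\<exists>U. open U \<and> k \<in> U \<and> (\<forall>h. norm h \<le> 1 \<longrightarrow> (\<forall>x. x \<notin> U \<longrightarrow> apply_C0 h x = 0) \<longrightarrow>
      apply_C0 h k = 1 \<longrightarrow> norm (blinfun_apply (\<phi> + \<psi>) h - (point_mass \<phi> k + point_mass \<psi> k)) \<le> \<epsilon>)"
    using U V by (intro exI[of _ "U \<inter> V"]) auto
qed

lemma point_mass_dual_scale:
  fixes \<phi> :: "('a::t2_space, 'k::real_or_complex) C0 \<Rightarrow>\<^sub>L 'k"
  assumes lc: "locally_compact_space (euclidean :: 'a topology)" and \<phi>: "\<phi> \<in> dual scaleC0"
  shows "point_mass (dual_scale a \<phi>) k = a * point_mass \<phi> k"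
proof (rule point_mass_eqI[OF lc], unfold is_point_mass_def, intro allI impI)
  fix \<epsilon> :: real assume \<epsilon>: "\<epsilon> > 0"
  have a1: "norm a + 1 > 0" by (simp add: add_nonneg_pos)
  then have "\<epsilon> / (norm a + 1) > 0" using \<epsilon> by simp
  then obtain U where U: "open U" "k \<in> U" "\<And>h. norm h \<le> 1 \<Longrightarrow> (\<forall>x. x \<notin> U \<longrightarrow> apply_C0 h x = 0) \<Longrightarrow>
      apply_C0 h k = 1 \<Longrightarrow> norm (blinfun_apply \<phi> h - point_mass \<phi> k) \<le> \<epsilon> / (norm a + 1)"
    using is_point_mass_point_mass[OF lc \<phi>] unfolding is_point_mass_def by blast
  have "norm (blinfun_apply (dual_scale a \<phi>) h - a * point_mass \<phi> k) \<le> \<epsilon>"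
    if h: "norm h \<le> 1" "\<forall>x. x \<notin> U \<longrightarrow> apply_C0 h x = 0" "apply_C0 h k = 1" for h
  proof -
    have "norm (blinfun_apply (dual_scale a \<phi>) h - a * point_mass \<phi> k) = norm a * norm (blinfun_apply \<phi> h - point_mass \<phi> k)"
      by (simp add: norm_mult[symmetric] algebra_simps)
    also have "\<dots> \<le> (norm a + 1) * (\<epsilon> / (norm a + 1))"
      by (intro mult_mono U(3)) (use h in auto)
    also have "\<dots> = \<epsilon>" using a1 by simp
    finally show ?thesis .
  qed
  then show "\<exists>U. open U \<and> k \<in> U \<and> (\<forall>h. norm h \<le> 1 \<longrightarrow> (\<forall>x. x \<notin> U \<longrightarrow> apply_C0 h x = 0) \<longrightarrow>
      apply_C0 h k = 1 \<longrightarrow> norm (blinfun_apply (dual_scale a \<phi>) h - a * point_mass \<phi> k) \<le> \<epsilon>)"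
    using U by blast
qed

lemma separate_finite:
  fixes F :: "'a::t2_space set"
  assumes F: "finite F"
  obtains V where "\<And>k. k \<in> F \<Longrightarrow> open (V k)" "\<And>k. k \<in> F \<Longrightarrow> k \<in> V k"
    "\<And>k l. k \<in> F \<Longrightarrow> l \<in> F \<Longrightarrow> k \<noteq> l \<Longrightarrow> V k \<inter> V l = {}"
proof -
  have "\<forall>k l. \<exists>A B. k \<noteq> l \<longrightarrow> open A \<and> open B \<and> (k::'a) \<in> A \<and> l \<in> B \<and> A \<inter> B = {}"
  proof (intro allI)
    fix k l :: 'a
    show "\<exists>A B. k \<noteq> l \<longrightarrow> open A \<and> open B \<and> k \<in> A \<and> l \<in> B \<and> A \<inter> B = {}"
    proof (cases "k = l")
      case False
      then show ?thesis using hausdorff[OF False] by simp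
    qed simp
  qed
  then obtain A B where AB: "\<And>k l::'a. k \<noteq> l \<Longrightarrow> open (A k l) \<and> open (B k l) \<and> k \<in> A k l \<and> l \<in> B k l \<and> A k l \<inter> B k l = {}"
    by (metis (no_types))
  define V where "V k = (\<Inter>l\<in>F-{k}. A k l \<inter> B l k)" for k
  show thesis
  proof (rule that)
    show "open (V k)" for k unfolding V_def using F AB by (intro open_INT) auto
    show "k \<in> V k" for k
      unfolding V_def
    proof (intro INT_I IntI)
      fix l assume "l \<in> F - {k}"
      then show "k \<in> A k l" "k \<in> B l k" using AB[of k l] AB[of l k] by auto
    qed
    fix k l assume kl: "k \<in> F" "l \<in> F" "k \<noteq> l"
    have "V k \<subseteq> A k l \<inter> B l k" "V l \<subseteq> A l k \<inter> B k l"
      unfolding V_def by (rule INT_lower, use kl in simp)+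
    moreover have "A k l \<inter> B k l = {}" using AB[OF kl(3)] by simp
    ultimately show "V k \<inter> V l = {}" by auto
  qed
qed

text \<open>
  Disjoint bumps at the points of a finite set, each supported in a prescribed neighbourhood and so narrow that \<^term>\<open>\<phi>\<close> nearly
  takes the point mass as its value.
\<close>

lemma bumps_at_points:
  fixes \<phi> :: "('a::t2_space, 'k::real_or_complex) C0 \<Rightarrow>\<^sub>L 'k"
  assumes lc: "locally_compact_space (euclidean :: 'a topology)" and \<phi>: "\<phi> \<in> dual scaleC0"
    and F: "finite F" and W: "\<And>k. k \<in> F \<Longrightarrow> open (W k)" "\<And>k. k \<in> F \<Longrightarrow> k \<in> W k" and \<epsilon>: "\<epsilon> > 0"
  obtains h :: "'a \<Rightarrow> ('a, 'k) C0" and g :: "'a \<Rightarrow> 'a \<Rightarrow> real"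
    where "\<And>k x. k \<in> F \<Longrightarrow> apply_C0 (h k) x = of_real (g k x)" "\<And>k x. k \<in> F \<Longrightarrow> 0 \<le> g k x"
      "\<And>k x. k \<in> F \<Longrightarrow> g k x \<le> 1" "\<And>k. k \<in> F \<Longrightarrow> g k k = 1"
      "\<And>k x. k \<in> F \<Longrightarrow> x \<notin> W k \<Longrightarrow> g k x = 0" "\<And>k. k \<in> F \<Longrightarrow> norm (h k) \<le> 1"
      "\<And>k l x. k \<in> F \<Longrightarrow> l \<in> F \<Longrightarrow> k \<noteq> l \<Longrightarrow> g k x = 0 \<or> g l x = 0"
      "\<And>k. k \<in> F \<Longrightarrow> norm (blinfun_apply \<phi> (h k) - point_mass \<phi> k) \<le> \<epsilon>"
proof -
  obtain V where V: "\<And>k. k \<in> F \<Longrightarrow> open (V k)" "\<And>k. k \<in> F \<Longrightarrow> k \<in> V k"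
    "\<And>k l. k \<in> F \<Longrightarrow> l \<in> F \<Longrightarrow> k \<noteq> l \<Longrightarrow> V k \<inter> V l = {}"
    by (rule separate_finite[OF F]) blast
  have "\<exists>h :: ('a, 'k) C0. \<exists>g. (\<forall>x. apply_C0 h x = of_real (g x) \<and> 0 \<le> g x \<and> g x \<le> 1) \<and> g k = 1 \<and>
      (\<forall>x. x \<notin> V k \<inter> W k \<longrightarrow> g x = 0) \<and> norm h \<le> 1 \<and> norm (blinfun_apply \<phi> h - point_mass \<phi> k) \<le> \<epsilon>"
    if k: "k \<in> F" for k
  proof -
    obtain U where U: "open U" "k \<in> U" "\<And>h. norm h \<le> 1 \<Longrightarrow> (\<forall>x. x \<notin> U \<longrightarrow> apply_C0 h x = 0) \<Longrightarrow>
        apply_C0 h k = 1 \<Longrightarrow> norm (blinfun_apply \<phi> h - point_mass \<phi> k) \<le> \<epsilon>"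
      using is_point_mass_point_mass[OF lc \<phi>] \<epsilon> unfolding is_point_mass_def by blast
    have "open (U \<inter> (V k \<inter> W k))" "k \<in> U \<inter> (V k \<inter> W k)"
      using U(2) V(2)[OF k] W(2)[OF k] by (auto intro!: open_Int U(1) V(1)[OF k] W(1)[OF k])
    from bump_at_point[OF lc this, where 'k='k] obtain h :: "('a, 'k) C0" and g where h: "\<And>x. apply_C0 h x = of_real (g x)"
      "\<And>x. 0 \<le> g x" "\<And>x. g x \<le> 1" "g k = 1" "\<And>x. x \<notin> U \<inter> (V k \<inter> W k) \<Longrightarrow> g x = 0" "norm h \<le> 1"
      by blast
    have "norm (blinfun_apply \<phi> h - point_mass \<phi> k) \<le> \<epsilon>"
      by (rule U(3)) (use h in auto)
    with h show ?thesis by (intro exI[of _ h] exI[of _ g]) auto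
  qed
  then have "\<exists>h :: 'a \<Rightarrow> ('a, 'k) C0. \<forall>k\<in>F. \<exists>g. (\<forall>x. apply_C0 (h k) x = of_real (g x) \<and> 0 \<le> g x \<and> g x \<le> 1) \<and> g k = 1 \<and>
      (\<forall>x. x \<notin> V k \<inter> W k \<longrightarrow> g x = 0) \<and> norm (h k) \<le> 1 \<and> norm (blinfun_apply \<phi> (h k) - point_mass \<phi> k) \<le> \<epsilon>"
    by (intro bchoice) blast
  then obtain h :: "'a \<Rightarrow> ('a, 'k) C0" where h: "\<forall>k\<in>F. \<exists>g. (\<forall>x. apply_C0 (h k) x = of_real (g x) \<and> 0 \<le> g x \<and> g x \<le> 1) \<and> g k = 1 \<and>
      (\<forall>x. x \<notin> V k \<inter> W k \<longrightarrow> g x = 0) \<and> norm (h k) \<le> 1 \<and> norm (blinfun_apply \<phi> (h k) - point_mass \<phi> k) \<le> \<epsilon>" ..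
  from bchoice[OF this] obtain g where g: "\<And>k. k \<in> F \<Longrightarrow> (\<forall>x. apply_C0 (h k) x = of_real (g k x) \<and> 0 \<le> g k x \<and> g k x \<le> 1) \<and> g k k = 1 \<and>
      (\<forall>x. x \<notin> V k \<inter> W k \<longrightarrow> g k x = 0) \<and> norm (h k) \<le> 1 \<and> norm (blinfun_apply \<phi> (h k) - point_mass \<phi> k) \<le> \<epsilon>"
    by blast
  show thesis
  proof (rule that[of h g])
    fix k l x assume "k \<in> F" "l \<in> F" "k \<noteq> l"
    then show "g k x = 0 \<or> g l x = 0" using V(3)[of k l] g[of k] g[of l] by blast
  qed (use g in auto)
qed

lemma point_masses_attained:
  fixes \<phi> :: "('a::t2_space, 'k::real_or_complex) C0 \<Rightarrow>\<^sub>L 'k"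
  assumes lc: "locally_compact_space (euclidean :: 'a topology)" and \<phi>: "\<phi> \<in> dual scaleC0"
    and G: "finite G" "open W" "G \<subseteq> W" and \<epsilon>: "\<epsilon> > 0"
  obtains f where "norm f \<le> 1" "\<And>x. x \<notin> W \<Longrightarrow> apply_C0 f x = 0"
    "norm (blinfun_apply \<phi> f - of_real (\<Sum>k\<in>G. norm (point_mass \<phi> k))) \<le> \<epsilon>"
proof -
  have \<epsilon>': "\<epsilon> / (card G + 1) > 0" using \<epsilon> by simp
  obtain h :: "'a \<Rightarrow> ('a, 'k) C0" and g :: "'a \<Rightarrow> 'a \<Rightarrow> real"
    where h: "\<And>k x. k \<in> G \<Longrightarrow> apply_C0 (h k) x = of_real (g k x)"
      "\<And>k x. k \<in> G \<Longrightarrow> x \<notin> W \<Longrightarrow> g k x = 0" "\<And>k. k \<in> G \<Longrightarrow> norm (h k) \<le> 1"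
      "\<And>k l x. k \<in> G \<Longrightarrow> l \<in> G \<Longrightarrow> k \<noteq> l \<Longrightarrow> g k x = 0 \<or> g l x = 0"
      "\<And>k. k \<in> G \<Longrightarrow> norm (blinfun_apply \<phi> (h k) - point_mass \<phi> k) \<le> \<epsilon> / (card G + 1)"
  proof (rule bumps_at_points[OF lc \<phi> G(1), of "\<lambda>_. W"])
    show "open W" by fact
    show "k \<in> W" if "k \<in> G" for k using that G by blast
    show "\<epsilon> / (card G + 1) > 0" by fact
  qed blast
  define a where "a k = unit_conj (point_mass \<phi> k)" for k
  define f where "f = (\<Sum>k\<in>G. scaleC0 (a k) (h k))"
  show thesis
  proof (rule that)
    show "norm f \<le> 1"
      unfolding f_def
    proof (rule norm_disjoint_sum[OF G(1)])
      fix i j x assume "i \<in> G" "j \<in> G" "i \<noteq> j"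
      then show "apply_C0 (h i) x = 0 \<or> apply_C0 (h j) x = 0" using h(4)[of i j x] h(1) by auto
    qed (use h(3) in \<open>auto simp: a_def\<close>)
    show "apply_C0 f x = 0" if "x \<notin> W" for x
      unfolding f_def using h(1,2) that by simp
    have "blinfun_apply \<phi> f - of_real (\<Sum>k\<in>G. norm (point_mass \<phi> k)) =
        (\<Sum>k\<in>G. a k * (blinfun_apply \<phi> (h k) - point_mass \<phi> k))"
      by (simp add: f_def blinfun.sum_right dual_applyD[OF \<phi>] sum_subtractf[symmetric] right_diff_distrib a_def)
    also have "norm \<dots> \<le> (\<Sum>k\<in>G. \<epsilon> / (card G + 1))"
      by (rule sum_norm_le) (use h(5) in \<open>simp add: norm_mult a_def\<close>)
    also have "\<dots> \<le> \<epsilon>" using \<epsilon> by (simp add: field_simps)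
    finally show "norm (blinfun_apply \<phi> f - of_real (\<Sum>k\<in>G. norm (point_mass \<phi> k))) \<le> \<epsilon>" .
  qed
qed

lemma sum_point_mass_le:
  fixes \<phi> :: "('a::t2_space, 'k::real_or_complex) C0 \<Rightarrow>\<^sub>L 'k"
  assumes lc: "locally_compact_space (euclidean :: 'a topology)" and \<phi>: "\<phi> \<in> dual scaleC0" and G: "finite G"
  shows "(\<Sum>k\<in>G. norm (point_mass \<phi> k)) \<le> norm \<phi>"
proof (rule field_le_epsilon)
  fix \<epsilon> :: real assume \<epsilon>: "\<epsilon> > 0"
  let ?S = "\<Sum>k\<in>G. norm (point_mass \<phi> k)"
  obtain f where f: "norm f \<le> 1" "norm (blinfun_apply \<phi> f - of_real ?S) \<le> \<epsilon>"
    by (rule point_masses_attained[OF lc \<phi> G _ _ \<epsilon>, of UNIV]) auto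
  have "?S = norm (of_real ?S :: 'k)" unfolding norm_of_real by (simp add: sum_nonneg)
  also have "\<dots> \<le> norm (blinfun_apply \<phi> f) + \<epsilon>"
    using f(2) norm_triangle_ineq3[of "blinfun_apply \<phi> f" "of_real ?S"] by linarith
  also have "norm (blinfun_apply \<phi> f) \<le> norm \<phi> * 1"
    by (rule order_trans[OF norm_blinfun]) (intro mult_left_mono f norm_ge_zero)
  finally show "?S \<le> norm \<phi> + \<epsilon>" by simp
qed

text \<open>
  Removing the point masses on \<^term>\<open>F\<close> leaves a functional whose norm is that of the restriction of \<^term>\<open>\<phi>\<close> to the functions
  vanishing on \<^term>\<open>F\<close>. There is no loss of a factor: for narrow bumps \<open>h\<^sub>k\<close> the function \<open>f - \<Sum> f(k) h\<^sub>k\<close> vanishes on \<^term>\<open>F\<close>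
  and its norm is hardly larger than one.
\<close>

lemma remove_point_masses:
  fixes \<phi> :: "('a::t2_space, 'k::real_or_complex) C0 \<Rightarrow>\<^sub>L 'k"
  assumes lc: "locally_compact_space (euclidean :: 'a topology)" and \<phi>: "\<phi> \<in> dual scaleC0" and F: "finite F"
    and B: "\<And>g. norm g \<le> 1 \<Longrightarrow> (\<forall>x\<in>F. apply_C0 g x = 0) \<Longrightarrow> norm (blinfun_apply \<phi> g) \<le> B"
    and f: "norm f \<le> 1"
  shows "norm (blinfun_apply \<phi> f - (\<Sum>k\<in>F. point_mass \<phi> k * apply_C0 f k)) \<le> B"
proof -
  have B0: "B \<ge> 0" using B[of 0] by (simp add: blinfun.zero_right)
  have fx: "norm (apply_C0 f x) \<le> 1" for x using norm_apply_C0_le[of f x] f by linarith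
  let ?r = "norm (blinfun_apply \<phi> f - (\<Sum>k\<in>F. point_mass \<phi> k * apply_C0 f k))"
  have main: "?r \<le> B + \<epsilon> * (B + card F)" if \<epsilon>: "\<epsilon> > 0" for \<epsilon>
  proof -
    define W where "W k = {x. norm (apply_C0 f x - apply_C0 f k) < \<epsilon>}" for k
    obtain h :: "'a \<Rightarrow> ('a, 'k) C0" and g :: "'a \<Rightarrow> 'a \<Rightarrow> real"
      where h: "\<And>k x. k \<in> F \<Longrightarrow> apply_C0 (h k) x = of_real (g k x)" "\<And>k x. k \<in> F \<Longrightarrow> 0 \<le> g k x"
        "\<And>k x. k \<in> F \<Longrightarrow> g k x \<le> 1" "\<And>k. k \<in> F \<Longrightarrow> g k k = 1"
        "\<And>k x. k \<in> F \<Longrightarrow> x \<notin> W k \<Longrightarrow> g k x = 0" "\<And>k. k \<in> F \<Longrightarrow> norm (h k) \<le> 1"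
        "\<And>k l x. k \<in> F \<Longrightarrow> l \<in> F \<Longrightarrow> k \<noteq> l \<Longrightarrow> g k x = 0 \<or> g l x = 0"
        "\<And>k. k \<in> F \<Longrightarrow> norm (blinfun_apply \<phi> (h k) - point_mass \<phi> k) \<le> \<epsilon>"
    proof (rule bumps_at_points[OF lc \<phi> F, of W])
      show "open (W k)" for k
        unfolding W_def by (intro open_Collect_less continuous_intros continuous_on_C0)
      show "k \<in> W k" for k unfolding W_def using \<epsilon> by simp
      show "\<epsilon> > 0" by fact
    qed blast
    define e where "e = f - (\<Sum>k\<in>F. scaleC0 (apply_C0 f k) (h k))"
    have e_apply: "apply_C0 e x = apply_C0 f x - (\<Sum>k\<in>F. apply_C0 f k * apply_C0 (h k) x)" for x
      by (simp add: e_def)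
    have cases: "(\<Sum>k\<in>F. apply_C0 f k * apply_C0 (h k) x) = 0 \<or>
        (\<exists>k\<in>F. (\<Sum>k\<in>F. apply_C0 f k * apply_C0 (h k) x) = apply_C0 f k * apply_C0 (h k) x)" for x
    proof (rule apply_disjoint_sum[OF F, of h x "apply_C0 f"])
      show "\<forall>i\<in>F. \<forall>j\<in>F. i \<noteq> j \<longrightarrow> apply_C0 (h i) x = 0 \<or> apply_C0 (h j) x = 0"
        using h(1,7) by (metis of_real_0)
    qed auto
    have norm_e: "norm e \<le> 1 + \<epsilon>"
    proof (rule norm_C0_le)
      fix x
      show "norm (apply_C0 e x) \<le> 1 + \<epsilon>"
        using cases[of x]
      proof
        assume "(\<Sum>k\<in>F. apply_C0 f k * apply_C0 (h k) x) = 0"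
        then show ?thesis using fx[of x] \<epsilon> by (simp add: e_apply)
      next
        assume "\<exists>k\<in>F. (\<Sum>k\<in>F. apply_C0 f k * apply_C0 (h k) x) = apply_C0 f k * apply_C0 (h k) x"
        then obtain k where k: "k \<in> F" "apply_C0 e x = apply_C0 f x - apply_C0 f k * of_real (g k x)"
          using h(1) by (auto simp: e_apply)
        show ?thesis
        proof (cases "x \<in> W k")
          case True
          have "apply_C0 e x = (apply_C0 f x - apply_C0 f k) + apply_C0 f k * of_real (1 - g k x)"
            by (simp add: k(2) algebra_simps)
          also have "norm \<dots> \<le> norm (apply_C0 f x - apply_C0 f k) + norm (apply_C0 f k * of_real (1 - g k x))"
            by (rule norm_triangle_ineq)
          also have "norm (apply_C0 f k * of_real (1 - g k x)) \<le> 1"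
            unfolding norm_mult norm_of_real using fx[of k] h(2,3)[OF k(1), of x] by (intro mult_le_one) auto
          finally show ?thesis using True by (simp add: W_def)
        next
          case False
          then show ?thesis using h(5)[OF k(1)] fx[of x] \<epsilon> by (simp add: k(2))
        qed
      qed
    qed
    have e0: "apply_C0 e l = 0" if l: "l \<in> F" for l
    proof -
      have "(\<Sum>k\<in>F. apply_C0 f k * apply_C0 (h k) l) = apply_C0 f l * apply_C0 (h l) l + (\<Sum>k\<in>F-{l}. apply_C0 f k * apply_C0 (h k) l)"
        by (rule sum.remove[OF F l])
      also have "(\<Sum>k\<in>F-{l}. apply_C0 f k * apply_C0 (h k) l) = 0"
      proof (intro sum.neutral ballI)
        fix k assume "k \<in> F - {l}"
        then show "apply_C0 f k * apply_C0 (h k) l = 0" using h(7)[of k l l] h(4)[OF l] h(1)[of k l] l by auto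
      qed
      finally show ?thesis using h(1,4) l by (simp add: e_apply)
    qed
    have "norm (blinfun_apply \<phi> ((1 / (1 + \<epsilon>)) *\<^sub>R e)) \<le> B"
      by (rule B) (use norm_e \<epsilon> e0 in \<open>auto simp: divide_le_eq\<close>)
    then have \<phi>e: "norm (blinfun_apply \<phi> e) \<le> B * (1 + \<epsilon>)"
      using \<epsilon> by (simp add: blinfun.scaleR_right divide_le_eq)
    have "blinfun_apply \<phi> f - (\<Sum>k\<in>F. point_mass \<phi> k * apply_C0 f k) =
        blinfun_apply \<phi> e + (\<Sum>k\<in>F. apply_C0 f k * (blinfun_apply \<phi> (h k) - point_mass \<phi> k))"
      by (simp add: e_def blinfun.diff_right blinfun.sum_right dual_applyD[OF \<phi>] right_diff_distrib sum_subtractf mult.commute)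
    then have "?r \<le> norm (blinfun_apply \<phi> e) + norm (\<Sum>k\<in>F. apply_C0 f k * (blinfun_apply \<phi> (h k) - point_mass \<phi> k))"
      by (simp only: norm_triangle_ineq)
    also have "norm (\<Sum>k\<in>F. apply_C0 f k * (blinfun_apply \<phi> (h k) - point_mass \<phi> k)) \<le> (\<Sum>k\<in>F. 1 * \<epsilon>)"
    proof (rule sum_norm_le)
      fix k assume "k \<in> F"
      then show "norm (apply_C0 f k * (blinfun_apply \<phi> (h k) - point_mass \<phi> k)) \<le> 1 * \<epsilon>"
        unfolding norm_mult using fx h(8) by (intro mult_mono) auto
    qed
    finally show ?thesis using \<phi>e by (simp add: algebra_simps)
  qed
  show ?thesis
  proof (rule field_le_epsilon)
    fix e :: real assume e: "e > 0"
    have pos: "B + card F + 1 > 0" using B0 by (simp add: add_nonneg_pos)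
    define \<epsilon> where "\<epsilon> = e / (B + card F + 1)"
    have \<epsilon>: "\<epsilon> > 0" using e pos by (simp add: \<epsilon>_def)
    have "\<epsilon> * (B + card F) \<le> \<epsilon> * (B + card F + 1)" using \<epsilon> by (intro mult_left_mono) auto
    also have "\<dots> = e" using pos by (simp add: \<epsilon>_def)
    finally show "?r \<le> B + e" using main[OF \<epsilon>] by linarith
  qed
qed

text \<open>
  The distance from \<^term>\<open>\<phi>\<close> to its point masses on \<^term>\<open>F\<close> is at most the total mass of the points outside \<^term>\<open>F\<close>: over a
  scattered space functionals are determined by their point masses, and the norm is the sum of their moduli.
\<close>

theorem dual_approx_point_masses:
  fixes \<phi> :: "('a::t2_space, 'k::real_or_complex) C0 \<Rightarrow>\<^sub>L 'k"
  assumes lc: "locally_compact_space (euclidean :: 'a topology)"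
    and sc: "scattered (UNIV :: 'a set)" and \<phi>: "\<phi> \<in> dual scaleC0" and F: "finite F"
    and c: "\<And>G. finite G \<Longrightarrow> G \<inter> F = {} \<Longrightarrow> (\<Sum>k\<in>G. norm (point_mass \<phi> k)) \<le> c"
    and f: "norm f \<le> 1"
  shows "norm (blinfun_apply \<phi> f - (\<Sum>k\<in>F. point_mass \<phi> k * apply_C0 f k)) \<le> c"
proof (rule field_le_epsilon)
  fix \<epsilon> :: real assume \<epsilon>: "\<epsilon> > 0"
  obtain F0 where F0: "finite F0" "\<And>g. norm g \<le> 1 \<Longrightarrow> (\<forall>x\<in>F0. apply_C0 g x = 0) \<Longrightarrow> norm (blinfun_apply \<phi> g) \<le> \<epsilon>"
    using scattered_imp_atomic[OF lc sc \<phi>] \<epsilon> unfolding atomic_on_def by auto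
  let ?G = "F0 - F"
  have fx: "norm (apply_C0 f x) \<le> 1" for x using norm_apply_C0_le[of f x] f by linarith
  have "norm (blinfun_apply \<phi> f - (\<Sum>k\<in>F \<union> ?G. point_mass \<phi> k * apply_C0 f k)) \<le> \<epsilon>"
    by (rule remove_point_masses[OF lc \<phi> _ _ f]) (use F F0 in auto)
  moreover have "(\<Sum>k\<in>F \<union> ?G. point_mass \<phi> k * apply_C0 f k) =
      (\<Sum>k\<in>F. point_mass \<phi> k * apply_C0 f k) + (\<Sum>k\<in>?G. point_mass \<phi> k * apply_C0 f k)"
    by (rule sum.union_disjoint) (use F F0 in auto)
  moreover have "norm (\<Sum>k\<in>?G. point_mass \<phi> k * apply_C0 f k) \<le> c"
  proof -
    have "norm (\<Sum>k\<in>?G. point_mass \<phi> k * apply_C0 f k) \<le> (\<Sum>k\<in>?G. norm (point_mass \<phi> k))"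
      by (rule sum_norm_le) (simp add: norm_mult mult_left_le fx)
    also have "\<dots> \<le> c" by (rule c) (use F0 in auto)
    finally show ?thesis .
  qed
  ultimately show "norm (blinfun_apply \<phi> f - (\<Sum>k\<in>F. point_mass \<phi> k * apply_C0 f k)) \<le> c + \<epsilon>"
    using norm_triangle_ineq[of "blinfun_apply \<phi> f - (\<Sum>k\<in>F \<union> ?G. point_mass \<phi> k * apply_C0 f k)" "\<Sum>k\<in>?G. point_mass \<phi> k * apply_C0 f k"]
    by (simp add: algebra_simps)
qed

section \<open>Selection of subsequences\<close>

text \<open>
  Rosenthal's lemma: if the sums of finitely many entries of a row are bounded, uniformly in the rows, then a subsequence
  of the indices makes all such sums of off-diagonal entries small. The proof splits the indices into infinitely many infinite classes.
  If no class is suitable, each class contains an index whose row has sum above \<open>\<epsilon>\<close> within the class; on the set of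
  these indices the row sums are smaller by \<open>\<epsilon>\<close>, and after finitely many such steps nothing is left.
\<close>

lemma rosenthal_selection_aux:
  fixes a :: "nat \<Rightarrow> nat \<Rightarrow> real"
  assumes \<epsilon>: "\<epsilon> > 0" and I: "infinite I"
    and bound: "\<And>i J. i \<in> I \<Longrightarrow> finite J \<Longrightarrow> J \<subseteq> I \<Longrightarrow> (\<Sum>j\<in>J. a i j) \<le> real n * \<epsilon>"
  shows "\<exists>I'\<subseteq>I. infinite I' \<and> (\<forall>i\<in>I'. \<forall>J. finite J \<longrightarrow> J \<subseteq> I' - {i} \<longrightarrow> (\<Sum>j\<in>J. a i j) \<le> \<epsilon>)"
  using I bound
proof (induction n arbitrary: I)
  case 0
  have "(\<Sum>j\<in>J. a i j) \<le> \<epsilon>" if "i \<in> I" "finite J" "J \<subseteq> I - {i}" for i J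
  proof -
    have "J \<subseteq> I" using that(3) by blast
    then show ?thesis using 0(2)[OF that(1,2)] \<epsilon> by simp
  qed
  with 0(1) show ?case by blast
next
  case (Suc n)
  obtain e :: "nat \<Rightarrow> nat" where e: "strict_mono e" "\<And>n. e n \<in> I"
    using infinite_enumerate[OF Suc.prems(1)] by blast
  have inj: "e x = e y \<longleftrightarrow> x = y" for x y using e(1) by (simp add: strict_mono_eq)
  define P where "P p = range (\<lambda>q. e (prod_encode (p, q)))" for p
  have PI: "P p \<subseteq> I" for p using e(2) by (auto simp: P_def)
  have P_inf: "infinite (P p)" for p
    unfolding P_def by (rule range_inj_infinite) (simp add: inj_on_def inj)
  have P_disj: "p = p'" if "x \<in> P p" "x \<in> P p'" for p p' x
    using that by (auto simp: P_def inj)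
  show ?case
  proof (cases "\<exists>p. \<forall>i\<in>P p. \<forall>J. finite J \<longrightarrow> J \<subseteq> P p - {i} \<longrightarrow> (\<Sum>j\<in>J. a i j) \<le> \<epsilon>")
    case True
    then obtain p where "\<forall>i\<in>P p. \<forall>J. finite J \<longrightarrow> J \<subseteq> P p - {i} \<longrightarrow> (\<Sum>j\<in>J. a i j) \<le> \<epsilon>" ..
    with PI[of p] P_inf[of p] show ?thesis by (intro exI[of _ "P p"]) simp
  next
    case False
    then have "\<forall>p. \<exists>i J. i \<in> P p \<and> finite J \<and> J \<subseteq> P p - {i} \<and> \<epsilon> < (\<Sum>j\<in>J. a i j)"
    proof (intro allI)
      fix p
      from False have "\<not> (\<forall>i\<in>P p. \<forall>J. finite J \<longrightarrow> J \<subseteq> P p - {i} \<longrightarrow> (\<Sum>j\<in>J. a i j) \<le> \<epsilon>)" by simp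
      then show "\<exists>i J. i \<in> P p \<and> finite J \<and> J \<subseteq> P p - {i} \<and> \<epsilon> < (\<Sum>j\<in>J. a i j)"
        by (simp add: not_le) blast
    qed
    then obtain i J where iJ: "\<And>p. i p \<in> P p" "\<And>p. finite (J p)" "\<And>p. J p \<subseteq> P p - {i p}"
      "\<And>p. \<epsilon> < (\<Sum>j\<in>J p. a (i p) j)"
      by metis
    have "inj i"
    proof (rule injI)
      fix p q assume "i p = i q"
      then have "i p \<in> P q" using iJ(1)[of q] by simp
      then show "p = q" by (rule P_disj[OF iJ(1)])
    qed
    then have inf: "infinite (range i)" by (rule range_inj_infinite)
    have sub: "range i \<subseteq> I" using iJ(1) PI by blast
    have "(\<Sum>j\<in>L. a k j) \<le> real n * \<epsilon>" if k: "k \<in> range i" and L: "finite L" "L \<subseteq> range i" for k L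
    proof -
      obtain p where p: "k = i p" using k by blast
      have "L \<inter> J p = {}"
      proof -
        have False if "x \<in> L" "x \<in> J p" for x
        proof -
          obtain p' where p': "x = i p'" using L(2) \<open>x \<in> L\<close> by blast
          have x: "x \<in> P p" "x \<noteq> i p" using iJ(3)[of p] \<open>x \<in> J p\<close> by auto
          then have "p' = p" using P_disj iJ(1)[of p'] p' by blast
          with x(2) p' show False by simp
        qed
        then show ?thesis by blast
      qed
      then have "(\<Sum>j\<in>L \<union> J p. a k j) = (\<Sum>j\<in>L. a k j) + (\<Sum>j\<in>J p. a k j)"
        using L(1) iJ(2) by (simp add: sum.union_disjoint)
      moreover have "(\<Sum>j\<in>L \<union> J p. a k j) \<le> real (Suc n) * \<epsilon>"
      proof (rule Suc.prems(2))
        show "k \<in> I" using k sub by blast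
        show "finite (L \<union> J p)" using L(1) iJ(2) by simp
        show "L \<union> J p \<subseteq> I" using L(2) sub iJ(3)[of p] PI[of p] by blast
      qed
      ultimately show ?thesis using iJ(4)[of p] by (simp add: p algebra_simps)
    qed
    then have "\<exists>I'\<subseteq>range i. infinite I' \<and>
        (\<forall>i\<in>I'. \<forall>J. finite J \<longrightarrow> J \<subseteq> I' - {i} \<longrightarrow> (\<Sum>j\<in>J. a i j) \<le> \<epsilon>)"
      by (rule Suc.IH[OF inf])
    then obtain I' where "I' \<subseteq> range i"
      and I': "infinite I' \<and> (\<forall>i\<in>I'. \<forall>J. finite J \<longrightarrow> J \<subseteq> I' - {i} \<longrightarrow> (\<Sum>j\<in>J. a i j) \<le> \<epsilon>)"
      by (elim exE conjE) (rule that, assumption, rule conjI)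
    from this(1) sub have "I' \<subseteq> I" by (rule order_trans)
    with I' show ?thesis by (intro exI[of _ I'] conjI) simp_all
  qed
qed

lemma rosenthal_selection:
  fixes a :: "nat \<Rightarrow> nat \<Rightarrow> real"
  assumes bound: "\<And>i J. finite J \<Longrightarrow> (\<Sum>j\<in>J. a i j) \<le> M" and \<epsilon>: "\<epsilon> > 0"
  obtains r :: "nat \<Rightarrow> nat" where "strict_mono r"
    "\<And>i J. finite J \<Longrightarrow> i \<notin> J \<Longrightarrow> (\<Sum>j\<in>J. a (r i) (r j)) \<le> \<epsilon>"
proof -
  obtain n :: nat where n: "M / \<epsilon> \<le> real n" using real_arch_simple by blast
  have "M \<le> real n * \<epsilon>" using n \<epsilon> by (simp add: divide_le_eq)
  then have "\<exists>I'\<subseteq>UNIV. infinite I' \<and> (\<forall>i\<in>I'. \<forall>J. finite J \<longrightarrow> J \<subseteq> I' - {i} \<longrightarrow> (\<Sum>j\<in>J. a i j) \<le> \<epsilon>)"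
    by (intro rosenthal_selection_aux[OF \<epsilon>, of UNIV a n]) (auto intro: order_trans[OF bound])
  then obtain I where "infinite I"
    and I': "\<forall>i\<in>I. \<forall>J. finite J \<longrightarrow> J \<subseteq> I - {i} \<longrightarrow> (\<Sum>j\<in>J. a i j) \<le> \<epsilon>"
    by (elim exE conjE) (rule that)
  then have I: "infinite I" "\<And>i J. i \<in> I \<Longrightarrow> finite J \<Longrightarrow> J \<subseteq> I - {i} \<Longrightarrow> (\<Sum>j\<in>J. a i j) \<le> \<epsilon>"
    by simp_all
  obtain r :: "nat \<Rightarrow> nat" where r: "strict_mono r" "\<And>n. r n \<in> I"
    using infinite_enumerate[OF I(1)] by blast
  have inj: "inj r" by (rule strict_mono_imp_inj_on[OF r(1)])
  show thesis
  proof (rule that[OF r(1)])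
    fix i and J :: "nat set" assume J: "finite J" "i \<notin> J"
    have "(\<Sum>j\<in>J. a (r i) (r j)) = (\<Sum>j\<in>r ` J. a (r i) j)"
      by (subst sum.reindex) (auto intro: inj_on_subset[OF inj])
    also have "\<dots> \<le> \<epsilon>"
      by (rule I(2)) (use J r(2) inj in \<open>auto simp: inj_eq\<close>)
    finally show "(\<Sum>j\<in>J. a (r i) (r j)) \<le> \<epsilon>" .
  qed
qed

text \<open>
  Take disjoint neighbourhoods \<open>U\<^sub>1, \<dots>, U\<^sub>N\<close> of \<^term>\<open>N\<close> of the sets \<^term>\<open>G i\<close>. Each further \<^term>\<open>G i\<close> has mass at most
  \<open>M / N\<close> in one of them, and infinitely many in the same one, which may therefore be removed.
\<close>

lemma separation_step:
  fixes G :: "nat \<Rightarrow> 'a::t2_space set" and m :: "nat \<Rightarrow> 'a \<Rightarrow> real"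
  assumes G: "\<And>i. finite (G i)" "\<And>i j. i \<noteq> j \<Longrightarrow> G i \<inter> G j = {}"
    and m: "\<And>i k. 0 \<le> m i k" "\<And>i. (\<Sum>k\<in>G i. m i k) \<le> M"
    and I: "infinite I" and big: "\<And>i. i \<in> I \<Longrightarrow> c < (\<Sum>k\<in>G i - W. m i k)" and \<delta>: "\<delta> > 0"
  shows "\<exists>i\<in>I. \<exists>U I'. open U \<and> G i \<subseteq> U \<and> I' \<subseteq> I \<and> infinite I' \<and>
    (\<forall>i'\<in>I'. i < i' \<and> c - \<delta> < (\<Sum>k\<in>G i' - (W \<union> U). m i' k))"
proof -
  obtain N :: nat where N: "M / \<delta> < real N" using reals_Archimedean2 by blast
  have N': "M < real N * \<delta>" using N \<delta> by (simp add: divide_less_eq)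
  obtain e :: "nat \<Rightarrow> nat" where e: "strict_mono e" "\<And>n. e n \<in> I"
    using infinite_enumerate[OF I] by blast
  have "finite (\<Union>t<N. G (e t))" using G(1) by simp
  then obtain V where V: "\<And>k. k \<in> (\<Union>t<N. G (e t)) \<Longrightarrow> open (V k)" "\<And>k. k \<in> (\<Union>t<N. G (e t)) \<Longrightarrow> k \<in> V k"
    "\<And>k l. k \<in> (\<Union>t<N. G (e t)) \<Longrightarrow> l \<in> (\<Union>t<N. G (e t)) \<Longrightarrow> k \<noteq> l \<Longrightarrow> V k \<inter> V l = {}"
    by (rule separate_finite) (rule that)
  define U where "U t = (\<Union>k\<in>G (e t). V k)" for t
  have U: "open (U t)" "G (e t) \<subseteq> U t" if "t < N" for t
    unfolding U_def using V(1,2) that by (intro open_UN, auto)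
  have U_disj: "U s \<inter> U t = {}" if st: "s < N" "t < N" "s \<noteq> t" for s t
  proof -
    have "G (e s) \<inter> G (e t) = {}" using G(2)[of "e s" "e t"] st(3) e(1) by (simp add: strict_mono_eq)
    then have "V k \<inter> V l = {}" if "k \<in> G (e s)" "l \<in> G (e t)" for k l
      using V(3)[of k l] that st by blast
    then show ?thesis unfolding U_def by blast
  qed
  define A where "A t = {i\<in>I. e N < i \<and> (\<Sum>k\<in>G i \<inter> U t. m i k) < \<delta>}" for t
  have "{i\<in>I. e N < i} \<subseteq> (\<Union>t<N. A t)"
  proof
    fix i assume i: "i \<in> {i\<in>I. e N < i}"
    have "\<exists>t<N. (\<Sum>k\<in>G i \<inter> U t. m i k) < \<delta>"
    proof (rule ccontr)
      assume "\<not> ?thesis"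
      then have "(\<Sum>t<N. \<delta>) \<le> (\<Sum>t<N. \<Sum>k\<in>G i \<inter> U t. m i k)"
      proof (intro sum_mono)
        fix t assume "t \<in> {..<N}"
        with \<open>\<not> (\<exists>t<N. (\<Sum>k\<in>G i \<inter> U t. m i k) < \<delta>)\<close>
        show "\<delta> \<le> (\<Sum>k\<in>G i \<inter> U t. m i k)" by (meson lessThan_iff not_less)
      qed
      also have "\<dots> = (\<Sum>k\<in>(\<Union>t<N. G i \<inter> U t). m i k)"
        by (rule sum.UNION_disjoint[symmetric]) (use G(1) U_disj in auto)
      also have "\<dots> \<le> (\<Sum>k\<in>G i. m i k)"
        by (rule sum_mono2) (use G(1) m(1) in auto)
      finally show False using m(2)[of i] N' by simp
    qed
    then show "i \<in> (\<Union>t<N. A t)" using i by (auto simp: A_def)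
  qed
  moreover have "infinite {i\<in>I. e N < i}"
  proof
    assume "finite {i\<in>I. e N < i}"
    then have "finite ({i\<in>I. e N < i} \<union> {..e N})" by simp
    moreover have "I \<subseteq> {i\<in>I. e N < i} \<union> {..e N}" by auto
    ultimately show False using I finite_subset by blast
  qed
  ultimately have "infinite (\<Union>t<N. A t)" using infinite_super by blast
  then obtain t where t: "t < N" "infinite (A t)" by auto
  have "e t < i \<and> c - \<delta> < (\<Sum>k\<in>G i - (W \<union> U t). m i k)" if i: "i \<in> A t" for i
  proof
    have "e t < e N" using t(1) e(1) by (simp add: strict_mono_less)
    then show "e t < i" using i by (simp add: A_def)
    have "c < (\<Sum>k\<in>G i - W. m i k)" using i big by (simp add: A_def)
    also have "\<dots> \<le> (\<Sum>k\<in>(G i - (W \<union> U t)) \<union> (G i \<inter> U t). m i k)"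
      by (rule sum_mono2) (use G(1) m(1) in auto)
    also have "\<dots> = (\<Sum>k\<in>G i - (W \<union> U t). m i k) + (\<Sum>k\<in>G i \<inter> U t. m i k)"
      by (rule sum.union_disjoint) (use G(1) in auto)
    finally show "c - \<delta> < (\<Sum>k\<in>G i - (W \<union> U t). m i k)" using i by (simp add: A_def)
  qed
  moreover have "A t \<subseteq> I" by (auto simp: A_def)
  ultimately show ?thesis
    using e(2)[of t] U[OF t(1)] t(2) by (intro bexI[of _ "e t"] exI[of _ "U t"] exI[of _ "A t"]) auto
qed

lemma separated_subsequence:
  fixes G :: "nat \<Rightarrow> 'a::t2_space set" and m :: "nat \<Rightarrow> 'a \<Rightarrow> real"
  assumes G: "\<And>i. finite (G i)" "\<And>i j. i \<noteq> j \<Longrightarrow> G i \<inter> G j = {}"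
    and m: "\<And>i k. 0 \<le> m i k" "\<And>i. (\<Sum>k\<in>G i. m i k) \<le> M"
    and big: "\<And>i. c < (\<Sum>k\<in>G i. m i k)" and \<epsilon>: "\<epsilon> > 0"
  obtains r :: "nat \<Rightarrow> nat" and H U :: "nat \<Rightarrow> 'a set" where "strict_mono r"
    "\<And>j. H j \<subseteq> G (r j)" "\<And>j. open (U j)" "\<And>j. H j \<subseteq> U j" "\<And>j l. j < l \<Longrightarrow> U j \<inter> H l = {}"
    "\<And>j. c - \<epsilon> < (\<Sum>k\<in>H j. m (r j) k)"
proof -
  define d where "d n = c - \<epsilon> + \<epsilon> / 2 ^ n" for n :: nat
  have d: "c - \<epsilon> < d n" "d n - \<epsilon> / 2 ^ Suc n = d (Suc n)" for n
    using \<epsilon> by (simp_all add: d_def)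
  \<comment> \<open>State: the chosen index \<open>i\<close>, its set \<open>H\<close> and neighbourhood \<open>U\<close>, the indices \<open>I\<close> still admitted, and the
    union \<open>W\<close> of the neighbourhoods chosen so far.\<close>
  define P :: "nat \<Rightarrow> nat \<times> 'a set \<times> 'a set \<times> nat set \<times> 'a set \<Rightarrow> bool" where
    "P n = (\<lambda>(i, H, U, I, W). infinite I \<and> (\<forall>i'\<in>I. i < i' \<and> d (Suc n) < (\<Sum>k\<in>G i' - W. m i' k)) \<and>
       open U \<and> H \<subseteq> U \<and> H \<subseteq> G i \<and> U \<subseteq> W \<and> c - \<epsilon> < (\<Sum>k\<in>H. m i k))" for n
  define Q :: "nat \<times> 'a set \<times> 'a set \<times> nat set \<times> 'a set \<Rightarrow> nat \<times> 'a set \<times> 'a set \<times> nat set \<times> 'a set \<Rightarrow> bool" where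
    "Q = (\<lambda>(i, H, U, I, W) (i', H', U', I', W'). i < i' \<and> W \<subseteq> W' \<and> H' \<inter> W = {})"
  have step: "\<exists>i\<in>I. \<exists>U I'. P n (i, G i - W, U, I', W \<union> U)"
    if I: "infinite I" "\<And>i. i \<in> I \<Longrightarrow> d n < (\<Sum>k\<in>G i - W. m i k)" for I W n
  proof -
    have "\<epsilon> / 2 ^ Suc n > 0" using \<epsilon> by simp
    from separation_step[of G m M I "d n" W, OF G m I this]
    obtain i U I' where i: "i \<in> I" "open U" "G i \<subseteq> U" "I' \<subseteq> I" "infinite I'"
      "\<forall>i'\<in>I'. i < i' \<and> d n - \<epsilon> / 2 ^ Suc n < (\<Sum>k\<in>G i' - (W \<union> U). m i' k)"
      by blast
    have "c - \<epsilon> < (\<Sum>k\<in>G i - W. m i k)" using d(1)[of n] I(2)[OF i(1)] by linarith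
    then have "P n (i, G i - W, U, I', W \<union> U)"
      unfolding P_def using i(2,3,5,6) d(2)[of n] by auto
    then show ?thesis using i(1) by blast
  qed
  have "\<exists>s. \<forall>n. P n (s n) \<and> Q (s n) (s (Suc n))"
  proof (rule dependent_nat_choice)
    have "d 0 < (\<Sum>k\<in>G i - {}. m i k)" for i using big by (simp add: d_def)
    then have "\<exists>i\<in>UNIV. \<exists>U I'. P 0 (i, G i - {}, U, I', {} \<union> U)"
      by (intro step) auto
    then show "\<exists>s. P 0 s" by blast
  next
    fix s n assume Ps: "P n s"
    obtain i H U I W where s: "s = (i, H, U, I, W)" by (cases s) auto
    have I: "infinite I" "\<And>i'. i' \<in> I \<Longrightarrow> i < i' \<and> d (Suc n) < (\<Sum>k\<in>G i' - W. m i' k)"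
      using Ps by (auto simp: P_def s)
    then obtain i' U' I' where i': "i' \<in> I" "P (Suc n) (i', G i' - W, U', I', W \<union> U')"
      using step[of I "Suc n" W] by blast
    have "Q s (i', G i' - W, U', I', W \<union> U')" using I(2)[OF i'(1)] by (auto simp: Q_def s)
    with i'(2) show "\<exists>s'. P (Suc n) s' \<and> Q s s'" by blast
  qed
  then obtain s where s: "\<And>n. P n (s n)" "\<And>n. Q (s n) (s (Suc n))" by blast
  define r where "r n = fst (s n)" for n
  define H where "H n = fst (snd (s n))" for n
  define U where "U n = fst (snd (snd (s n)))" for n
  define I where "I n = fst (snd (snd (snd (s n))))" for n
  define W where "W n = snd (snd (snd (snd (s n))))" for n
  have s_eq: "s n = (r n, H n, U n, I n, W n)" for n
    by (simp add: r_def H_def U_def I_def W_def)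
  have P: "open (U n)" "H n \<subseteq> U n" "H n \<subseteq> G (r n)" "U n \<subseteq> W n" "c - \<epsilon> < (\<Sum>k\<in>H n. m (r n) k)" for n
    using s(1)[of n] unfolding s_eq P_def by auto
  have Q: "r n < r (Suc n)" "W n \<subseteq> W (Suc n)" "H (Suc n) \<inter> W n = {}" for n
    using s(2)[of n] unfolding s_eq Q_def by auto
  show thesis
  proof (rule that[of r H U])
    show "strict_mono r" using Q(1) by (simp add: strict_mono_Suc_iff)
    fix j l :: nat assume jl: "j < l"
    then obtain l' where l': "l = Suc l'" "j \<le> l'" by (cases l) auto
    have "W j \<subseteq> W l'" by (rule lift_Suc_mono_le[of W, OF Q(2) l'(2)])
    then show "U j \<inter> H l = {}" using P(4)[of j] Q(3)[of l'] l'(1) by blast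
  qed (use P in auto)
qed

lemma disjoint_neighbourhoods:
  fixes G :: "nat \<Rightarrow> 'a::t2_space set" and m :: "nat \<Rightarrow> 'a \<Rightarrow> real"
  assumes lc: "locally_compact_space (euclidean :: 'a topology)"
    and G: "\<And>i. finite (G i)" "\<And>i j. i \<noteq> j \<Longrightarrow> G i \<inter> G j = {}"
    and m: "\<And>i k. 0 \<le> m i k" "\<And>i. (\<Sum>k\<in>G i. m i k) \<le> M"
    and big: "\<And>i. c < (\<Sum>k\<in>G i. m i k)" and \<epsilon>: "\<epsilon> > 0"
  obtains r :: "nat \<Rightarrow> nat" and H V :: "nat \<Rightarrow> 'a set" where "strict_mono r"
    "\<And>j. finite (H j)" "\<And>j. open (V j)" "\<And>j. H j \<subseteq> V j" "\<And>j l. j \<noteq> l \<Longrightarrow> V j \<inter> V l = {}"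
    "\<And>j. c - \<epsilon> < (\<Sum>k\<in>H j. m (r j) k)"
proof -
  obtain r :: "nat \<Rightarrow> nat" and H U :: "nat \<Rightarrow> 'a set" where r: "strict_mono r"
    "\<And>j. H j \<subseteq> G (r j)" "\<And>j. open (U j)" "\<And>j. H j \<subseteq> U j" "\<And>j l. j < l \<Longrightarrow> U j \<inter> H l = {}"
    "\<And>j. c - \<epsilon> < (\<Sum>k\<in>H j. m (r j) k)"
    by (rule separated_subsequence[of G m M c, OF G m big \<epsilon>], assumption) (rule that)
  have H: "finite (H j)" for j by (rule finite_subset[OF r(2) G(1)])
  have "\<exists>g :: 'a \<Rightarrow> real. continuous_on UNIV g \<and> (\<forall>x\<in>H j. g x = 1) \<and> (\<forall>x. x \<notin> U j \<longrightarrow> g x = 0)" for j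
    by (rule bump[OF lc finite_imp_compact[OF H[of j]] r(3,4)]) blast
  then obtain g :: "nat \<Rightarrow> 'a \<Rightarrow> real" where g: "\<And>j. continuous_on UNIV (g j)"
    "\<And>j x. x \<in> H j \<Longrightarrow> g j x = 1" "\<And>j x. x \<notin> U j \<Longrightarrow> g j x = 0"
    by metis
  \<comment> \<open>The earlier \<^term>\<open>U l\<close> miss \<^term>\<open>H j\<close> but may meet \<^term>\<open>U j\<close>; level sets of bump functions make them disjoint.\<close>
  define V where "V j = {x. 1/2 < g j x} \<inter> (\<Inter>l<j. {x. g l x < 1/2})" for j
  have V_disj: "V j \<inter> V l = {}" if "j < l" for j l
    using that unfolding V_def by (auto simp: not_less) (metis lessThan_iff less_asym)
  show thesis
  proof (rule that[of r H V])
    show "open (V j)" for j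
      unfolding V_def by (intro open_Int open_INT ballI open_Collect_less continuous_intros g(1)) auto
    show "H j \<subseteq> V j" for j
    proof
      fix x assume x: "x \<in> H j"
      have "g l x = 0" if "l < j" for l
        using r(5)[OF that] x by (intro g(3)) blast
      then show "x \<in> V j" using g(2)[OF x] by (simp add: V_def)
    qed
    show "V j \<inter> V l = {}" if "j \<noteq> l" for j l
      using V_disj[of j l] V_disj[of l j] that by (cases "j < l") (auto simp: Int_commute)
  qed (use r H in auto)
qed

section \<open>The essential norm\<close>

lemma norm_blinfun_le_unit:
  fixes \<phi> :: "'x::real_normed_vector \<Rightarrow>\<^sub>L 'y::real_normed_vector"
  assumes "0 \<le> B" "\<And>x. norm x \<le> 1 \<Longrightarrow> norm (blinfun_apply \<phi> x) \<le> B"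
  shows "norm \<phi> \<le> B"
proof (rule norm_blinfun_bound[OF assms(1)])
  fix x :: 'x
  show "norm (blinfun_apply \<phi> x) \<le> B * norm x"
  proof (cases "x = 0")
    case False
    have "norm (blinfun_apply \<phi> ((1 / norm x) *\<^sub>R x)) \<le> B"
      by (rule assms(2)) (use False in simp)
    then show ?thesis using False by (simp add: blinfun.scaleR_right divide_le_eq)
  qed (simp add: blinfun.zero_right)
qed

lemma norm_apply_dual_ball_le:
  assumes "\<phi> \<in> dual_ball s"
  shows "norm (blinfun_apply \<phi> x) \<le> norm x"
proof -
  have "norm (blinfun_apply \<phi> x) \<le> norm \<phi> * norm x" by (rule norm_blinfun)
  also have "\<dots> \<le> 1 * norm x" using assms by (intro mult_right_mono) (auto simp: dual_ball_def)
  finally show ?thesis by simp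
qed

lemma zero_dual_ball: "0 \<in> dual_ball s"
  by (simp add: dual_ball_def dual_def bounded_operators_def)

lemma adjoint_op_apply [simp]: "blinfun_apply (adjoint_op T \<phi>) x = blinfun_apply \<phi> (blinfun_apply T x)"
  by (simp add: adjoint_op_def)

lemma adjoint_op_dual:
  assumes "T \<in> bounded_operators sY sX" "\<phi> \<in> dual sX"
  shows "adjoint_op T \<phi> \<in> dual sY"
  using assms by (simp add: dual_def bounded_operators_def)

lemma norm_adjoint_op_le: "\<phi> \<in> dual_ball s \<Longrightarrow> norm (adjoint_op T \<phi>) \<le> norm T"
  unfolding adjoint_op_def
  by (rule order_trans[OF norm_blinfun_compose]) (auto simp: dual_ball_def intro: mult_left_le_one_le)

lemma adjoint_op_linear:
  "adjoint_op T (\<phi> + \<psi>) = adjoint_op T \<phi> + adjoint_op T \<psi>"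
  "adjoint_op T (dual_scale a \<phi>) = dual_scale a (adjoint_op T \<phi>)"
  by (auto intro!: blinfun_eqI simp: blinfun.add_left)

lemma dual_op_norm_upper:
  assumes S: "S \<in> dual_compact_operators sX sY" and \<phi>: "\<phi> \<in> dual_ball sX"
  shows "norm (adjoint_op T \<phi> - S \<phi>) \<le> dual_op_norm sX (\<lambda>\<phi>. adjoint_op T \<phi> - S \<phi>)"
  unfolding dual_op_norm_def
proof (rule cSUP_upper[OF \<phi>])
  have "bounded (closure (S ` dual_ball sX))"
    using S by (intro compact_imp_bounded) (simp add: dual_compact_operators_def)
  then have "bounded (S ` dual_ball sX)" by (rule bounded_subset) (rule closure_subset)
  then obtain B where B: "\<And>\<phi>. \<phi> \<in> dual_ball sX \<Longrightarrow> norm (S \<phi>) \<le> B"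
    by (auto simp: bounded_iff)
  show "bdd_above ((\<lambda>\<phi>. norm (adjoint_op T \<phi> - S \<phi>)) ` dual_ball sX)"
  proof (rule bdd_aboveI2)
    fix \<phi> assume \<phi>: "\<phi> \<in> dual_ball sX"
    have "norm (adjoint_op T \<phi> - S \<phi>) \<le> norm (adjoint_op T \<phi>) + norm (S \<phi>)"
      by (rule norm_triangle_ineq4)
    also have "\<dots> \<le> norm T + B" using norm_adjoint_op_le[OF \<phi>] B[OF \<phi>] by (rule add_mono)
    finally show "norm (adjoint_op T \<phi> - S \<phi>) \<le> norm T + B" .
  qed
qed

lemma zero_dual_compact_operators:
  fixes sX :: "'k::real_or_complex \<Rightarrow> 'x::real_normed_vector \<Rightarrow> 'x"
    and sY :: "'k \<Rightarrow> 'y::real_normed_vector \<Rightarrow> 'y"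
  shows "(\<lambda>_. 0) \<in> dual_compact_operators sX sY"
proof -
  have "(\<lambda>_. 0) ` dual_ball sX = {0 :: 'y \<Rightarrow>\<^sub>L 'k}" using zero_dual_ball[of sX] by blast
  then have "compact (closure ((\<lambda>_. 0 :: 'y \<Rightarrow>\<^sub>L 'k) ` dual_ball sX))" by simp
  moreover have "(0 :: 'y \<Rightarrow>\<^sub>L 'k) \<in> dual sY"
    by (simp add: dual_def bounded_operators_def)
  moreover have "dual_scale a (0 :: 'y \<Rightarrow>\<^sub>L 'k) = 0" for a
    by (rule blinfun_eqI) simp
  ultimately show ?thesis
    by (simp add: dual_compact_operators_def dual_linear_def)
qed

lemma dual_op_norm_nonneg:
  assumes "S \<in> dual_compact_operators sX sY"
  shows "0 \<le> dual_op_norm sX (\<lambda>\<phi>. adjoint_op T \<phi> - S \<phi>)"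
  using dual_op_norm_upper[OF assms zero_dual_ball, of T] norm_ge_zero order_trans by blast

lemma dual_essential_norm_le:
  assumes S: "S \<in> dual_compact_operators sX sY"
    and le: "\<And>\<phi>. \<phi> \<in> dual_ball sX \<Longrightarrow> norm (adjoint_op T \<phi> - S \<phi>) \<le> B"
  shows "dual_essential_norm sX sY (adjoint_op T) \<le> B"
proof -
  have "dual_essential_norm sX sY (adjoint_op T) \<le> dual_op_norm sX (\<lambda>\<phi>. adjoint_op T \<phi> - S \<phi>)"
    unfolding dual_essential_norm_def
    by (rule cINF_lower[OF _ S]) (rule bdd_belowI2[of _ 0], rule dual_op_norm_nonneg)
  also have "\<dots> \<le> B"
    unfolding dual_op_norm_def using zero_dual_ball le by (intro cSUP_least) auto
  finally show ?thesis .
qed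

subsection \<open>The lower estimate\<close>

lemma c0_existence: "f \<longlonglongrightarrow> 0 \<Longrightarrow> \<exists>F :: 'k::real_normed_vector c0. apply_C0 F = f"
  using range_apply_c0[where 'k='k] by (metis (mono_tags, lifting) imageE mem_Collect_eq)

lemma evaluation_functional:
  fixes k :: "'a::topological_space"
  shows "\<exists>\<delta> \<in> dual_ball (scaleC0 :: 'k::real_or_complex \<Rightarrow> ('a, 'k) C0 \<Rightarrow> _). \<forall>f. blinfun_apply \<delta> f = apply_C0 f k"
proof -
  obtain \<delta> where \<delta>: "\<delta> \<in> dual (scaleC0 :: 'k \<Rightarrow> ('a, 'k) C0 \<Rightarrow> _)" "\<And>f. blinfun_apply \<delta> f = apply_C0 f k"
    using dual_functionalI[of "\<lambda>f. apply_C0 f k" scaleC0 1] normed_space_over_scaleC0 norm_apply_C0_le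
    by auto
  have "norm \<delta> \<le> 1" by (rule norm_blinfun_bound) (auto simp: \<delta>(2) norm_apply_C0_le)
  then show ?thesis using \<delta> by (auto simp: dual_ball_def)
qed

lemma c0_unit_vector:
  "\<exists>e :: 'k::real_normed_field c0. \<forall>i. apply_C0 e i = (if i = n then 1 else 0)"
proof -
  have "(\<lambda>i. if i = n then 1 else 0 :: 'k) \<longlonglongrightarrow> 0"
    by (rule tendsto_eventually) (auto intro: eventually_sequentiallyI[of "Suc n"])
  from c0_existence[OF this] show ?thesis by metis
qed

theorem factorization_le_essential_norm:
  fixes s :: "'k::real_or_complex \<Rightarrow> 'x::real_normed_vector \<Rightarrow> 'x"
    and T :: "('a::t2_space, 'k) C0 \<Rightarrow>\<^sub>L 'x"
    and U :: "'x \<Rightarrow>\<^sub>L 'k c0" and V :: "'k c0 \<Rightarrow>\<^sub>L ('a, 'k) C0"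
  assumes s: "normed_space_over s" and U: "U \<in> bounded_operators s scaleC0"
    and UTV: "U o\<^sub>L T o\<^sub>L V = id_blinfun"
  shows "inverse (norm U) * inverse (norm V) \<le> dual_essential_norm s scaleC0 (adjoint_op T)"
  unfolding dual_essential_norm_def
proof (rule cINF_greatest)
  show "dual_compact_operators s (scaleC0 :: 'k \<Rightarrow> ('a, 'k) C0 \<Rightarrow> _) \<noteq> {}"
    using zero_dual_compact_operators by blast
  fix S assume S: "S \<in> dual_compact_operators s (scaleC0 :: 'k \<Rightarrow> ('a, 'k) C0 \<Rightarrow> _)"
  let ?D = "dual_op_norm s (\<lambda>\<phi>. adjoint_op T \<phi> - S \<phi>)"
  have UTV_apply: "blinfun_apply U (blinfun_apply T (blinfun_apply V a)) = a" for a
    using arg_cong[OF UTV, of "\<lambda>A. blinfun_apply A a"] by simp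
  have "\<exists>e :: nat \<Rightarrow> 'k c0. \<forall>n i. apply_C0 (e n) i = (if i = n then 1 else 0)"
    using c0_unit_vector by metis
  then obtain e :: "nat \<Rightarrow> 'k c0" where e: "\<And>n i. apply_C0 (e n) i = (if i = n then 1 else 0)"
    by blast
  have e_nz: "e 0 \<noteq> 0" using e[of 0 0] by auto
  have U0: "norm U > 0" and V0: "norm V > 0"
    using UTV_apply[of "e 0"] e_nz by (auto simp: blinfun.zero_left blinfun.zero_right)
  have "\<forall>n. \<exists>\<delta> \<in> dual_ball (scaleC0 :: 'k \<Rightarrow> 'k c0 \<Rightarrow> _). \<forall>f. blinfun_apply \<delta> f = apply_C0 f n"
    using evaluation_functional by blast
  then obtain \<delta> where \<delta>: "\<And>n. \<delta> n \<in> dual_ball (scaleC0 :: 'k \<Rightarrow> 'k c0 \<Rightarrow> _)"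
    "\<And>n f. blinfun_apply (\<delta> n) f = apply_C0 f n"
    by metis
  define \<phi> where "\<phi> n = (1 / norm U) *\<^sub>R (\<delta> n o\<^sub>L U)" for n
  have \<phi>_apply: "blinfun_apply (\<phi> n) x = (1 / norm U) *\<^sub>R apply_C0 (blinfun_apply U x) n" for n x
    by (simp add: \<phi>_def blinfun.scaleR_left \<delta>(2))
  have \<phi>: "\<phi> n \<in> dual_ball s" for n
  proof -
    have "norm (\<delta> n o\<^sub>L U) \<le> 1 * norm U"
      by (rule order_trans[OF norm_blinfun_compose])
        (use \<delta>(1)[of n] in \<open>auto simp: dual_ball_def intro: mult_left_le_one_le\<close>)
    then have "norm (\<phi> n) \<le> 1" using U0 by (simp add: \<phi>_def divide_le_eq)
    moreover have "\<phi> n \<in> dual s"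
      using U by (simp add: dual_def bounded_operators_def \<phi>_apply)
    ultimately show ?thesis by (simp add: dual_ball_def)
  qed
  have "compact (closure (S ` dual_ball s))" using S by (simp add: dual_compact_operators_def)
  moreover have "\<forall>n. S (\<phi> n) \<in> closure (S ` dual_ball s)"
    using \<phi> closure_subset by blast
  ultimately have "\<exists>l\<in>closure (S ` dual_ball s). \<exists>r. strict_mono r \<and> ((\<lambda>n. S (\<phi> n)) \<circ> r) \<longlonglongrightarrow> l"
    unfolding compact_def by (auto dest: spec[of _ "\<lambda>n. S (\<phi> n)"])
  then obtain l and r :: "nat \<Rightarrow> nat" where r: "strict_mono r" "((\<lambda>n. S (\<phi> n)) \<circ> r) \<longlonglongrightarrow> l"
    by blast
  have Cau: "Cauchy ((\<lambda>n. S (\<phi> n)) \<circ> r)" by (rule LIMSEQ_imp_Cauchy[OF r(2)])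
  show "inverse (norm U) * inverse (norm V) \<le> ?D"
  proof (rule field_le_epsilon)
    fix \<epsilon> :: real assume \<epsilon>: "\<epsilon> > 0"
    obtain N where N: "\<And>m n. m \<ge> N \<Longrightarrow> n \<ge> N \<Longrightarrow> dist (((\<lambda>n. S (\<phi> n)) \<circ> r) m) (((\<lambda>n. S (\<phi> n)) \<circ> r) n) < \<epsilon>"
      using metric_CauchyD[OF Cau \<epsilon>] by blast
    define m where "m = r N"
    define n where "n = r (Suc N)"
    have mn: "m \<noteq> n" using r(1) by (simp add: m_def n_def strict_mono_eq)
    have Smn: "norm (S (\<phi> m) - S (\<phi> n)) < \<epsilon>"
      using N[of N "Suc N"] by (simp add: m_def n_def dist_norm)
    let ?a = "e m - e n"
    let ?\<Phi> = "adjoint_op T (\<phi> m) - adjoint_op T (\<phi> n)"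
    have "norm ?a \<le> 1" by (rule norm_C0_le) (auto simp: e)
    have "blinfun_apply ?\<Phi> (blinfun_apply V ?a) = of_real (2 / norm U)"
      using mn by (simp add: blinfun.diff_left \<phi>_apply UTV_apply e scaleR_conv_of_real)
    then have "2 / norm U = norm (blinfun_apply ?\<Phi> (blinfun_apply V ?a))"
      by (simp only: norm_of_real) simp
    also have "\<dots> \<le> norm ?\<Phi> * norm (blinfun_apply V ?a)" by (rule norm_blinfun)
    also have "\<dots> \<le> norm ?\<Phi> * (norm V * 1)"
      by (intro mult_left_mono order_trans[OF norm_blinfun]) (use \<open>norm ?a \<le> 1\<close> in \<open>auto intro: mult_left_le\<close>)
    finally have 1: "2 / norm U \<le> norm ?\<Phi> * norm V" by simp
    have "?\<Phi> = (adjoint_op T (\<phi> m) - S (\<phi> m)) - (adjoint_op T (\<phi> n) - S (\<phi> n)) + (S (\<phi> m) - S (\<phi> n))"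
      by simp
    then have "norm ?\<Phi> \<le> norm (adjoint_op T (\<phi> m) - S (\<phi> m)) + norm (adjoint_op T (\<phi> n) - S (\<phi> n)) + norm (S (\<phi> m) - S (\<phi> n))"
      by (metis norm_triangle_le norm_triangle_ineq4 add_right_mono)
    also have "\<dots> \<le> ?D + ?D + \<epsilon>"
      using dual_op_norm_upper[OF S \<phi>, of T m] dual_op_norm_upper[OF S \<phi>, of T n] Smn by linarith
    finally have "norm ?\<Phi> * norm V \<le> (2 * ?D + \<epsilon>) * norm V"
      by (intro mult_right_mono) auto
    with 1 have "2 / norm U \<le> (2 * ?D + \<epsilon>) * norm V" by linarith
    then have "2 / norm U / norm V \<le> 2 * ?D + \<epsilon>" using pos_divide_le_eq[OF V0] by blast
    moreover have "2 / norm U / norm V = 2 * (inverse (norm U) * inverse (norm V))"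
      by (simp add: divide_inverse mult.assoc)
    ultimately show "inverse (norm U) * inverse (norm V) \<le> ?D + \<epsilon>"
      using \<epsilon> by linarith
  qed
qed

subsection \<open>Operators of essential norm zero\<close>

lemma finite_net_image:
  fixes S :: "'b \<Rightarrow> 'c::metric_space"
  assumes "compact (closure (S ` B))" "\<epsilon> > 0"
  obtains \<Phi> where "finite \<Phi>" "\<Phi> \<subseteq> B" "\<And>\<phi>. \<phi> \<in> B \<Longrightarrow> \<exists>\<psi>\<in>\<Phi>. dist (S \<phi>) (S \<psi>) < \<epsilon>"
proof -
  have "closure (S ` B) \<subseteq> (\<Union>\<psi>\<in>B. ball (S \<psi>) \<epsilon>)"
    using assms(2) by (force simp: closure_approachable)
  then obtain \<Phi> where \<Phi>: "\<Phi> \<subseteq> B" "finite \<Phi>" "closure (S ` B) \<subseteq> (\<Union>\<psi>\<in>\<Phi>. ball (S \<psi>) \<epsilon>)"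
    using compactE_image[OF assms(1), of B "\<lambda>\<psi>. ball (S \<psi>) \<epsilon>"] by auto
  show thesis
  proof (rule that[OF \<Phi>(2,1)])
    fix \<phi> assume "\<phi> \<in> B"
    then have "S \<phi> \<in> S ` B" by (rule imageI)
    then have "S \<phi> \<in> closure (S ` B)" by (rule subsetD[OF closure_subset])
    then have "S \<phi> \<in> (\<Union>\<psi>\<in>\<Phi>. ball (S \<psi>) \<epsilon>)" by (rule subsetD[OF \<Phi>(3)])
    then show "\<exists>\<psi>\<in>\<Phi>. dist (S \<phi>) (S \<psi>) < \<epsilon>" by (auto simp: dist_commute)
  qed
qed

lemma finite_net_scalars:
  fixes g :: "'i \<Rightarrow> 'b \<Rightarrow> 'k::real_or_complex"
  assumes \<Phi>: "finite \<Phi>" and g: "\<And>\<psi> f. \<psi> \<in> \<Phi> \<Longrightarrow> f \<in> B \<Longrightarrow> norm (g \<psi> f) \<le> R" and \<epsilon>: "\<epsilon> > 0"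
  obtains Q where "finite Q" "Q \<subseteq> B" "\<And>f. f \<in> B \<Longrightarrow> \<exists>q\<in>Q. \<forall>\<psi>\<in>\<Phi>. norm (g \<psi> f - g \<psi> q) < \<epsilon>"
proof -
  have \<epsilon>2: "\<epsilon> / 2 > 0" using \<epsilon> by simp
  obtain k where k: "finite k" "cball (0::'k) R \<subseteq> (\<Union>x\<in>k. ball x (\<epsilon> / 2))"
    using compact_cball_scalar[of R, where 'k='k] \<epsilon>2 unfolding compact_eq_totally_bounded by meson
  define pick where "pick z = (SOME x. x \<in> k \<and> dist x z < \<epsilon> / 2)" for z
  have pick: "pick z \<in> k" "dist (pick z) z < \<epsilon> / 2" if "norm z \<le> R" for z
  proof -
    have "\<exists>x. x \<in> k \<and> dist x z < \<epsilon> / 2" using k(2) that by (auto simp: subset_iff)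
    from someI_ex[OF this] show "pick z \<in> k" "dist (pick z) z < \<epsilon> / 2" by (auto simp: pick_def)
  qed
  define col where "col f = (\<lambda>\<psi>\<in>\<Phi>. pick (g \<psi> f))" for f
  have "col ` B \<subseteq> \<Phi> \<rightarrow>\<^sub>E k" using pick(1) g by (auto simp: col_def)
  then have "finite (col ` B)" using finite_PiE[OF \<Phi>, of "\<lambda>_. k"] k(1) finite_subset by blast
  then obtain Q where Q: "Q \<subseteq> B" "finite Q" "col ` B = col ` Q"
    using finite_subset_image[of "col ` B" col B] by blast
  show thesis
  proof (rule that[OF Q(2,1)])
    fix f assume f: "f \<in> B"
    then obtain q where q: "q \<in> Q" "col f = col q" using Q(3) by (metis imageE imageI)
    have "norm (g \<psi> f - g \<psi> q) < \<epsilon>" if \<psi>: "\<psi> \<in> \<Phi>" for \<psi>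
    proof -
      have "pick (g \<psi> f) = pick (g \<psi> q)" using fun_cong[OF q(2), of \<psi>] \<psi> by (simp add: col_def)
      moreover have "dist (pick (g \<psi> f)) (g \<psi> f) < \<epsilon> / 2" by (rule pick(2)[OF g[OF \<psi> f]])
      moreover have "dist (pick (g \<psi> q)) (g \<psi> q) < \<epsilon> / 2" by (rule pick(2)[OF g[OF \<psi>]]) (use q(1) Q(1) in blast)
      ultimately have "dist (g \<psi> f) (g \<psi> q) < \<epsilon>" by (metis dist_triangle_half_r)
      then show ?thesis by (simp add: dist_norm)
    qed
    then show "\<exists>q\<in>Q. \<forall>\<psi>\<in>\<Phi>. norm (g \<psi> f - g \<psi> q) < \<epsilon>" using q(1) by blast
  qed
qed

lemma compact_operatorI:
  fixes T :: "'y::real_normed_vector \<Rightarrow>\<^sub>L 'x::banach"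
  assumes "\<And>\<epsilon>. \<epsilon> > 0 \<Longrightarrow> \<exists>Q. finite Q \<and> (\<forall>f. norm f \<le> 1 \<longrightarrow> (\<exists>q\<in>Q. norm (blinfun_apply T f - blinfun_apply T q) \<le> \<epsilon>))"
  shows "compact_operator T"
  unfolding compact_operator_def compact_eq_totally_bounded
proof (intro conjI allI impI)
  show "complete (closure (blinfun_apply T ` cball 0 1))"
    by (simp add: complete_eq_closed)
  fix \<epsilon> :: real assume \<epsilon>: "\<epsilon> > 0"
  then obtain Q where Q: "finite Q" "\<And>f. norm f \<le> 1 \<Longrightarrow> \<exists>q\<in>Q. norm (blinfun_apply T f - blinfun_apply T q) \<le> \<epsilon> / 2"
    using assms[of "\<epsilon> / 2"] by auto
  have "blinfun_apply T ` cball 0 1 \<subseteq> (\<Union>q\<in>Q. cball (blinfun_apply T q) (\<epsilon> / 2))"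
    using Q(2) by (fastforce simp: dist_norm norm_minus_commute)
  moreover have "closed (\<Union>q\<in>Q. cball (blinfun_apply T q) (\<epsilon> / 2))"
    using Q(1) by (intro closed_UN) auto
  ultimately have "closure (blinfun_apply T ` cball 0 1) \<subseteq> (\<Union>q\<in>Q. cball (blinfun_apply T q) (\<epsilon> / 2))"
    by (rule closure_minimal)
  also have "\<dots> \<subseteq> (\<Union>x\<in>blinfun_apply T ` Q. ball x \<epsilon>)" using \<epsilon> by auto
  finally show "\<exists>k. finite k \<and> closure (blinfun_apply T ` cball 0 1) \<subseteq> (\<Union>x\<in>k. ball x \<epsilon>)"
    using Q(1) by (intro exI[of _ "blinfun_apply T ` Q"]) simp
qed

text \<open>
  If compact operators approximate the adjoint, finitely many functionals in the dual ball suffice to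
  estimate the norm of \<open>T f\<close> up to a small error, and a finite net for their values is one for the image of the unit ball.
\<close>

theorem essential_norm_pos:
  fixes s :: "'k::real_or_complex \<Rightarrow> 'x::banach \<Rightarrow> 'x" and T :: "'y::real_normed_vector \<Rightarrow>\<^sub>L 'x"
  assumes s: "normed_space_over s" and T: "\<not> compact_operator T"
  shows "dual_essential_norm s sY (adjoint_op T) > 0"
proof (rule ccontr)
  assume "\<not> ?thesis"
  then have e0: "dual_essential_norm s sY (adjoint_op T) \<le> 0" by simp
  have "compact_operator T"
  proof (rule compact_operatorI)
    fix \<epsilon>' :: real assume "\<epsilon>' > 0"
    define \<epsilon> where "\<epsilon> = \<epsilon>' / 8"
    have \<epsilon>: "\<epsilon> > 0" using \<open>\<epsilon>' > 0\<close> by (simp add: \<epsilon>_def)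
    have "(INF S\<in>dual_compact_operators s sY. dual_op_norm s (\<lambda>\<phi>. adjoint_op T \<phi> - S \<phi>)) < \<epsilon>"
      using e0 \<epsilon> unfolding dual_essential_norm_def by linarith
    then obtain S where S: "S \<in> dual_compact_operators s sY" "dual_op_norm s (\<lambda>\<phi>. adjoint_op T \<phi> - S \<phi>) < \<epsilon>"
      using cInf_lessD[of "(\<lambda>S. dual_op_norm s (\<lambda>\<phi>. adjoint_op T \<phi> - S \<phi>)) ` dual_compact_operators s sY" \<epsilon>]
        zero_dual_compact_operators by blast
    have TS: "norm (adjoint_op T \<phi> - S \<phi>) \<le> \<epsilon>" if "\<phi> \<in> dual_ball s" for \<phi>
      using dual_op_norm_upper[OF S(1) that, of T] S(2) by linarith
    have "compact (closure (S ` dual_ball s))" using S(1) by (simp add: dual_compact_operators_def)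
    then obtain \<Phi> where \<Phi>: "finite \<Phi>" "\<Phi> \<subseteq> dual_ball s"
      "\<And>\<phi>. \<phi> \<in> dual_ball s \<Longrightarrow> \<exists>\<psi>\<in>\<Phi>. dist (S \<phi>) (S \<psi>) < \<epsilon>"
      by (rule finite_net_image[OF _ \<epsilon>]) (rule that)
    have bound: "norm (blinfun_apply \<psi> (blinfun_apply T f)) \<le> norm T"
      if "\<psi> \<in> \<Phi>" "f \<in> cball 0 1" for \<psi> f
    proof -
      have "norm (blinfun_apply \<psi> (blinfun_apply T f)) \<le> norm (blinfun_apply T f)"
        using that(1) \<Phi>(2) by (intro norm_apply_dual_ball_le) auto
      also have "\<dots> \<le> norm T * norm f" by (rule norm_blinfun)
      also have "\<dots> \<le> norm T" using that(2) by (auto intro: mult_left_le)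
      finally show ?thesis .
    qed
    obtain Q where Q: "finite Q" "Q \<subseteq> cball 0 1" "\<And>f. f \<in> cball 0 1 \<Longrightarrow>
        \<exists>q\<in>Q. \<forall>\<psi>\<in>\<Phi>. norm (blinfun_apply \<psi> (blinfun_apply T f) - blinfun_apply \<psi> (blinfun_apply T q)) < \<epsilon>"
      by (rule finite_net_scalars[OF \<Phi>(1), of "cball 0 1" "\<lambda>\<psi> f. blinfun_apply \<psi> (blinfun_apply T f)" "norm T" \<epsilon>, OF bound \<epsilon>])
        (assumption, assumption, rule that)
    have "\<exists>q\<in>Q. norm (blinfun_apply T f - blinfun_apply T q) \<le> \<epsilon>'" if f: "norm f \<le> 1" for f
    proof -
      obtain q where q: "q \<in> Q" "\<And>\<psi>. \<psi> \<in> \<Phi> \<Longrightarrow> norm (blinfun_apply \<psi> (blinfun_apply T f) - blinfun_apply \<psi> (blinfun_apply T q)) < \<epsilon>"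
        using Q(3)[of f] f by auto
      let ?d = "f - q"
      have d: "norm ?d \<le> 2"
        using norm_triangle_ineq4[of f q] f q(1) Q(2) by fastforce
      obtain \<phi> where \<phi>: "\<phi> \<in> dual_ball s" "norm (blinfun_apply T ?d) \<le> norm (blinfun_apply \<phi> (blinfun_apply T ?d))"
        using dual_norming_functional[OF s, of "blinfun_apply T ?d"] by blast
      obtain \<psi> where \<psi>: "\<psi> \<in> \<Phi>" "dist (S \<phi>) (S \<psi>) < \<epsilon>" using \<Phi>(3)[OF \<phi>(1)] by blast
      have \<psi>b: "\<psi> \<in> dual_ball s" using \<psi>(1) \<Phi>(2) by blast
      let ?A = "adjoint_op T \<phi> - S \<phi>" and ?B = "S \<phi> - S \<psi>" and ?C = "adjoint_op T \<psi> - S \<psi>"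
      have "norm (adjoint_op T \<phi> - adjoint_op T \<psi>) = norm (?A + ?B - ?C)" by simp
      also have "\<dots> \<le> norm ?A + norm ?B + norm ?C"
        using norm_triangle_ineq4[of "?A + ?B" ?C] norm_triangle_ineq[of ?A ?B] by linarith
      also have "\<dots> \<le> 3 * \<epsilon>" using TS[OF \<phi>(1)] TS[OF \<psi>b] \<psi>(2) unfolding dist_norm by linarith
      finally have "norm (adjoint_op T \<phi> - adjoint_op T \<psi>) * norm ?d \<le> (3 * \<epsilon>) * 2"
        using d by (intro mult_mono) (use \<epsilon> in auto)
      then have 1: "norm (blinfun_apply (adjoint_op T \<phi> - adjoint_op T \<psi>) ?d) \<le> 6 * \<epsilon>"
        using norm_blinfun[of "adjoint_op T \<phi> - adjoint_op T \<psi>" ?d] by linarith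
      have 2: "norm (blinfun_apply \<psi> (blinfun_apply T ?d)) \<le> \<epsilon>"
        using q(2)[OF \<psi>(1)] by (simp add: blinfun.diff_right)
      have "blinfun_apply \<phi> (blinfun_apply T ?d) =
          blinfun_apply (adjoint_op T \<phi> - adjoint_op T \<psi>) ?d + blinfun_apply \<psi> (blinfun_apply T ?d)"
        by (simp add: blinfun.diff_left)
      then have "norm (blinfun_apply \<phi> (blinfun_apply T ?d)) \<le> 6 * \<epsilon> + \<epsilon>"
        using 1 2 norm_triangle_mono by metis
      also have "\<dots> \<le> \<epsilon>'" using \<epsilon> by (simp add: \<epsilon>_def)
      finally have "norm (blinfun_apply T ?d) \<le> \<epsilon>'" using \<phi>(2) by linarith
      then show ?thesis using q(1) by (auto simp: blinfun.diff_right)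
    qed
    then show "\<exists>Q. finite Q \<and> (\<forall>f. norm f \<le> 1 \<longrightarrow> (\<exists>q\<in>Q. norm (blinfun_apply T f - blinfun_apply T q) \<le> \<epsilon>'))"
      using Q(1) by blast
  qed
  with T show False by simp
qed

subsection \<open>Approximation by finitely many point masses\<close>

lemma compact_dual_combinations:
  fixes \<delta> :: "'i \<Rightarrow> 'y::real_normed_vector \<Rightarrow>\<^sub>L 'k::real_or_complex"
  assumes "finite F"
  shows "compact {\<Sum>k\<in>F. dual_scale (c k) (\<delta> k) | c. \<forall>k\<in>F. norm (c k) \<le> M}"
  using assms
proof (induction F)
  case empty
  have "{\<Sum>k\<in>{}. dual_scale (c k) (\<delta> k) | c. \<forall>k\<in>{}. norm (c k) \<le> M} = {0}" by simp
  then show ?case by simp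
next
  case (insert k F)
  let ?A = "(\<lambda>a. dual_scale a (\<delta> k)) ` cball 0 M"
  let ?B = "{\<Sum>k\<in>F. dual_scale (c k) (\<delta> k) | c. \<forall>k\<in>F. norm (c k) \<le> M}"
  have "continuous_on UNIV (\<lambda>a. dual_scale a (\<delta> k))"
    unfolding dual_scale_def by (intro continuous_intros)
  then have "compact ?A"
    by (intro compact_continuous_image compact_cball_scalar) (rule continuous_on_subset, auto)
  then have "compact {x + y | x y. x \<in> ?A \<and> y \<in> ?B}"
    by (rule compact_sums[OF _ insert.IH])
  moreover have "{\<Sum>k\<in>insert k F. dual_scale (c k) (\<delta> k) | c. \<forall>k\<in>insert k F. norm (c k) \<le> M} =
      {x + y | x y. x \<in> ?A \<and> y \<in> ?B}" (is "?L = ?R")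
  proof (intro equalityI subsetI)
    fix z assume "z \<in> ?L"
    then obtain c where "z = (\<Sum>k\<in>insert k F. dual_scale (c k) (\<delta> k))" "\<forall>k\<in>insert k F. norm (c k) \<le> M" by blast
    then show "z \<in> ?R" using insert.hyps
      by (intro CollectI exI[of _ "dual_scale (c k) (\<delta> k)"] exI[of _ "\<Sum>k\<in>F. dual_scale (c k) (\<delta> k)"]) auto
  next
    fix z assume "z \<in> ?R"
    then obtain a c where a: "z = dual_scale a (\<delta> k) + (\<Sum>k\<in>F. dual_scale (c k) (\<delta> k))" "norm a \<le> M"
      "\<forall>k\<in>F. norm (c k) \<le> M" by auto
    have "(\<Sum>j\<in>F. dual_scale ((c(k := a)) j) (\<delta> j)) = (\<Sum>j\<in>F. dual_scale (c j) (\<delta> j))"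
      using insert.hyps(2) by (intro sum.cong) auto
    then show "z \<in> ?L"
      using a insert.hyps by (intro CollectI exI[of _ "c(k := a)"]) auto
  qed
  ultimately show ?case by simp
qed

text \<open>
  Otherwise \<open>\<phi> \<mapsto> \<Sum>\<^sub>k\<^sub>\<in>\<^sub>F (T\<^sup>* \<phi>)({k}) \<delta>\<^sub>k\<close> would be a compact operator at distance at most \<^term>\<open>c\<close> from the adjoint.
\<close>

theorem large_outside_finite_set:
  fixes s :: "'k::real_or_complex \<Rightarrow> 'x::real_normed_vector \<Rightarrow> 'x"
    and T :: "('a::t2_space, 'k) C0 \<Rightarrow>\<^sub>L 'x"
  assumes lc: "locally_compact_space (euclidean :: 'a topology)" and sc: "scattered (UNIV :: 'a set)"
    and T: "T \<in> bounded_operators scaleC0 s"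
    and c: "c < dual_essential_norm s scaleC0 (adjoint_op T)" and F: "finite F"
  shows "\<exists>\<phi>\<in>dual_ball s. \<exists>G. finite G \<and> G \<inter> F = {} \<and> c < (\<Sum>k\<in>G. norm (point_mass (adjoint_op T \<phi>) k))"
proof (rule ccontr)
  assume "\<not> ?thesis"
  then have small: "(\<Sum>k\<in>G. norm (point_mass (adjoint_op T \<phi>) k)) \<le> c"
    if "\<phi> \<in> dual_ball s" "finite G" "G \<inter> F = {}" for \<phi> G
    using that by (meson not_le)
  have c0: "0 \<le> c" using small[OF zero_dual_ball, of "{}"] by simp
  have T': "adjoint_op T \<phi> \<in> dual scaleC0" if "\<phi> \<in> dual s" for \<phi>
    by (rule adjoint_op_dual[OF T that])
  have "\<forall>k. \<exists>\<delta> \<in> dual_ball (scaleC0 :: 'k \<Rightarrow> ('a, 'k) C0 \<Rightarrow> _). \<forall>f. blinfun_apply \<delta> f = apply_C0 f k"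
    using evaluation_functional by blast
  then obtain \<delta> where \<delta>: "\<And>k. \<delta> k \<in> dual_ball (scaleC0 :: 'k \<Rightarrow> ('a, 'k) C0 \<Rightarrow> _)"
    "\<And>k f. blinfun_apply (\<delta> k) f = apply_C0 f k"
    by metis
  define S where "S \<phi> = (\<Sum>k\<in>F. dual_scale (point_mass (adjoint_op T \<phi>) k) (\<delta> k))" for \<phi>
  have S_apply: "blinfun_apply (S \<phi>) f = (\<Sum>k\<in>F. point_mass (adjoint_op T \<phi>) k * apply_C0 f k)" for \<phi> f
    by (simp add: S_def blinfun.sum_left \<delta>(2))
  have "S \<in> dual_compact_operators s scaleC0"
    unfolding dual_compact_operators_def
  proof (intro CollectI conjI)
    show "dual_linear s scaleC0 S"
      unfolding dual_linear_def
    proof (intro conjI ballI allI)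
      fix \<phi> assume \<phi>: "\<phi> \<in> dual s"
      show "S \<phi> \<in> dual scaleC0"
        by (simp add: dual_def bounded_operators_def S_apply sum_distrib_left mult.left_commute)
      show "S (\<phi> + \<psi>) = S \<phi> + S \<psi>" if "\<psi> \<in> dual s" for \<psi>
        by (rule blinfun_eqI)
          (simp add: S_apply adjoint_op_linear point_mass_add[OF lc T'[OF \<phi>] T'[OF that]] blinfun.add_left
            distrib_right sum.distrib)
      show "S (dual_scale a \<phi>) = dual_scale a (S \<phi>)" for a
        by (rule blinfun_eqI)
          (simp add: S_apply adjoint_op_linear point_mass_dual_scale[OF lc T'[OF \<phi>]] sum_distrib_left mult.assoc)
    qed
    let ?K = "{\<Sum>k\<in>F. dual_scale (c k) (\<delta> k) | c. \<forall>k\<in>F. norm (c k) \<le> norm T}"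
    have "S ` dual_ball s \<subseteq> ?K"
    proof (intro image_subsetI)
      fix \<phi> assume \<phi>: "\<phi> \<in> dual_ball s"
      then have d: "adjoint_op T \<phi> \<in> dual scaleC0" using T' by (simp add: dual_ball_def)
      have pm: "norm (point_mass (adjoint_op T \<phi>) k) \<le> norm T" for k
        using sum_point_mass_le[OF lc d, of "{k}"] norm_adjoint_op_le[OF \<phi>, of T] by simp
      show "S \<phi> \<in> ?K"
        unfolding S_def
        by (intro CollectI exI[of _ "point_mass (adjoint_op T \<phi>)"] conjI refl ballI pm)
    qed
    moreover have K: "compact ?K" by (rule compact_dual_combinations[OF F])
    ultimately have "closure (S ` dual_ball s) \<subseteq> ?K" by (intro closure_minimal compact_imp_closed)
    then have "?K \<inter> closure (S ` dual_ball s) = closure (S ` dual_ball s)" by (rule Int_absorb1)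
    with compact_Int_closed[OF K closed_closure[of "S ` dual_ball s"]]
    show "compact (closure (S ` dual_ball s))" by (simp only:)
  qed
  then have "dual_essential_norm s scaleC0 (adjoint_op T) \<le> c"
  proof (rule dual_essential_norm_le)
    fix \<phi> assume \<phi>: "\<phi> \<in> dual_ball s"
    then have d: "adjoint_op T \<phi> \<in> dual scaleC0" using T' by (simp add: dual_ball_def)
    show "norm (adjoint_op T \<phi> - S \<phi>) \<le> c"
    proof (rule norm_blinfun_le_unit[OF c0])
      fix f :: "('a, 'k) C0" assume f: "norm f \<le> 1"
      have "norm (blinfun_apply (adjoint_op T \<phi>) f - (\<Sum>k\<in>F. point_mass (adjoint_op T \<phi>) k * apply_C0 f k)) \<le> c"
        by (rule dual_approx_point_masses[OF lc sc d F small[OF \<phi>] f])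
      then show "norm (blinfun_apply (adjoint_op T \<phi> - S \<phi>) f) \<le> c"
        by (simp add: blinfun.diff_left S_apply)
    qed
  qed
  with c show False by simp
qed

section \<open>Factorizations of the identity\<close>

lemma disjoint_choice:
  assumes ex: "\<And>F. finite F \<Longrightarrow> \<exists>x G. finite G \<and> G \<inter> F = {} \<and> P x G"
  obtains x :: "nat \<Rightarrow> 'x" and G :: "nat \<Rightarrow> 'a set"
    where "\<And>n. finite (G n)" "\<And>n. P (x n) (G n)" "\<And>i j. i \<noteq> j \<Longrightarrow> G i \<inter> G j = {}"
proof -
  define A :: "nat \<Rightarrow> 'a set \<times> 'x \<times> 'a set \<Rightarrow> bool" where
    "A n = (\<lambda>(F, x, G). finite F \<and> finite G \<and> G \<subseteq> F \<and> P x G)" for n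
  define B :: "'a set \<times> 'x \<times> 'a set \<Rightarrow> 'a set \<times> 'x \<times> 'a set \<Rightarrow> bool" where
    "B = (\<lambda>(F, x, G) (F', x', G'). F \<subseteq> F' \<and> G' \<inter> F = {})"
  have "\<exists>s. \<forall>n. A n (s n) \<and> B (s n) (s (Suc n))"
  proof (rule dependent_nat_choice)
    obtain x G where "finite G" "P x G" using ex[of "{}"] by auto
    then have "A 0 (G, x, G)" by (simp add: A_def)
    then show "\<exists>s. A 0 s" by blast
  next
    fix s n assume As: "A n s"
    obtain F x G where s: "s = (F, x, G)" by (cases s) auto
    have F: "finite F" using As by (simp add: A_def s)
    obtain x' G' where G': "finite G'" "G' \<inter> F = {}" "P x' G'" using ex[OF F] by auto
    then have "A (Suc n) (F \<union> G', x', G')" "B s (F \<union> G', x', G')"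
      using F by (auto simp: A_def B_def s)
    then show "\<exists>s'. A (Suc n) s' \<and> B s s'" by blast
  qed
  then obtain s where s: "\<And>n. A n (s n)" "\<And>n. B (s n) (s (Suc n))" by blast
  define F where "F n = fst (s n)" for n
  define x where "x n = fst (snd (s n))" for n
  define G where "G n = snd (snd (s n))" for n
  have s_eq: "s n = (F n, x n, G n)" for n by (simp add: F_def x_def G_def)
  have A: "finite (G n)" "G n \<subseteq> F n" "P (x n) (G n)" for n
    using s(1)[of n] unfolding s_eq A_def by auto
  have B: "F n \<subseteq> F (Suc n)" "G (Suc n) \<inter> F n = {}" for n
    using s(2)[of n] unfolding s_eq B_def by auto
  have disj: "G i \<inter> G j = {}" if ij: "i < j" for i j
  proof -
    obtain j' where j': "j = Suc j'" "i \<le> j'" using ij by (cases j) auto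
    have "F i \<subseteq> F j'" by (rule lift_Suc_mono_le[of F, OF B(1) j'(2)])
    then show ?thesis using A(2)[of i] B(2)[of j'] j'(1) by blast
  qed
  show thesis
  proof (rule that[of G x])
    show "G i \<inter> G j = {}" if "i \<noteq> j" for i j
      using disj[of i j] disj[of j i] that by (cases "i < j") (auto simp: Int_commute)
  qed (use A in auto)
qed

text \<open>The inverse exists by Banach's fixed point theorem, and it is linear over the scalar field because \<^term>\<open>A\<close> is.\<close>

lemma left_inverse_near_identity:
  fixes s :: "'k::real_or_complex \<Rightarrow> 'x::banach \<Rightarrow> 'x"
  assumes A: "A \<in> bounded_operators s s"
    and near: "\<And>a. norm (blinfun_apply A a - a) \<le> q * norm a" and q: "0 \<le> q" "q < 1"
  obtains R where "R \<in> bounded_operators s s" "R o\<^sub>L A = id_blinfun" "norm R \<le> 1 / (1 - q)"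
proof -
  have lower: "(1 - q) * norm a \<le> norm (blinfun_apply A a)" for a
  proof -
    have "norm a - norm (blinfun_apply A a) \<le> q * norm a"
      using near[of a] norm_triangle_ineq2[of a "blinfun_apply A a"] by (simp add: norm_minus_commute)
    then show ?thesis by (simp add: algebra_simps)
  qed
  have inj: "inj (blinfun_apply A)"
  proof (rule injI)
    fix a b assume "blinfun_apply A a = blinfun_apply A b"
    then have "(1 - q) * norm (a - b) \<le> 0" using lower[of "a - b"] by (simp add: blinfun.diff_right)
    then show "a = b" using q by (simp add: mult_le_0_iff)
  qed
  have surj: "\<exists>a. blinfun_apply A a = y" for y
  proof -
    have "\<exists>!a. y - (blinfun_apply A a - a) = a"
    proof (rule banach_fix_type[OF q], intro allI)
      fix a b :: 'x
      have "dist (y - (blinfun_apply A a - a)) (y - (blinfun_apply A b - b)) =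
          norm (blinfun_apply A (b - a) - (b - a))"
        by (simp add: dist_norm blinfun.diff_right algebra_simps)
      also have "\<dots> \<le> q * norm (b - a)" by (rule near)
      finally show "dist (y - (blinfun_apply A a - a)) (y - (blinfun_apply A b - b)) \<le> q * dist a b"
        by (simp add: dist_norm norm_minus_commute)
    qed
    then obtain a where "y - (blinfun_apply A a - a) = a" by blast
    then have "blinfun_apply A a = y" by (simp add: algebra_simps)
    then show ?thesis ..
  qed
  define \<rho> where "\<rho> = inv (blinfun_apply A)"
  have A\<rho>: "blinfun_apply A (\<rho> y) = y" for y
    unfolding \<rho>_def using surj[of y] by (metis f_inv_into_f rangeI)
  have \<rho>A: "\<rho> (blinfun_apply A a) = a" for a unfolding \<rho>_def by (rule inv_f_f[OF inj])
  have \<rho>_norm: "norm (\<rho> y) \<le> norm y * (1 / (1 - q))" for y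
    using lower[of "\<rho> y"] q by (simp add: A\<rho> field_simps)
  have bl: "bounded_linear \<rho>"
  proof (rule bounded_linear_intro[OF _ _ \<rho>_norm])
    show "\<rho> (x + y) = \<rho> x + \<rho> y" for x y
      using \<rho>A[of "\<rho> x + \<rho> y"] by (simp add: blinfun.add_right A\<rho>)
    show "\<rho> (r *\<^sub>R x) = r *\<^sub>R \<rho> x" for r x
      using \<rho>A[of "r *\<^sub>R \<rho> x"] by (simp add: blinfun.scaleR_right A\<rho>)
  qed
  have app: "blinfun_apply (Blinfun \<rho>) = \<rho>" by (rule bounded_linear_Blinfun_apply[OF bl])
  show thesis
  proof (rule that[of "Blinfun \<rho>"])
    have A_s: "blinfun_apply A (s a x) = s a (blinfun_apply A x)" for a x
      using A by (simp add: bounded_operators_def)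
    have "\<rho> (s a x) = s a (\<rho> x)" for a x
      using \<rho>A[of "s a (\<rho> x)"] by (simp add: A_s A\<rho>)
    then show "Blinfun \<rho> \<in> bounded_operators s s" by (simp add: bounded_operators_def app)
    show "Blinfun \<rho> o\<^sub>L A = id_blinfun" by (rule blinfun_eqI) (simp add: app \<rho>A)
    show "norm (Blinfun \<rho>) \<le> 1 / (1 - q)"
      by (rule norm_blinfun_bound) (use q \<rho>_norm in \<open>auto simp: app mult.commute\<close>)
  qed
qed

lemma operator_into_c0:
  fixes s :: "'k::real_or_complex \<Rightarrow> 'x::real_normed_vector \<Rightarrow> 'x"
  assumes w: "\<And>n. w n \<in> dual s" "\<And>n. norm (w n) \<le> B"
    and null: "\<And>x. (\<lambda>n. blinfun_apply (w n) x) \<longlonglongrightarrow> 0"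
  obtains U :: "'x \<Rightarrow>\<^sub>L 'k c0" where "U \<in> bounded_operators s scaleC0" "norm U \<le> B"
    "\<And>x n. apply_C0 (blinfun_apply U x) n = blinfun_apply (w n) x"
proof -
  have "\<forall>x. \<exists>F :: 'k c0. apply_C0 F = (\<lambda>n. blinfun_apply (w n) x)"
    using c0_existence[OF null] by blast
  then obtain u :: "'x \<Rightarrow> 'k c0" where u: "\<And>x. apply_C0 (u x) = (\<lambda>n. blinfun_apply (w n) x)" by metis
  have B0: "0 \<le> B" using w(2)[of 0] norm_ge_zero order_trans by blast
  have u_norm: "norm (u x) \<le> norm x * B" for x
  proof (rule norm_C0_le)
    fix n
    have "norm (blinfun_apply (w n) x) \<le> norm (w n) * norm x" by (rule norm_blinfun)
    also have "\<dots> \<le> B * norm x" by (intro mult_right_mono w) simp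
    finally show "norm (apply_C0 (u x) n) \<le> norm x * B" by (simp add: u mult.commute)
  qed
  have bl: "bounded_linear u"
    by (rule bounded_linear_intro[OF _ _ u_norm])
      (auto intro!: apply_C0_eqI simp: u blinfun.add_right blinfun.scaleR_right)
  have app: "blinfun_apply (Blinfun u) = u" by (rule bounded_linear_Blinfun_apply[OF bl])
  show thesis
  proof (rule that[of "Blinfun u"])
    have "u (s a x) = scaleC0 a (u x)" for a x
      by (rule apply_C0_eqI) (simp add: u dual_applyD[OF w(1)])
    then show "Blinfun u \<in> bounded_operators s scaleC0" by (simp add: bounded_operators_def app)
    show "norm (Blinfun u) \<le> B"
      by (rule norm_blinfun_bound[OF B0]) (use u_norm in \<open>simp add: app mult.commute\<close>)
  qed (simp add: app u)
qed

lemma operator_from_c0: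
  fixes g :: "nat \<Rightarrow> ('a::topological_space, 'k::real_or_complex) C0"
  assumes g: "\<And>n. norm (g n) \<le> 1"
    and disj: "\<And>m n x. m \<noteq> n \<Longrightarrow> apply_C0 (g m) x = 0 \<or> apply_C0 (g n) x = 0"
  obtains V :: "'k c0 \<Rightarrow>\<^sub>L ('a, 'k) C0" where "V \<in> bounded_operators scaleC0 scaleC0" "norm V \<le> 1"
    "\<And>a. (\<lambda>N. \<Sum>n<N. scaleC0 (apply_C0 a n) (g n)) \<longlonglongrightarrow> blinfun_apply V a"
proof -
  interpret C: normed_space_over "scaleC0 :: 'k \<Rightarrow> ('a, 'k) C0 \<Rightarrow> _" by (rule normed_space_over_scaleC0)
  have summ: "summable (\<lambda>n. scaleC0 (apply_C0 a n) (g n))" for a :: "'k c0"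
    unfolding summable_Cauchy
  proof (intro allI impI)
    fix e :: real assume e: "e > 0"
    have "apply_C0 a \<longlonglongrightarrow> 0" using range_apply_c0[where 'k='k] by blast
    then have "\<forall>\<^sub>F n in sequentially. dist (apply_C0 a n) 0 < e / 2"
      by (rule tendstoD) (use e in simp)
    then obtain N where N: "\<And>n. n \<ge> N \<Longrightarrow> norm (apply_C0 a n) < e / 2"
      by (auto simp: eventually_sequentially)
    have "norm (\<Sum>n=m..<l. scaleC0 (apply_C0 a n) (g n)) < e" if "m \<ge> N" for m l
    proof -
      have "norm (\<Sum>n=m..<l. scaleC0 (apply_C0 a n) (g n)) \<le> e / 2"
        by (rule norm_disjoint_sum) (use e g disj N that in \<open>auto intro: less_imp_le\<close>)
      then show ?thesis using e by simp
    qed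
    then show "\<exists>N. \<forall>m\<ge>N. \<forall>n. norm (\<Sum>n=m..<n. scaleC0 (apply_C0 a n) (g n)) < e" by blast
  qed
  define v where "v a = (\<Sum>n. scaleC0 (apply_C0 a n) (g n))" for a :: "'k c0"
  have lim: "(\<lambda>N. \<Sum>n<N. scaleC0 (apply_C0 a n) (g n)) \<longlonglongrightarrow> v a" for a
    unfolding v_def by (rule summable_LIMSEQ[OF summ])
  have v_add: "v (a + b) = v a + v b" for a b
    unfolding v_def suminf_add[OF summ summ] by (simp add: C.scale_left_distrib)
  have blC: "bounded_linear (\<lambda>f::('a, 'k) C0. scaleC0 c f)" for c
    by (rule bounded_linear_intro[where K="norm c"])
      (auto simp: C.scale_right_distrib C.norm_scale mult.commute C.scale_of_real[symmetric] C.scale_left_commute)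
  have v_scale: "v (scaleC0 c a) = scaleC0 c (v a)" for c a
    unfolding v_def bounded_linear.suminf[OF blC summ] by simp
  have v_scaleR: "v (r *\<^sub>R a) = r *\<^sub>R v a" for r a
  proof -
    have "r *\<^sub>R a = scaleC0 (of_real r) a"
      by (rule apply_C0_eqI) (simp add: scaleR_conv_of_real)
    then show ?thesis by (simp add: v_scale C.scale_of_real)
  qed
  have v_norm: "norm (v a) \<le> norm a" for a
  proof (rule tendsto_upperbound[OF tendsto_norm[OF lim]])
    have "norm (\<Sum>n<N. scaleC0 (apply_C0 a n) (g n)) \<le> norm a" for N
      by (rule norm_disjoint_sum) (use g disj norm_apply_C0_le in auto)
    then show "\<forall>\<^sub>F N in sequentially. norm (\<Sum>n<N. scaleC0 (apply_C0 a n) (g n)) \<le> norm a" by simp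
  qed simp
  have bl: "bounded_linear v"
    by (rule bounded_linear_intro[where K=1]) (auto simp: v_add v_scaleR v_norm)
  have app: "blinfun_apply (Blinfun v) = v" by (rule bounded_linear_Blinfun_apply[OF bl])
  show thesis
  proof (rule that[of "Blinfun v"])
    show "Blinfun v \<in> bounded_operators scaleC0 scaleC0" by (simp add: bounded_operators_def app v_scale)
    show "norm (Blinfun v) \<le> 1" by (rule norm_blinfun_bound) (auto simp: app v_norm)
  qed (simp add: app lim)
qed

lemma sum_disjoint_apply_le:
  fixes f :: "'i \<Rightarrow> ('a::topological_space, 'k::real_or_complex) C0"
  assumes \<psi>: "\<psi> \<in> dual scaleC0" and J: "finite J"
    and disj: "\<And>i j x. i \<in> J \<Longrightarrow> j \<in> J \<Longrightarrow> i \<noteq> j \<Longrightarrow> apply_C0 (f i) x = 0 \<or> apply_C0 (f j) x = 0"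
    and f: "\<And>i. i \<in> J \<Longrightarrow> norm (f i) \<le> 1"
  shows "(\<Sum>j\<in>J. norm (blinfun_apply \<psi> (f j))) \<le> norm \<psi>"
proof -
  let ?f = "\<Sum>j\<in>J. scaleC0 (unit_conj (blinfun_apply \<psi> (f j))) (f j)"
  have "blinfun_apply \<psi> ?f = of_real (\<Sum>j\<in>J. norm (blinfun_apply \<psi> (f j)))"
    by (simp add: blinfun.sum_right dual_applyD[OF \<psi>])
  then have "(\<Sum>j\<in>J. norm (blinfun_apply \<psi> (f j))) = norm (blinfun_apply \<psi> ?f)"
    by (simp only: norm_of_real) (simp add: sum_nonneg)
  also have "\<dots> \<le> norm \<psi> * norm ?f" by (rule norm_blinfun)
  also have "\<dots> \<le> norm \<psi> * 1"
    by (intro mult_left_mono norm_disjoint_sum J disj f) auto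
  finally show ?thesis by simp
qed

text \<open>
  The functions \<^term>\<open>f i\<close> are combined with the signs of the coefficients of the blocks. As the coefficients of a block have absolute
  sum one, both the lower bound on the diagonal and the smallness off the diagonal survive.
\<close>

lemma almost_biorthogonal_blocks:
  fixes f :: "nat \<Rightarrow> ('a::topological_space, 'k::real_or_complex) C0"
    and x w :: "nat \<Rightarrow> 'x::real_normed_vector \<Rightarrow>\<^sub>L 'k" and T :: "('a, 'k) C0 \<Rightarrow>\<^sub>L 'x"
  assumes T: "T \<in> bounded_operators scaleC0 s" and w: "block_seq x w"
    and x: "\<And>i. x i \<in> dual_ball s"
    and f: "\<And>i. norm (f i) \<le> 1" "\<And>i j t. i \<noteq> j \<Longrightarrow> apply_C0 (f i) t = 0 \<or> apply_C0 (f j) t = 0"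
    and diag: "\<And>i. norm (blinfun_apply (x i) (blinfun_apply T (f i)) - of_real (\<sigma> i)) \<le> \<theta>" "\<And>i. c \<le> \<sigma> i"
    and off: "\<And>i J. finite J \<Longrightarrow> i \<notin> J \<Longrightarrow> (\<Sum>j\<in>J. norm (blinfun_apply (x i) (blinfun_apply T (f j)))) \<le> \<theta>"
  obtains g :: "nat \<Rightarrow> ('a, 'k) C0" where "\<And>n. norm (g n) \<le> 1"
    "\<And>m n t. m \<noteq> n \<Longrightarrow> apply_C0 (g m) t = 0 \<or> apply_C0 (g n) t = 0"
    "\<And>n. c - 2 * \<theta> \<le> norm (blinfun_apply (w n) (blinfun_apply T (g n)))"
    "\<And>n L. finite L \<Longrightarrow> n \<notin> L \<Longrightarrow> (\<Sum>l\<in>L. norm (blinfun_apply (w n) (blinfun_apply T (g l)))) \<le> \<theta>"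
proof -
  obtain p where p: "strict_mono p" "\<And>n. w n \<in> blocks x (p n) (p (Suc n))"
    using w by (auto simp: block_seq_def)
  define I where "I n = {p n..<p (Suc n)}" for n
  have "\<forall>n. \<exists>\<beta>. w n = (\<Sum>i\<in>I n. \<beta> i *\<^sub>R x i) \<and> (\<Sum>i\<in>I n. \<bar>\<beta> i\<bar>) = 1"
    using p(2) unfolding blocks_def I_def by blast
  then obtain \<beta> where \<beta>: "\<And>n. w n = (\<Sum>i\<in>I n. \<beta> n i *\<^sub>R x i)" "\<And>n. (\<Sum>i\<in>I n. \<bar>\<beta> n i\<bar>) = 1"
    by metis
  have I_fin: "finite (I n)" for n by (simp add: I_def)
  have I_disj: "I m \<inter> I n = {}" if "m \<noteq> n" for m n
  proof -
    have *: "I m \<inter> I n = {}" if "m < n" for m n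
    proof -
      have "p (Suc m) \<le> p n" using p(1) that by (simp add: strict_mono_less_eq)
      then show ?thesis by (auto simp: I_def)
    qed
    show ?thesis using *[of m n] *[of n m] that by (cases "m < n") (auto simp: Int_commute)
  qed
  define a where "a i j = blinfun_apply (x i) (blinfun_apply T (f j))" for i j
  define g where "g n = (\<Sum>j\<in>I n. scaleC0 (of_real (sgn (\<beta> n j))) (f j))" for n
  have T_s: "blinfun_apply T (scaleC0 r h) = s r (blinfun_apply T h)" for r h
    using T by (simp add: bounded_operators_def)
  have xd: "x i \<in> dual s" for i using x[of i] by (simp add: dual_ball_def)
  have wg: "blinfun_apply (w n) (blinfun_apply T (g l)) =
      (\<Sum>i\<in>I n. of_real (\<beta> n i) * (\<Sum>j\<in>I l. of_real (sgn (\<beta> l j)) * a i j))" for n l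
  proof -
    have "blinfun_apply (w n) (blinfun_apply T (g l)) =
        (\<Sum>j\<in>I l. \<Sum>i\<in>I n. of_real (\<beta> n i) * (of_real (sgn (\<beta> l j)) * a i j))"
      by (simp add: \<beta>(1)[of n] g_def blinfun.sum_left blinfun.sum_right blinfun.scaleR_left T_s
          dual_applyD[OF xd] a_def scaleR_conv_of_real)
    also have "\<dots> = (\<Sum>i\<in>I n. \<Sum>j\<in>I l. of_real (\<beta> n i) * (of_real (sgn (\<beta> l j)) * a i j))"
      by (rule sum.swap)
    finally show ?thesis by (simp only: sum_distrib_left)
  qed
  have row: "norm (\<Sum>j\<in>J. of_real (sgn (\<beta> l j)) * a i j) \<le> (\<Sum>j\<in>J. norm (a i j))" for J l i
  proof (rule sum_norm_le)
    fix j show "norm (of_real (sgn (\<beta> l j)) * a i j) \<le> norm (a i j)"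
      by (simp add: norm_mult sgn_if)
  qed
  show thesis
  proof (rule that[of g])
    show "norm (g n) \<le> 1" for n
      unfolding g_def by (rule norm_disjoint_sum) (use f I_fin in \<open>auto simp: sgn_if\<close>)
    have supp: "\<exists>j\<in>I n. apply_C0 (f j) t \<noteq> 0" if "apply_C0 (g n) t \<noteq> 0" for n t
    proof (rule ccontr)
      assume "\<not> ?thesis"
      then have "apply_C0 (g n) t = 0" by (simp add: g_def)
      with that show False by simp
    qed
    show "apply_C0 (g m) t = 0 \<or> apply_C0 (g n) t = 0" if "m \<noteq> n" for m n t
    proof (rule ccontr)
      assume "\<not> ?thesis"
      then obtain i j where "i \<in> I m" "apply_C0 (f i) t \<noteq> 0" "j \<in> I n" "apply_C0 (f j) t \<noteq> 0"
        using supp[of m t] supp[of n t] by blast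
      moreover have "i \<noteq> j" using I_disj[OF that] calculation by blast
      ultimately show False using f(2)[of i j t] by blast
    qed
    show "(\<Sum>l\<in>L. norm (blinfun_apply (w n) (blinfun_apply T (g l)))) \<le> \<theta>" if L: "finite L" "n \<notin> L" for n L
    proof -
      have "(\<Sum>l\<in>L. norm (blinfun_apply (w n) (blinfun_apply T (g l)))) \<le>
          (\<Sum>l\<in>L. \<Sum>i\<in>I n. \<bar>\<beta> n i\<bar> * (\<Sum>j\<in>I l. norm (a i j)))"
        unfolding wg
      proof (intro sum_mono sum_norm_le)
        fix l i show "norm (of_real (\<beta> n i) * (\<Sum>j\<in>I l. of_real (sgn (\<beta> l j)) * a i j)) \<le>
            \<bar>\<beta> n i\<bar> * (\<Sum>j\<in>I l. norm (a i j))"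
          unfolding norm_mult norm_of_real by (intro mult_left_mono row) simp
      qed
      also have "\<dots> = (\<Sum>i\<in>I n. \<Sum>l\<in>L. \<bar>\<beta> n i\<bar> * (\<Sum>j\<in>I l. norm (a i j)))"
        by (rule sum.swap)
      also have "\<dots> = (\<Sum>i\<in>I n. \<bar>\<beta> n i\<bar> * (\<Sum>j\<in>(\<Union>l\<in>L. I l). norm (a i j)))"
      proof (intro sum.cong refl)
        fix i
        have "(\<Sum>j\<in>(\<Union>l\<in>L. I l). norm (a i j)) = (\<Sum>l\<in>L. \<Sum>j\<in>I l. norm (a i j))"
          by (rule sum.UNION_disjoint) (use L(1) I_fin I_disj in auto)
        then show "(\<Sum>l\<in>L. \<bar>\<beta> n i\<bar> * (\<Sum>j\<in>I l. norm (a i j))) = \<bar>\<beta> n i\<bar> * (\<Sum>j\<in>(\<Union>l\<in>L. I l). norm (a i j))"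
          by (simp add: sum_distrib_left)
      qed
      also have "\<dots> \<le> (\<Sum>i\<in>I n. \<bar>\<beta> n i\<bar> * \<theta>)"
      proof (intro sum_mono mult_left_mono)
        fix i assume i: "i \<in> I n"
        have "i \<notin> I l" if "l \<in> L" for l
        proof -
          have "n \<noteq> l" using L(2) that by blast
          then show ?thesis using I_disj[of n l] i by blast
        qed
        then have "i \<notin> (\<Union>l\<in>L. I l)" by blast
        then show "(\<Sum>j\<in>(\<Union>l\<in>L. I l). norm (a i j)) \<le> \<theta>"
          unfolding a_def by (intro off) (use L(1) I_fin in auto)
      qed simp
      also have "\<dots> = \<theta>" by (simp add: sum_distrib_right[symmetric] \<beta>(2))
      finally show ?thesis .
    qed
    show "c - 2 * \<theta> \<le> norm (blinfun_apply (w n) (blinfun_apply T (g n)))" for n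
    proof -
      let ?S = "\<Sum>i\<in>I n. \<bar>\<beta> n i\<bar> * \<sigma> i"
      define E where "E i = of_real \<bar>\<beta> n i\<bar> * (a i i - of_real (\<sigma> i)) +
        of_real (\<beta> n i) * (\<Sum>j\<in>I n-{i}. of_real (sgn (\<beta> n j)) * a i j)" for i
      have "blinfun_apply (w n) (blinfun_apply T (g n)) = (\<Sum>i\<in>I n. of_real (\<bar>\<beta> n i\<bar> * \<sigma> i) + E i)"
        unfolding wg
      proof (intro sum.cong refl)
        fix i assume i: "i \<in> I n"
        have "(\<Sum>j\<in>I n. of_real (sgn (\<beta> n j)) * a i j) =
            of_real (sgn (\<beta> n i)) * a i i + (\<Sum>j\<in>I n-{i}. of_real (sgn (\<beta> n j)) * a i j)"
          by (rule sum.remove[OF I_fin i])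
        moreover have "of_real (\<beta> n i) * (of_real (sgn (\<beta> n i)) * a i i) = of_real \<bar>\<beta> n i\<bar> * a i i"
          by (simp add: sgn_if abs_if)
        ultimately show "of_real (\<beta> n i) * (\<Sum>j\<in>I n. of_real (sgn (\<beta> n j)) * a i j) = of_real (\<bar>\<beta> n i\<bar> * \<sigma> i) + E i"
          by (simp add: E_def algebra_simps)
      qed
      then have eq: "of_real ?S = blinfun_apply (w n) (blinfun_apply T (g n)) - (\<Sum>i\<in>I n. E i)"
        by (simp add: sum.distrib)
      have "norm (\<Sum>i\<in>I n. E i) \<le> (\<Sum>i\<in>I n. \<bar>\<beta> n i\<bar> * (2 * \<theta>))"
      proof (rule sum_norm_le)
        fix i assume i: "i \<in> I n"
        have "norm (E i) \<le> norm (of_real \<bar>\<beta> n i\<bar> * (a i i - of_real (\<sigma> i))) +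
            norm (of_real (\<beta> n i) * (\<Sum>j\<in>I n-{i}. of_real (sgn (\<beta> n j)) * a i j))"
          unfolding E_def by (rule norm_triangle_ineq)
        also have "\<dots> \<le> \<bar>\<beta> n i\<bar> * \<theta> + \<bar>\<beta> n i\<bar> * \<theta>"
          unfolding norm_mult norm_of_real abs_idempotent
        proof (intro add_mono mult_left_mono)
          show "norm (a i i - of_real (\<sigma> i)) \<le> \<theta>" unfolding a_def by (rule diag(1))
          have "(\<Sum>j\<in>I n-{i}. norm (a i j)) \<le> \<theta>"
            unfolding a_def by (rule off) (use I_fin in auto)
          then show "norm (\<Sum>j\<in>I n-{i}. of_real (sgn (\<beta> n j)) * a i j) \<le> \<theta>"
            using row[of n i "I n - {i}"] by linarith
        qed auto
        also have "\<dots> = \<bar>\<beta> n i\<bar> * (2 * \<theta>)" by (simp add: algebra_simps)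
        finally show "norm (E i) \<le> \<bar>\<beta> n i\<bar> * (2 * \<theta>)" .
      qed
      also have "\<dots> = 2 * \<theta>" by (simp add: sum_distrib_right[symmetric] \<beta>(2))
      finally have E: "norm (\<Sum>i\<in>I n. E i) \<le> 2 * \<theta>" .
      have "c = (\<Sum>i\<in>I n. \<bar>\<beta> n i\<bar> * c)" by (simp add: sum_distrib_right[symmetric] \<beta>(2))
      also have "\<dots> \<le> ?S" by (intro sum_mono mult_left_mono diag(2)) simp
      also have "?S \<le> norm (of_real ?S :: 'k)" unfolding norm_of_real by simp
      also have "\<dots> \<le> norm (blinfun_apply (w n) (blinfun_apply T (g n))) + norm (\<Sum>i\<in>I n. E i)"
        unfolding eq by (rule norm_triangle_ineq4)
      finally show ?thesis using E by linarith
    qed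
  qed
qed


theorem factorization_of_identity:
  fixes s :: "'k::real_or_complex \<Rightarrow> 'x::banach \<Rightarrow> 'x"
    and T :: "('a::t2_space, 'k) C0 \<Rightarrow>\<^sub>L 'x"
  assumes lc: "locally_compact_space (euclidean :: 'a topology)" and sc: "scattered (UNIV :: 'a set)"
    and s: "normed_space_over s"
    and X: "\<not> contains_copy_of_l1 s \<or> sequentially_compactin (weak_star_topology s) (dual_ball s)"
    and T: "T \<in> bounded_operators scaleC0 s"
    and c: "0 < c" "c < dual_essential_norm s scaleC0 (adjoint_op T)"
  shows "\<exists>(U :: 'x \<Rightarrow>\<^sub>L 'k c0) (V :: 'k c0 \<Rightarrow>\<^sub>L ('a, 'k) C0). U \<in> bounded_operators s scaleC0 \<and>
    V \<in> bounded_operators scaleC0 scaleC0 \<and> U o\<^sub>L T o\<^sub>L V = id_blinfun \<and>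
    c \<le> inverse (norm U) * inverse (norm V)"
proof -
  obtain d where d: "c < d" "d < dual_essential_norm s scaleC0 (adjoint_op T)"
    using dense[OF c(2)] by blast
  \<comment> \<open>One part is lost for the neighbourhoods, two for the diagonal and one for inverting \<open>I + E\<close>.\<close>
  define \<theta> where "\<theta> = (d - c) / 4"
  have "4 * \<theta> = d - c" by (simp add: \<theta>_def)
  then have \<theta>: "\<theta> > 0" "d = c + 4 * \<theta>" using d(1) by linarith+
  define m where "m \<phi> k = norm (point_mass (adjoint_op T \<phi>) k)" for \<phi> k
  obtain y :: "nat \<Rightarrow> 'x \<Rightarrow>\<^sub>L 'k" and G :: "nat \<Rightarrow> 'a set" where y: "\<And>n. finite (G n)"
    "\<And>n. y n \<in> dual_ball s \<and> d < (\<Sum>k\<in>G n. m (y n) k)" "\<And>i j. i \<noteq> j \<Longrightarrow> G i \<inter> G j = {}"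
  proof (rule disjoint_choice[of "\<lambda>\<phi> G. \<phi> \<in> dual_ball s \<and> d < (\<Sum>k\<in>G. m \<phi> k)"])
    show "\<exists>\<phi> G. finite G \<and> G \<inter> F = {} \<and> \<phi> \<in> dual_ball s \<and> d < (\<Sum>k\<in>G. m \<phi> k)" if "finite F" for F
      using large_outside_finite_set[OF lc sc T d(2) that] unfolding m_def by blast
  qed (rule that)
  have yd: "adjoint_op T (y n) \<in> dual scaleC0" for n
    using y(2)[of n] adjoint_op_dual[OF T] by (simp add: dual_ball_def)
  have m_le: "(\<Sum>k\<in>G n. m (y n) k) \<le> norm T" for n
    using sum_point_mass_le[OF lc yd y(1)] norm_adjoint_op_le[of "y n" s T] y(2)[of n]
    unfolding m_def by (meson order_trans)
  have m0: "0 \<le> m (y n) k" for n k by (simp add: m_def)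
  have big: "d < (\<Sum>k\<in>G n. m (y n) k)" for n using y(2) by blast
  obtain r :: "nat \<Rightarrow> nat" and H W :: "nat \<Rightarrow> 'a set" where r: "strict_mono r"
    "\<And>j. finite (H j)" "\<And>j. open (W j)" "\<And>j. H j \<subseteq> W j" "\<And>j l. j \<noteq> l \<Longrightarrow> W j \<inter> W l = {}"
    "\<And>j. d - \<theta> < (\<Sum>k\<in>H j. m (y (r j)) k)"
    by (rule disjoint_neighbourhoods[OF lc y(1) _ m0 m_le big \<theta>(1)], erule y(3)) (rule that)
  have "\<exists>f. norm f \<le> 1 \<and> (\<forall>t. t \<notin> W j \<longrightarrow> apply_C0 f t = 0) \<and>
      norm (blinfun_apply (adjoint_op T (y (r j))) f - of_real (\<Sum>k\<in>H j. m (y (r j)) k)) \<le> \<theta>" for j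
    by (rule point_masses_attained[OF lc yd r(2-4) \<theta>(1), of j "r j"]) (auto simp: m_def)
  then obtain f :: "nat \<Rightarrow> ('a, 'k) C0" where f: "\<And>j. norm (f j) \<le> 1"
    "\<And>j t. t \<notin> W j \<Longrightarrow> apply_C0 (f j) t = 0"
    "\<And>j. norm (blinfun_apply (adjoint_op T (y (r j))) (f j) - of_real (\<Sum>k\<in>H j. m (y (r j)) k)) \<le> \<theta>"
    by metis
  have f_disj: "apply_C0 (f i) t = 0 \<or> apply_C0 (f j) t = 0" if "i \<noteq> j" for i j t
    using r(5)[OF that] f(2)[of t i] f(2)[of t j] by blast
  have row: "(\<Sum>j\<in>J. norm (blinfun_apply (adjoint_op T (y (r i))) (f j))) \<le> norm T" if "finite J" for i J
    using sum_disjoint_apply_le[OF yd that, of f "r i"] f(1) f_disj norm_adjoint_op_le[of "y (r i)" s T] y(2)[of "r i"]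
    by (meson order_trans)
  obtain r2 :: "nat \<Rightarrow> nat" where r2: "strict_mono r2"
    "\<And>i J. finite J \<Longrightarrow> i \<notin> J \<Longrightarrow>
      (\<Sum>j\<in>J. norm (blinfun_apply (adjoint_op T (y (r (r2 i)))) (f (r2 j)))) \<le> \<theta>"
    using rosenthal_selection[of "\<lambda>i j. norm (blinfun_apply (adjoint_op T (y (r i))) (f j))" "norm T" \<theta>] row \<theta>(1)
    by blast
  define x where "x i = y (r (r2 i))" for i
  have x: "x i \<in> dual_ball s" for i using y(2) by (simp add: x_def)
  obtain w where w: "block_seq x w" "\<And>u. (\<lambda>n. blinfun_apply (w n) u) \<longlonglongrightarrow> 0"
    using weak_star_null_block_seq[OF s X, of x] x by blast
  have wball: "w n \<in> dual_ball s" for n by (rule block_seq_dual_ball[OF w(1) x])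
  obtain g :: "nat \<Rightarrow> ('a, 'k) C0" where g: "\<And>n. norm (g n) \<le> 1"
    "\<And>m n t. m \<noteq> n \<Longrightarrow> apply_C0 (g m) t = 0 \<or> apply_C0 (g n) t = 0"
    "\<And>n. (d - \<theta>) - 2 * \<theta> \<le> norm (blinfun_apply (w n) (blinfun_apply T (g n)))"
    "\<And>n L. finite L \<Longrightarrow> n \<notin> L \<Longrightarrow> (\<Sum>l\<in>L. norm (blinfun_apply (w n) (blinfun_apply T (g l)))) \<le> \<theta>"
  proof (rule almost_biorthogonal_blocks[OF T w(1) x, of "\<lambda>i. f (r2 i)" "\<lambda>i. \<Sum>k\<in>H (r2 i). m (x i) k" \<theta> "d - \<theta>"])
    show "norm (f (r2 i)) \<le> 1" for i by (rule f(1))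
    show "apply_C0 (f (r2 i)) t = 0 \<or> apply_C0 (f (r2 j)) t = 0" if "i \<noteq> j" for i j t
      using f_disj that r2(1) by (simp add: strict_mono_eq)
    show "norm (blinfun_apply (x i) (blinfun_apply T (f (r2 i))) - of_real (\<Sum>k\<in>H (r2 i). m (x i) k)) \<le> \<theta>" for i
      using f(3)[of "r2 i"] by (simp add: x_def)
    show "d - \<theta> \<le> (\<Sum>k\<in>H (r2 i). m (x i) k)" for i
      using r(6)[of "r2 i"] by (simp add: x_def)
    show "(\<Sum>j\<in>J. norm (blinfun_apply (x i) (blinfun_apply T (f (r2 j))))) \<le> \<theta>" if "finite J" "i \<notin> J" for i J
      using r2(2)[OF that] by (simp add: x_def)
  qed (rule that)
  define \<kappa> where "\<kappa> = c + \<theta>"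
  have \<kappa>: "\<kappa> > 0" using c(1) \<theta>(1) by (simp add: \<kappa>_def)
  define \<alpha> where "\<alpha> n = blinfun_apply (w n) (blinfun_apply T (g n))" for n
  have \<alpha>: "\<kappa> \<le> norm (\<alpha> n)" for n using g(3)[of n] \<theta>(2) by (simp add: \<alpha>_def \<kappa>_def)
  then have \<alpha>0: "\<alpha> n \<noteq> 0" for n using \<kappa> by (metis norm_zero not_less)
  have inv\<alpha>: "norm (1 / \<alpha> n) \<le> 1 / \<kappa>" for n
    using \<alpha>[of n] \<kappa> by (simp add: norm_divide frac_le)
  define w' where "w' n = dual_scale (1 / \<alpha> n) (w n)" for n
  have w'd: "w' n \<in> dual s" for n
    unfolding w'_def using wball[of n] by (intro dual_scale_in_dual) (simp add: dual_ball_def)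
  have w'n: "norm (w' n) \<le> 1 / \<kappa>" for n
  proof (rule norm_blinfun_bound)
    fix u
    have "norm (1 / \<alpha> n) * norm (blinfun_apply (w n) u) \<le> 1 / \<kappa> * norm u"
      using inv\<alpha> norm_apply_dual_ball_le[OF wball] \<kappa> by (intro mult_mono) auto
    then show "norm (blinfun_apply (w' n) u) \<le> 1 / \<kappa> * norm u"
      by (simp add: w'_def norm_mult[symmetric])
  qed (use \<kappa> in simp)
  have w'null: "(\<lambda>n. blinfun_apply (w' n) u) \<longlonglongrightarrow> 0" for u
  proof (rule tendsto_norm_zero_cancel, rule tendsto_sandwich[OF _ _ tendsto_const])
    show "\<forall>\<^sub>F n in sequentially. norm (blinfun_apply (w' n) u) \<le> 1 / \<kappa> * norm (blinfun_apply (w n) u)"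
    proof (intro always_eventually allI)
      fix n
      have "norm (1 / \<alpha> n) * norm (blinfun_apply (w n) u) \<le> 1 / \<kappa> * norm (blinfun_apply (w n) u)"
        using inv\<alpha> by (intro mult_right_mono) auto
      then show "norm (blinfun_apply (w' n) u) \<le> 1 / \<kappa> * norm (blinfun_apply (w n) u)"
        by (simp add: w'_def norm_mult[symmetric])
    qed
    show "(\<lambda>n. 1 / \<kappa> * norm (blinfun_apply (w n) u)) \<longlonglongrightarrow> 0"
      using tendsto_mult[OF tendsto_const[of "1 / \<kappa>"] tendsto_norm[OF w(2)[of u]]] by simp
  qed auto
  obtain U :: "'x \<Rightarrow>\<^sub>L 'k c0" where U: "U \<in> bounded_operators s scaleC0" "norm U \<le> 1 / \<kappa>"
    "\<And>u n. apply_C0 (blinfun_apply U u) n = blinfun_apply (w' n) u"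
    by (rule operator_into_c0[OF w'd w'n w'null]) (rule that)
  obtain V :: "'k c0 \<Rightarrow>\<^sub>L ('a, 'k) C0" where V: "V \<in> bounded_operators scaleC0 scaleC0" "norm V \<le> 1"
    "\<And>a. (\<lambda>N. \<Sum>n<N. scaleC0 (apply_C0 a n) (g n)) \<longlonglongrightarrow> blinfun_apply V a"
    by (rule operator_from_c0[of g, OF g(1)], erule g(2)) (rule that)
  define A where "A = U o\<^sub>L T o\<^sub>L V"
  define q where "q = \<theta> / \<kappa>"
  have q: "0 \<le> q" "q < 1" using \<theta>(1) c(1) \<kappa> by (simp_all add: q_def \<kappa>_def)
  have T_s: "blinfun_apply T (scaleC0 b h) = s b (blinfun_apply T h)" for b h
    using T by (simp add: bounded_operators_def)
  have near: "norm (blinfun_apply A a - a) \<le> q * norm a" for a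
  proof (rule norm_C0_le)
    fix n
    let ?P = "\<lambda>N. blinfun_apply (w' n) (blinfun_apply T (\<Sum>l<N. scaleC0 (apply_C0 a l) (g l))) - apply_C0 a n"
    have lim: "?P \<longlonglongrightarrow> blinfun_apply (w' n) (blinfun_apply T (blinfun_apply V a)) - apply_C0 a n"
      by (intro tendsto_intros V(3))
    have "norm (?P N) \<le> q * norm a" if "n < N" for N
    proof -
      have w'g: "blinfun_apply (w' n) (blinfun_apply T (g n)) = 1"
        using \<alpha>0[of n] by (simp add: w'_def \<alpha>_def)
      have "blinfun_apply (w' n) (blinfun_apply T (\<Sum>l<N. scaleC0 (apply_C0 a l) (g l))) =
          (\<Sum>l<N. apply_C0 a l * blinfun_apply (w' n) (blinfun_apply T (g l)))"
        by (simp add: blinfun.sum_right T_s dual_applyD[OF w'd])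
      also have "\<dots> = apply_C0 a n * blinfun_apply (w' n) (blinfun_apply T (g n)) +
          (\<Sum>l\<in>{..<N}-{n}. apply_C0 a l * blinfun_apply (w' n) (blinfun_apply T (g l)))"
        by (rule sum.remove) (use that in auto)
      finally have "?P N = (\<Sum>l\<in>{..<N}-{n}. apply_C0 a l * blinfun_apply (w' n) (blinfun_apply T (g l)))"
        by (simp add: w'g)
      also have "norm \<dots> \<le> (\<Sum>l\<in>{..<N}-{n}. norm a * (1 / \<kappa> * norm (blinfun_apply (w n) (blinfun_apply T (g l)))))"
      proof (rule sum_norm_le)
        fix l
        have "norm (1 / \<alpha> n) * norm (blinfun_apply (w n) (blinfun_apply T (g l))) \<le> 1 / \<kappa> * norm (blinfun_apply (w n) (blinfun_apply T (g l)))"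
          using inv\<alpha> by (intro mult_right_mono) auto
        then have "norm (blinfun_apply (w' n) (blinfun_apply T (g l))) \<le> 1 / \<kappa> * norm (blinfun_apply (w n) (blinfun_apply T (g l)))"
          by (simp add: w'_def norm_mult[symmetric])
        then show "norm (apply_C0 a l * blinfun_apply (w' n) (blinfun_apply T (g l))) \<le>
            norm a * (1 / \<kappa> * norm (blinfun_apply (w n) (blinfun_apply T (g l))))"
          unfolding norm_mult by (intro mult_mono norm_apply_C0_le) auto
      qed
      also have "\<dots> = norm a * (1 / \<kappa> * (\<Sum>l\<in>{..<N}-{n}. norm (blinfun_apply (w n) (blinfun_apply T (g l)))))"
        by (simp only: sum_distrib_left)
      also have "\<dots> \<le> norm a * (1 / \<kappa> * \<theta>)"
        using \<kappa> by (intro mult_left_mono g(4)) auto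
      finally show ?thesis by (simp add: q_def mult.commute)
    qed
    then have "\<forall>\<^sub>F N in sequentially. norm (?P N) \<le> q * norm a"
      by (intro eventually_sequentiallyI[of "Suc n"]) auto
    from tendsto_upperbound[OF tendsto_norm[OF lim] this]
    show "norm (apply_C0 (blinfun_apply A a - a) n) \<le> q * norm a" by (simp add: A_def U(3))
  qed
  have A: "A \<in> bounded_operators scaleC0 scaleC0"
    using U(1) V(1) T by (simp add: bounded_operators_def A_def)
  obtain R :: "'k c0 \<Rightarrow>\<^sub>L 'k c0" where R: "R \<in> bounded_operators scaleC0 scaleC0" "R o\<^sub>L A = id_blinfun" "norm R \<le> 1 / (1 - q)"
    by (rule left_inverse_near_identity[OF A near q]) (rule that)
  define U' where "U' = R o\<^sub>L U"
  have eq: "U' o\<^sub>L T o\<^sub>L V = id_blinfun"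
  proof (rule blinfun_eqI)
    fix a
    show "blinfun_apply (U' o\<^sub>L T o\<^sub>L V) a = blinfun_apply id_blinfun a"
      using arg_cong[OF R(2), of "\<lambda>B. blinfun_apply B a"] by (simp add: U'_def A_def)
  qed
  have "norm U' \<le> norm R * norm U" unfolding U'_def by (rule norm_blinfun_compose)
  also have "\<dots> \<le> 1 / (1 - q) * (1 / \<kappa>)" using R(3) U(2) q by (intro mult_mono) auto
  also have "\<dots> = 1 / c"
  proof -
    have "(1 - q) * \<kappa> = c" using \<kappa> by (simp add: q_def left_diff_distrib) (simp add: \<kappa>_def)
    then have "1 / c = 1 / ((1 - q) * \<kappa>)" by simp
    then show ?thesis by simp
  qed
  finally have U'n: "norm U' \<le> 1 / c" .
  have "norm U' \<noteq> 0" and V0: "norm V \<noteq> 0"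
  proof -
    obtain e :: "'k c0" where "\<forall>i. apply_C0 e i = (if i = 0 then 1 else 0)"
      using c0_unit_vector[of 0, where 'k='k] ..
    then have "apply_C0 e 0 = 1" by simp
    then have e: "e \<noteq> 0" by auto
    have "blinfun_apply U' (blinfun_apply T (blinfun_apply V e)) = e"
      using arg_cong[OF eq, of "\<lambda>B. blinfun_apply B e"] by simp
    then show "norm U' \<noteq> 0" "norm V \<noteq> 0" using e by (auto simp: blinfun.zero_right)
  qed
  then have "c \<le> inverse (norm U')"
    using U'n c(1) by (simp add: field_simps)
  moreover have "1 \<le> inverse (norm V)" using V(2) V0 by (simp add: one_le_inverse_iff)
  ultimately have "c * 1 \<le> inverse (norm U') * inverse (norm V)"
    using c(1) by (intro mult_mono) auto
  moreover have "U' \<in> bounded_operators s scaleC0"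
    using R(1) U(1) by (simp add: bounded_operators_def U'_def)
  ultimately show ?thesis using V(1) eq by auto
qed

theorem theorem1p7:
  fixes scale :: "'k::real_or_complex \<Rightarrow> 'x::banach \<Rightarrow> 'x"
    and T :: "('a::t2_space, 'k) C0 \<Rightarrow>\<^sub>L 'x"
  assumes "locally_compact_space (euclidean :: 'a topology)"
    and "scattered (UNIV :: 'a set)"
    and "normed_space_over scale"
    and "\<not> contains_copy_of_l1 scale \<or>
         sequentially_compactin (weak_star_topology scale) (dual_ball scale)"
    and "T \<in> bounded_operators scaleC0 scale"
    and "\<not> compact_operator T"
  shows "ereal (dual_essential_norm scale scaleC0 (adjoint_op T)) =
    Sup {ereal (inverse (norm U) * inverse (norm V)) | U V.
           U \<in> bounded_operators scale (scaleC0 :: 'k \<Rightarrow> 'k c0 \<Rightarrow> 'k c0) \<and>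
           V \<in> bounded_operators (scaleC0 :: 'k \<Rightarrow> 'k c0 \<Rightarrow> 'k c0)
                 (scaleC0 :: 'k \<Rightarrow> ('a, 'k) C0 \<Rightarrow> ('a, 'k) C0) \<and>
           U o\<^sub>L T o\<^sub>L V = id_blinfun}"
    (is "ereal ?e = Sup ?M")
proof (rule antisym)
  have pos: "?e > 0" by (rule essential_norm_pos[OF assms(3,6)])
  show "ereal ?e \<le> Sup ?M"
  proof (rule dense_le)
    fix b assume b: "b < ereal ?e"
    obtain c where c: "0 < c" "b \<le> ereal c" "c < ?e"
    proof (cases b)
      case (real b')
      define M where "M = max 0 b'"
      define c where "c = (M + ?e) / 2"
      have "M < ?e" using b pos real by (simp add: M_def)
      moreover have "0 \<le> M" "b' \<le> M" by (simp_all add: M_def)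
      ultimately have "0 < c" "b' \<le> c" "c < ?e" using pos by (simp_all add: c_def)
      then show ?thesis using that[of c] real by simp
    next
      case PInf
      then show ?thesis using b by simp
    next
      case MInf
      then show ?thesis using that[of "?e / 2"] pos by simp
    qed
    obtain U :: "'x \<Rightarrow>\<^sub>L 'k c0" and V :: "'k c0 \<Rightarrow>\<^sub>L ('a, 'k) C0" where UV:
      "U \<in> bounded_operators scale scaleC0" "V \<in> bounded_operators scaleC0 scaleC0"
      "U o\<^sub>L T o\<^sub>L V = id_blinfun" "c \<le> inverse (norm U) * inverse (norm V)"
      using factorization_of_identity[OF assms(1-5) c(1,3)] by blast
    have "b \<le> ereal (inverse (norm U) * inverse (norm V))"
      using c(2) UV(4) order_trans by fastforce
    also have "\<dots> \<le> Sup ?M" by (rule Sup_upper) (use UV in blast)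
    finally show "b \<le> Sup ?M" .
  qed
  show "Sup ?M \<le> ereal ?e"
    by (rule Sup_least) (use factorization_le_essential_norm[OF assms(3)] in auto)
qed

end
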